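(* Let $\alpha>0$, $\beta\ge 0$ and $\delta>0$. Then there exists a minimizer of $J$ in $S\times W_0^{1,2}((0,T))^K$ subject to the constraint that all $c_k$ are nonnegative almost everywhere; that is, $J$ attains its minimum over the set $$\left\{(u,c)\in S\times W_0^{1,2}((0,T))^K:\ c_k\ge 0 \text{ a.e. on } (0,T),\ k=1,\dots,K\right\}.$$
   Context: Setting. $\Omega\subset\mathbb{R}^d$ ($d=2$ or $d=3$) is the region of interest, assumed bounded and such that $BV(\Omega)$ embeds compactly into $L^1(\Omega)$; $T>0$; $K\in\mathbb{N}$ is a fixed number of subregions. $BV(\Omega)$ is the space of functions of bounded variation; $|v|_{BV(\Omega)}$ denotes the total variation (seminorm) of $v$. Operator. $\mathcal{R}$ is the (linear) attenuated Radon transform, mapping an image sequence $f$ on $\Omega\times[0,T]$ to a sinogram on $\Sigma\times[0,T]$, where $\Sigma$ is the set of parameters $(\theta,s)$ of the measured lines, and acting at each time $t$ by $$\mathcal{R}f(\theta,s,t)=\int_{L(\theta,s)} f(x,t)\,e^{-\int_{H(x)}\mu(y)\,dy}\,dx,$$ where $L(\theta,s)=\{r\theta+s\theta^{\perp}: r\in\mathbb{R}\}$ (with the camera direction $\theta$, given by an angle in $[0,2\pi)$, and the detector bin position $s\in\mathbb{R}$), $H(x)$ is the section of the line $L(\theta,s)$ between $x$ and the collimator, and $\mu:\Omega\to[0,\infty)$ is a known attenuation map. For $u=(u_1,\dots,u_K)$ and $c=(c_1,\dots,c_K)$ write $uc(x,t)=\sum_{k=1}^K u_k(x)c_k(t)$.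 The data $g$ is a function on $\Sigma\times[0,T]$ with $\log(g)\in L^1(\Sigma\times[0,T])$. The Kullback-Leibler divergence is $$KL(\mathcal{R}uc,g)=\int_\Sigma\int_0^T\left(\mathcal{R}uc-g+g\log\left(\frac{g}{\mathcal{R}uc}\right)\right),$$ with the integrand understood as $+\infty$ where $\mathcal{R}uc\le 0$ (note $g>0$ a.e.), so that $KL$ takes values in $[0,+\infty]$. Constraint set for $u$: $S=\{v=(v_1,\dots,v_K)\in BV(\Omega)^K:\ \sum_{k=1}^K v_k(x)=1 \text{ and } v_k(x)\in[0,1]\text{ for all } k, \text{ for (almost) all } x\in\Omega\}$. Functional: $J:BV(\Omega)^K\times W_0^{1,2}((0,T))^K\to\mathbb{R}\cup\{+\infty\}$, $$J(u,c)=KL(\mathcal{R}uc,g)+\alpha\sum_{k=1}^K|u_k|_{BV(\Omega)}+\beta\sum_{k=1}^K\|u_k\|_{L^1(\Omega)}+\frac{\delta}{2}\sum_{k=1}^K\left\|\frac{\partial c_k}{\partial t}\right\|^2_{L^2((0,T))}.$$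
   Formalization: For d = 3, where the lines L(θ,s) with s real would all lie in one plane (a null set, so R is undefined on BV classes), the detector bin position is taken as a pair (s,z) and L(θ,s) is the planar line in the slice at height z. *)

theory Defs
  imports "HOL-Analysis.Analysis"
begin

text \<open>
  Function spaces are rendered by Borel functions defined everywhere; values outside the domain
  are irrelevant and pointwise constraints are imposed almost everywhere. Every Lebesgue class
  has a Borel representative, and Borel functions restrict to Borel functions on lines.
\<close>

section \<open>Functions of bounded variation\<close>

definition divergence :: "('a::euclidean_space \<Rightarrow> 'a) \<Rightarrow> 'a \<Rightarrow> real" where
  "divergence \<phi> x = (\<Sum>b\<in>Basis. frechet_derivative \<phi> (at x) b \<bullet> b)"

definition C1_compact_support :: "'a::euclidean_space set \<Rightarrow> ('a \<Rightarrow> 'a) set" where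
  "C1_compact_support \<Omega> = {\<phi>. (\<forall>x. \<phi> differentiable (at x)) \<and>
      (\<forall>b\<in>Basis. continuous_on UNIV (\<lambda>x. frechet_derivative \<phi> (at x) b)) \<and>
      (\<exists>C. compact C \<and> C \<subseteq> \<Omega> \<and> (\<forall>x. x \<notin> C \<longrightarrow> \<phi> x = 0))}"

definition total_variation :: "'a::euclidean_space set \<Rightarrow> ('a \<Rightarrow> real) \<Rightarrow> ereal" where
  "total_variation \<Omega> v =
     (SUP \<phi>\<in>{\<phi>\<in>C1_compact_support \<Omega>. \<forall>x. norm (\<phi> x) \<le> 1}.
        ereal (LINT x:\<Omega>|lborel. v x * divergence \<phi> x))"

definition L1_norm :: "'a::euclidean_space set \<Rightarrow> ('a \<Rightarrow> real) \<Rightarrow> real" where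
  "L1_norm \<Omega> v = (LINT x:\<Omega>|lborel. \<bar>v x\<bar>)"

definition BV :: "'a::euclidean_space set \<Rightarrow> ('a \<Rightarrow> real) set" where
  "BV \<Omega> = {v. set_integrable lborel \<Omega> v \<and> total_variation \<Omega> v < \<infinity>}"

definition BV_compact_in_L1 :: "'a::euclidean_space set \<Rightarrow> bool" where
  "BV_compact_in_L1 \<Omega> \<longleftrightarrow>
     (\<forall>v :: nat \<Rightarrow> 'a \<Rightarrow> real.
        (\<forall>n. v n \<in> BV \<Omega>) \<and>
        (\<exists>B::real. \<forall>n. ereal (L1_norm \<Omega> (v n)) + total_variation \<Omega> (v n) \<le> ereal B) \<longrightarrow>
        (\<exists>w r. strict_mono r \<and> set_integrable lborel \<Omega> w \<and>
               (\<lambda>n. L1_norm \<Omega> (\<lambda>x. v (r n) x - w x)) \<longlonglongrightarrow> 0))"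


section \<open>The Sobolev space on the interval \<open>(0, T)\<close>\<close>

definition smooth_compact_support :: "real \<Rightarrow> (real \<Rightarrow> real) set" where
  "smooth_compact_support T = {\<phi>. (\<forall>n t. ((deriv ^^ n) \<phi>) differentiable (at t)) \<and>
      (\<exists>C. compact C \<and> C \<subseteq> {0<..<T} \<and> (\<forall>t. t \<notin> C \<longrightarrow> \<phi> t = 0))}"

definition L2 :: "real \<Rightarrow> (real \<Rightarrow> real) set" where
  "L2 T = {c. set_borel_measurable lborel {0<..<T} c \<and>
              set_integrable lborel {0<..<T} (\<lambda>t. (c t)\<^sup>2)}"

definition L2_norm :: "real \<Rightarrow> (real \<Rightarrow> real) \<Rightarrow> real" where
  "L2_norm T c = sqrt (LINT t:{0<..<T}|lborel. (c t)\<^sup>2)"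

definition is_weak_deriv :: "real \<Rightarrow> (real \<Rightarrow> real) \<Rightarrow> (real \<Rightarrow> real) \<Rightarrow> bool" where
  "is_weak_deriv T c d \<longleftrightarrow>
     (\<forall>\<phi>\<in>smooth_compact_support T.
        (LINT t:{0<..<T}|lborel. c t * deriv \<phi> t) = - (LINT t:{0<..<T}|lborel. d t * \<phi> t))"

definition W12 :: "real \<Rightarrow> (real \<Rightarrow> real) set" where
  "W12 T = {c \<in> L2 T. \<exists>d \<in> L2 T. is_weak_deriv T c d}"

text \<open>The weak derivative is determined up to null sets only; the choice does not affect norms.\<close>

definition weak_deriv :: "real \<Rightarrow> (real \<Rightarrow> real) \<Rightarrow> real \<Rightarrow> real" where
  "weak_deriv T c = (SOME d. d \<in> L2 T \<and> is_weak_deriv T c d)"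

definition W12_norm :: "real \<Rightarrow> (real \<Rightarrow> real) \<Rightarrow> real" where
  "W12_norm T c = sqrt ((L2_norm T c)\<^sup>2 + (L2_norm T (weak_deriv T c))\<^sup>2)"

definition W12_0 :: "real \<Rightarrow> (real \<Rightarrow> real) set" where
  "W12_0 T = {c \<in> W12 T. \<exists>\<phi>. (\<forall>n::nat. \<phi> n \<in> smooth_compact_support T) \<and>
                (\<lambda>n. W12_norm T (\<lambda>t. \<phi> n t - c t)) \<longlonglongrightarrow> 0}"


section \<open>The attenuated Radon transform\<close>

text \<open>
  A measured line is indexed by the camera angle together with the detector bin position, and
  \<open>line p\<close> is its arc length parametrization. In the plane the bin position is a number \<open>s\<close>.
  In space the camera rotates about the third axis and the bin position is a pair \<open>(s, z)\<close>
  whose second entry selects the slice at height \<open>z\<close>, in which the line is the planar one.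
\<close>

definition line_2d :: "real \<times> real \<Rightarrow> real \<Rightarrow> real^2" where
  "line_2d = (\<lambda>(\<theta>, s) r. r *\<^sub>R vector [cos \<theta>, sin \<theta>] + s *\<^sub>R vector [- sin \<theta>, cos \<theta>])"

definition line_3d :: "real \<times> (real \<times> real) \<Rightarrow> real \<Rightarrow> real^3" where
  "line_3d = (\<lambda>(\<theta>, s, z) r. r *\<^sub>R vector [cos \<theta>, sin \<theta>, 0] + s *\<^sub>R vector [- sin \<theta>, cos \<theta>, 0]
                            + z *\<^sub>R vector [0, 0, 1])"

text \<open>
  The collimator sits at \<open>line p (coll p)\<close>, so that the section between \<open>line p r\<close> and the
  collimator has parameters in \<open>closed_segment r (coll p)\<close>. The map \<open>\<mu>\<close> lives on \<open>\<Omega>\<close> only.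
  An infinite exponent gives the factor \<open>0\<close>.
\<close>

definition attenuation ::
  "('p \<Rightarrow> real \<Rightarrow> 'a) \<Rightarrow> ('p \<Rightarrow> real) \<Rightarrow> 'a set \<Rightarrow> ('a \<Rightarrow> real) \<Rightarrow> 'p \<Rightarrow> real \<Rightarrow> real" where
  "attenuation line coll \<Omega> \<mu> p r =
     (let I = (\<integral>\<^sup>+ q. ennreal (\<mu> (line p q)) *
                  indicator {q \<in> closed_segment r (coll p). line p q \<in> \<Omega>} q \<partial>lborel)
      in if I = \<infinity> then 0 else exp (- enn2real I))"

definition radon ::
  "('p \<Rightarrow> real \<Rightarrow> 'a) \<Rightarrow> ('p \<Rightarrow> real) \<Rightarrow> 'a set \<Rightarrow> ('a \<Rightarrow> real) \<Rightarrow>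
     ('a \<times> real \<Rightarrow> real) \<Rightarrow> 'p \<times> real \<Rightarrow> real" where
  "radon line coll \<Omega> \<mu> f = (\<lambda>(p, t).
     LINT r:{r. line p r \<in> \<Omega>}|lborel. f (line p r, t) * attenuation line coll \<Omega> \<mu> p r)"

definition image_seq ::
  "nat \<Rightarrow> (nat \<Rightarrow> 'a \<Rightarrow> real) \<Rightarrow> (nat \<Rightarrow> real \<Rightarrow> real) \<Rightarrow> 'a \<times> real \<Rightarrow> real" where
  "image_seq K u c = (\<lambda>(x, t). \<Sum>k=1..K. u k x * c k t)"


section \<open>The variational problem\<close>

text \<open>For \<open>a > 0\<close> and \<open>b > 0\<close> the argument of \<open>ennreal\<close> is nonnegative, so nothing is truncated.\<close>

definition KL_integrand :: "real \<Rightarrow> real \<Rightarrow> ennreal" where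
  "KL_integrand a b = (if a \<le> 0 then \<infinity> else ennreal (a - b + b * ln (b / a)))"

definition KL ::
  "'p::euclidean_space set \<Rightarrow> real \<Rightarrow> ('p \<times> real \<Rightarrow> real) \<Rightarrow> ('p \<times> real \<Rightarrow> real) \<Rightarrow> ennreal" where
  "KL \<Sigma> T F g = (\<integral>\<^sup>+ p\<in>\<Sigma>. (\<integral>\<^sup>+ t\<in>{0..T}. KL_integrand (F (p, t)) (g (p, t)) \<partial>lborel) \<partial>lborel)"

definition partition_constraint ::
  "'a::euclidean_space set \<Rightarrow> nat \<Rightarrow> (nat \<Rightarrow> 'a \<Rightarrow> real) set" where
  "partition_constraint \<Omega> K = {v. (\<forall>k\<in>{1..K}. v k \<in> BV \<Omega>) \<and>
     (AE x in lborel. x \<in> \<Omega> \<longrightarrow> (\<Sum>k=1..K. v k x) = 1 \<and> (\<forall>k\<in>{1..K}. v k x \<in> {0..1}))}"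

definition admissible ::
  "'a::euclidean_space set \<Rightarrow> real \<Rightarrow> nat \<Rightarrow> ((nat \<Rightarrow> 'a \<Rightarrow> real) \<times> (nat \<Rightarrow> real \<Rightarrow> real)) set" where
  "admissible \<Omega> T K = {(u, c). u \<in> partition_constraint \<Omega> K \<and>
     (\<forall>k\<in>{1..K}. c k \<in> W12_0 T \<and> (AE t in lborel. t \<in> {0<..<T} \<longrightarrow> 0 \<le> c k t))}"

definition J ::
  "('p::euclidean_space \<Rightarrow> real \<Rightarrow> 'a::euclidean_space) \<Rightarrow> ('p \<Rightarrow> real) \<Rightarrow> 'a set \<Rightarrow> 'p set \<Rightarrow>
     real \<Rightarrow> nat \<Rightarrow> ('a \<Rightarrow> real) \<Rightarrow> ('p \<times> real \<Rightarrow> real) \<Rightarrow> real \<Rightarrow> real \<Rightarrow> real \<Rightarrow>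
     (nat \<Rightarrow> 'a \<Rightarrow> real) \<Rightarrow> (nat \<Rightarrow> real \<Rightarrow> real) \<Rightarrow> ereal" where
  "J line coll \<Omega> \<Sigma> T K \<mu> g \<alpha> \<beta> \<delta> u c =
     enn2ereal (KL \<Sigma> T (radon line coll \<Omega> \<mu> (image_seq K u c)) g)
     + ereal \<alpha> * (\<Sum>k=1..K. total_variation \<Omega> (u k))
     + ereal (\<beta> * (\<Sum>k=1..K. L1_norm \<Omega> (u k)))
     + ereal (\<delta> / 2 * (\<Sum>k=1..K. (L2_norm T (weak_deriv T (c k)))\<^sup>2))"

locale dynamic_spect =
  fixes coll :: "real \<times> 'q::euclidean_space \<Rightarrow> real"
    and \<Omega> :: "'a::euclidean_space set"
    and \<Sigma> :: "(real \<times> 'q) set"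
    and T :: real
    and K :: nat
    and \<mu> :: "'a \<Rightarrow> real"
    and g :: "(real \<times> 'q) \<times> real \<Rightarrow> real"
  assumes open_domain: "open \<Omega>"
    and bounded_domain: "bounded \<Omega>"
    and compact_embedding: "BV_compact_in_L1 \<Omega>"
    and T_pos: "0 < T"
    and K_pos: "1 \<le> K"
    and lines_meas: "\<Sigma> \<in> sets borel"
    and lines_angle: "\<Sigma> \<subseteq> {0..<2 * pi} \<times> UNIV"
    and coll_meas: "coll \<in> borel_measurable borel"
    and attenuation_meas: "set_borel_measurable lborel \<Omega> \<mu>"
    and attenuation_nonneg: "\<And>x. x \<in> \<Omega> \<Longrightarrow> 0 \<le> \<mu> x"
    and data_meas: "set_borel_measurable lborel (\<Sigma> \<times> {0..T}) g"
    and data_pos: "AE y in lborel. y \<in> \<Sigma> \<times> {0..T} \<longrightarrow> 0 < g y"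
    and data_log: "set_integrable lborel (\<Sigma> \<times> {0..T}) (\<lambda>y. ln (g y))"

end

theory Submission
  imports Defs "HOL-Complex_Analysis.Great_Picard"
begin

text \<open>
  Direct method. Along a minimizing sequence the total variations of the \<open>u\<^sub>k\<close> and the \<open>L\<^sup>2\<close> norms of
  the weak derivatives of the \<open>c\<^sub>k\<close> are bounded, so after passing to a subsequence the \<open>u\<^sub>k\<close> converge
  almost everywhere by the compact embedding, and the \<open>c\<^sub>k\<close> converge pointwise because they are
  uniformly Hoelder continuous of order one half. That the limit of the \<open>c\<^sub>k\<close> stays in the closure of
  the test functions follows from convex combinations with strongly convergent derivatives (Mazur).
  A Lebesgue null set meets almost every measured line in a null set, so by dominated convergence
  the sinograms converge almost everywhere. Fatou's lemma then gives lower semicontinuity of the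
  Kullback-Leibler term, whose integrand is continuous with values in \<open>[0, \<infinity>]\<close>.
\<close>

section \<open>Square integrable functions\<close>

text \<open>The bounds do not come from \<open>J\<close> alone. The constraint
  \<open>u k x \<in> {0..1}\<close> on a bounded domain supplies the L1 bound that the compact
  embedding asks for, so \<open>\<beta> = 0\<close> is allowed, and zero boundary values let the
  derivative control \<open>c k\<close> itself. The sinogram is linear in the product of
  \<open>u\<close> and \<open>c\<close>, so \<open>J\<close> is not jointly convex and weak
  convergence in both variables would not pass through it. This is why pointwise convergence of both
  factors is extracted. Membership in \<open>W12_0 T\<close> is a statement about strong
  approximation, whereas a bounded sequence only has a limit in a weaker sense; the convex
  combinations serve only to place the limit in the space, and the sinograms are still taken along
  the original sequence. Variations and derivative norms are made convergent along the subsequence,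
  not merely bounded. Then the whole regularizing part converges, and subtracting it from the
  convergent values of \<open>J\<close> leaves a convergent Kullback-Leibler part, even though that
  part has no separate bound. An infinite infimum is no obstruction: every admissible pair is then a
  minimizer.\<close>

definition sq_integrable :: "'a measure \<Rightarrow> ('a \<Rightarrow> real) \<Rightarrow> bool" where
  "sq_integrable M f \<longleftrightarrow> f \<in> borel_measurable M \<and> integrable M (\<lambda>x. (f x)\<^sup>2)"

definition sq_norm :: "'a measure \<Rightarrow> ('a \<Rightarrow> real) \<Rightarrow> real" where
  "sq_norm M f = sqrt (LINT x|M. (f x)\<^sup>2)"

lemma sq_integrable_measurable: "sq_integrable M f \<Longrightarrow> f \<in> borel_measurable M"
  by (simp add: sq_integrable_def)

lemma sq_norm_nonneg [simp]: "0 \<le> sq_norm M f"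
  by (simp add: sq_norm_def)

lemma sq_norm_power2: "(sq_norm M f)\<^sup>2 = (LINT x|M. (f x)\<^sup>2)"
  by (simp add: sq_norm_def)

lemma sq_norm_minus_commute: "sq_norm M (\<lambda>x. f x - g x) = sq_norm M (\<lambda>x. g x - f x)"
  by (simp add: sq_norm_def power2_commute)

lemma integrable_mult_sq:
  assumes "sq_integrable M f" "sq_integrable M g"
  shows "integrable M (\<lambda>x. f x * g x)"
proof (rule Bochner_Integration.integrable_bound)
  have [measurable]: "f \<in> borel_measurable M" "g \<in> borel_measurable M"
    using assms by (auto simp: sq_integrable_def)
  show "(\<lambda>x. f x * g x) \<in> borel_measurable M"
    by measurable
  show "integrable M (\<lambda>x. (f x)\<^sup>2 + (g x)\<^sup>2)"
    using assms by (auto simp: sq_integrable_def)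
  show "AE x in M. norm (f x * g x) \<le> norm ((f x)\<^sup>2 + (g x)\<^sup>2)"
  proof (rule AE_I2)
    fix x
    have "2 * (\<bar>f x\<bar> * \<bar>g x\<bar>) \<le> (f x)\<^sup>2 + (g x)\<^sup>2"
      using sum_squares_bound[of "\<bar>f x\<bar>" "\<bar>g x\<bar>"] by (simp add: power2_eq_square algebra_simps)
    moreover have "0 \<le> \<bar>f x\<bar> * \<bar>g x\<bar>" by simp
    moreover have "norm ((f x)\<^sup>2 + (g x)\<^sup>2) = (f x)\<^sup>2 + (g x)\<^sup>2" by simp
    ultimately show "norm (f x * g x) \<le> norm ((f x)\<^sup>2 + (g x)\<^sup>2)"
      unfolding real_norm_def abs_mult by linarith
  qed
qed

lemma sq_integrable_add:
  assumes "sq_integrable M f" "sq_integrable M g"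
  shows "sq_integrable M (\<lambda>x. f x + g x)"
proof -
  have "integrable M (\<lambda>x. (f x)\<^sup>2 + (g x)\<^sup>2 + 2 * (f x * g x))"
    using assms integrable_mult_sq[OF assms] by (auto simp: sq_integrable_def)
  then show ?thesis
    using assms by (auto simp: sq_integrable_def power2_sum mult.assoc)
qed

lemma sq_integrable_cmult:
  assumes "sq_integrable M f"
  shows "sq_integrable M (\<lambda>x. a * f x)"
  using assms by (auto simp: sq_integrable_def power_mult_distrib)

lemma sq_integrable_diff:
  assumes "sq_integrable M f" "sq_integrable M g"
  shows "sq_integrable M (\<lambda>x. f x - g x)"
  using sq_integrable_add[OF assms(1) sq_integrable_cmult[OF assms(2), of "-1"]] by simp

lemma sq_norm_cong_AE:
  assumes "f \<in> borel_measurable M" "g \<in> borel_measurable M" "AE x in M. f x = g x"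
  shows "sq_norm M f = sq_norm M g"
  unfolding sq_norm_def using assms by (intro arg_cong[where f = sqrt] integral_cong_AE) auto

text \<open>Cauchy-Schwarz: integrating \<open>(s * f x + t * g x)\<^sup>2\<close> gives a quadratic
  form in \<open>s\<close> and \<open>t\<close> that is never negative.\<close>

lemma abs_integral_mult_le:
  assumes "sq_integrable M f" "sq_integrable M g"
  shows "\<bar>LINT x|M. f x * g x\<bar> \<le> sq_norm M f * sq_norm M g"
proof -
  let ?A = "LINT x|M. (f x)\<^sup>2" and ?B = "LINT x|M. (g x)\<^sup>2" and ?C = "LINT x|M. f x * g x"
  have q: "0 \<le> s\<^sup>2 * ?A + 2 * s * t * ?C + t\<^sup>2 * ?B" for s t :: real
  proof -
    have "0 \<le> (LINT x|M. (s * f x + t * g x)\<^sup>2)" by simp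
    also have "\<dots> = (LINT x|M. s\<^sup>2 * (f x)\<^sup>2 + 2 * s * t * (f x * g x) + t\<^sup>2 * (g x)\<^sup>2)"
      by (simp add: power2_sum power_mult_distrib algebra_simps)
    also have "\<dots> = s\<^sup>2 * ?A + 2 * s * t * ?C + t\<^sup>2 * ?B"
      using assms integrable_mult_sq[OF assms] by (simp add: sq_integrable_def)
    finally show ?thesis .
  qed
  have "?C\<^sup>2 \<le> ?A * ?B"
  proof (cases "?B = 0")
    case True
    have "?C = 0"
    proof (rule ccontr)
      assume C: "?C \<noteq> 0"
      show False
        \<comment> \<open>For \<open>?B = 0\<close> the form is affine in \<open>t\<close>, and this
          \<open>t\<close> gives it the value -1.\<close>
        using q[of 1 "- (?A + 1) / (2 * ?C)"] C True by (simp add: field_simps)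
    qed
    with True show ?thesis by simp
  next
    case False
    moreover have "0 \<le> ?B" by simp
    ultimately have "0 < ?B" by linarith
    \<comment> \<open>The choice \<open>s = ?B\<close>, \<open>t = - ?C\<close> makes
      \<open>?B\<close> a common factor.\<close>
    moreover have "0 \<le> ?B * (?A * ?B - ?C\<^sup>2)"
      using q[of "?B" "- ?C"] by (simp add: power2_eq_square algebra_simps)
    ultimately show ?thesis by (simp add: zero_le_mult_iff)
  qed
  then have "sqrt (?C\<^sup>2) \<le> sqrt (?A * ?B)" by (rule real_sqrt_le_mono)
  then show ?thesis by (simp add: sq_norm_def real_sqrt_mult)
qed

lemma sq_norm_triangle:
  assumes "sq_integrable M f" "sq_integrable M g"
  shows "sq_norm M (\<lambda>x. f x + g x) \<le> sq_norm M f + sq_norm M g"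
proof (rule power2_le_imp_le)
  have "(sq_norm M (\<lambda>x. f x + g x))\<^sup>2 = (LINT x|M. (f x)\<^sup>2 + (g x)\<^sup>2 + 2 * (f x * g x))"
    by (simp add: sq_norm_power2 power2_sum mult.assoc)
  also have "\<dots> = (sq_norm M f)\<^sup>2 + (sq_norm M g)\<^sup>2 + 2 * (LINT x|M. f x * g x)"
    using assms integrable_mult_sq[OF assms] by (simp add: sq_integrable_def sq_norm_power2)
  also have "\<dots> \<le> (sq_norm M f + sq_norm M g)\<^sup>2"
    using abs_integral_mult_le[OF assms] by (simp add: power2_sum)
  finally show "(sq_norm M (\<lambda>x. f x + g x))\<^sup>2 \<le> (sq_norm M f + sq_norm M g)\<^sup>2" .
qed simp

lemma abs_sq_norm_diff_le:
  assumes "sq_integrable M f" "sq_integrable M g"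
  shows "\<bar>sq_norm M f - sq_norm M g\<bar> \<le> sq_norm M (\<lambda>x. f x - g x)"
  using sq_norm_triangle[OF sq_integrable_diff[OF assms] assms(2)]
    sq_norm_triangle[OF sq_integrable_diff[OF assms(2,1)] assms(1)]
    sq_norm_minus_commute[of M f g] by simp

lemma sq_norm_parallelogram:
  assumes "sq_integrable M f" "sq_integrable M g"
  shows "(sq_norm M (\<lambda>x. f x - g x))\<^sup>2 =
    2 * (sq_norm M f)\<^sup>2 + 2 * (sq_norm M g)\<^sup>2 - 4 * (sq_norm M (\<lambda>x. (f x + g x) / 2))\<^sup>2"
proof -
  have i: "integrable M (\<lambda>x. (f x)\<^sup>2)" "integrable M (\<lambda>x. (g x)\<^sup>2)" "integrable M (\<lambda>x. f x * g x)"
    using assms integrable_mult_sq[OF assms] by (auto simp: sq_integrable_def)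
  have 1: "(sq_norm M (\<lambda>x. f x - g x))\<^sup>2 =
      (sq_norm M f)\<^sup>2 + (sq_norm M g)\<^sup>2 - 2 * (LINT x|M. f x * g x)"
    using i by (simp add: sq_norm_power2 power2_diff mult.assoc)
  have "(sq_norm M (\<lambda>x. (f x + g x) / 2))\<^sup>2 =
      (LINT x|M. ((f x)\<^sup>2 + (g x)\<^sup>2 + 2 * (f x * g x)) / 4)"
    by (simp add: sq_norm_power2 power_divide power2_sum mult.assoc)
  also have "\<dots> = ((sq_norm M f)\<^sup>2 + (sq_norm M g)\<^sup>2 + 2 * (LINT x|M. f x * g x)) / 4"
    using i by (simp add: sq_norm_power2)
  finally show ?thesis using 1 by simp
qed

lemma (in finite_measure) sq_integrable_const: "sq_integrable M (\<lambda>x. a)"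
  by (simp add: sq_integrable_def)

lemma (in finite_measure) sq_integrable_imp_integrable:
  assumes "sq_integrable M f"
  shows "integrable M f"
  using integrable_mult_sq[OF assms sq_integrable_const[of 1]] by simp

lemma (in finite_measure) integral_abs_le_sq_norm:
  assumes "sq_integrable M f"
  shows "(LINT x|M. \<bar>f x\<bar>) \<le> sqrt (measure M (space M)) * sq_norm M f"
proof -
  have "sq_integrable M (\<lambda>x. \<bar>f x\<bar>)"
    using assms by (auto simp: sq_integrable_def)
  from abs_integral_mult_le[OF sq_integrable_const[of 1] this]
  show ?thesis by (simp add: sq_norm_def)
qed

lemma (in finite_measure) AE_subseq_of_sq_norm_tendsto_0:
  assumes f: "\<And>n. sq_integrable M (f n)" and lim: "(\<lambda>n. sq_norm M (f n)) \<longlonglongrightarrow> 0"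
  obtains r :: "nat \<Rightarrow> nat" where "strict_mono r" "AE x in M. (\<lambda>n. f (r n) x) \<longlonglongrightarrow> 0"
proof -
  have "(\<lambda>n. LINT x|M. norm (f n x)) \<longlonglongrightarrow> 0"
  proof (rule tendsto_sandwich[where f = "\<lambda>_. 0"])
    show "(\<lambda>n. sqrt (measure M (space M)) * sq_norm M (f n)) \<longlonglongrightarrow> 0"
      using tendsto_mult_left[OF lim] by simp
    show "\<forall>\<^sub>F n in sequentially. 0 \<le> (LINT x|M. norm (f n x))" by simp
    show "\<forall>\<^sub>F n in sequentially. (LINT x|M. norm (f n x)) \<le> sqrt (measure M (space M)) * sq_norm M (f n)"
      using integral_abs_le_sq_norm[OF f] by simp
  qed simp
  from tendsto_L1_AE_subseq[OF sq_integrable_imp_integrable[OF f] this] that show thesis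
    by blast
qed

text \<open>Riesz-Fischer. On a finite measure space a Cauchy sequence in L2 is Cauchy in L1, so a
  subsequence converges almost everywhere; Fatou's lemma then shows that the pointwise limit is also
  the limit in L2.\<close>

lemma (in finite_measure) sq_norm_complete:
  assumes f: "\<And>n. sq_integrable M (f n)"
    and C: "\<And>e. e > 0 \<Longrightarrow> \<exists>N. \<forall>i\<ge>N. \<forall>j\<ge>N. sq_norm M (\<lambda>x. f i x - f j x) < e"
  obtains g where "sq_integrable M g" "(\<lambda>n. sq_norm M (\<lambda>x. f n x - g x)) \<longlonglongrightarrow> 0"
proof -
  let ?m = "sqrt (measure M (space M))"
  have [measurable]: "\<And>n. f n \<in> borel_measurable M"
    using f by (simp add: sq_integrable_def)
  have C1: "\<exists>N. \<forall>i\<ge>N. \<forall>j\<ge>N. (LINT x|M. norm (f i x - f j x)) < e" if "e > 0" for e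
  proof -
    \<comment> \<open>The summand 1 keeps the divisor positive on a space of measure 0.\<close>
    from C[of "e / (?m + 1)"] that
    obtain N where N: "\<And>i j. i \<ge> N \<Longrightarrow> j \<ge> N \<Longrightarrow> sq_norm M (\<lambda>x. f i x - f j x) < e / (?m + 1)"
      by (auto simp: add_nonneg_pos)
    have "(LINT x|M. norm (f i x - f j x)) < e" if ij: "i \<ge> N" "j \<ge> N" for i j
    proof -
      have "(LINT x|M. norm (f i x - f j x)) \<le> ?m * sq_norm M (\<lambda>x. f i x - f j x)"
        using integral_abs_le_sq_norm[OF sq_integrable_diff[OF f f]] by simp
      also have "\<dots> \<le> ?m * (e / (?m + 1))"
        using N[OF ij] by (intro mult_left_mono) auto
      also have "\<dots> < e"
        using \<open>e > 0\<close> by (simp add: divide_simps add_nonneg_eq_0_iff add_nonneg_pos)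
      finally show ?thesis .
    qed
    then show ?thesis by blast
  qed
  obtain r where r: "strict_mono r" and cau: "AE x in M. Cauchy (\<lambda>i. f (r i) x)"
    using cauchy_L1_AE_cauchy_subseq[OF sq_integrable_imp_integrable[OF f] C1] by blast
  define g where "g x = lim (\<lambda>i. f (r i) x)" for x
  have [measurable]: "g \<in> borel_measurable M"
    unfolding g_def by measurable
  have lim: "AE x in M. (\<lambda>i. f (r i) x) \<longlonglongrightarrow> g x"
    using cau by eventually_elim (simp add: g_def Cauchy_convergent_iff convergent_LIMSEQ_iff)
  have fatou: "(\<integral>\<^sup>+x. ennreal ((f i x - g x)\<^sup>2) \<partial>M) \<le> ennreal (e\<^sup>2)"
    if e: "e > 0" and N: "\<And>j. j \<ge> N \<Longrightarrow> sq_norm M (\<lambda>x. f i x - f j x) < e" for e i N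
  proof -
    have "(\<integral>\<^sup>+x. ennreal ((f i x - g x)\<^sup>2) \<partial>M) \<le>
        (\<integral>\<^sup>+x. liminf (\<lambda>j. ennreal ((f i x - f (r j) x)\<^sup>2)) \<partial>M)"
    proof (rule nn_integral_mono_AE)
      show "AE x in M. ennreal ((f i x - g x)\<^sup>2) \<le> liminf (\<lambda>j. ennreal ((f i x - f (r j) x)\<^sup>2))"
        using lim
      proof eventually_elim
        case (elim x)
        have "(\<lambda>j. ennreal ((f i x - f (r j) x)\<^sup>2)) \<longlonglongrightarrow> ennreal ((f i x - g x)\<^sup>2)"
          by (intro tendsto_intros elim)
        from lim_imp_Liminf[OF _ this] show ?case by simp
      qed
    qed
    also have "\<dots> \<le> liminf (\<lambda>j. \<integral>\<^sup>+x. ennreal ((f i x - f (r j) x)\<^sup>2) \<partial>M)"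
      by (rule nn_integral_liminf) measurable
    also have "\<dots> \<le> ennreal (e\<^sup>2)"
    proof (rule Liminf_le)
      show "\<forall>\<^sub>F j in sequentially. (\<integral>\<^sup>+x. ennreal ((f i x - f (r j) x)\<^sup>2) \<partial>M) \<le> ennreal (e\<^sup>2)"
      proof (rule eventually_sequentiallyI[of N])
        fix j assume "N \<le> j"
        then have "N \<le> r j" using seq_suble[OF r, of j] by linarith
        have "(\<integral>\<^sup>+x. ennreal ((f i x - f (r j) x)\<^sup>2) \<partial>M) = ennreal (LINT x|M. (f i x - f (r j) x)\<^sup>2)"
          using sq_integrable_diff[OF f[of i] f[of "r j"]]
          by (intro nn_integral_eq_integral) (auto simp: sq_integrable_def)
        also have "\<dots> \<le> ennreal (e\<^sup>2)"
          using N[OF \<open>N \<le> r j\<close>] by (auto simp flip: sq_norm_power2 intro!: ennreal_leI power_mono)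
        finally show "(\<integral>\<^sup>+x. ennreal ((f i x - f (r j) x)\<^sup>2) \<partial>M) \<le> ennreal (e\<^sup>2)" .
      qed
    qed simp
    finally show ?thesis .
  qed
  have diff: "sq_integrable M (\<lambda>x. f i x - g x) \<and> sq_norm M (\<lambda>x. f i x - g x) \<le> e"
    if "e > 0" and "\<And>j. j \<ge> N \<Longrightarrow> sq_norm M (\<lambda>x. f i x - f j x) < e" for e i N
  proof -
    have F: "(\<integral>\<^sup>+x. ennreal ((f i x - g x)\<^sup>2) \<partial>M) \<le> ennreal (e\<^sup>2)"
      using that by (rule fatou)
    have int: "integrable M (\<lambda>x. (f i x - g x)\<^sup>2)"
      using F by (intro integrableI_bounded) (auto intro: le_less_trans)
    moreover have "(LINT x|M. (f i x - g x)\<^sup>2) \<le> e\<^sup>2"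
      using F nn_integral_eq_integral[OF int] that(1) by simp
    then have "sq_norm M (\<lambda>x. f i x - g x) \<le> e"
      unfolding sq_norm_def using that(1) by (intro real_le_lsqrt) auto
    ultimately show ?thesis by (simp add: sq_integrable_def)
  qed
  \<comment> \<open>One index at which \<open>f N1 - g\<close> is square integrable suffices:
    \<open>g\<close> is then a difference of two square integrable functions.\<close>
  obtain N1 where "\<And>i j. i \<ge> N1 \<Longrightarrow> j \<ge> N1 \<Longrightarrow> sq_norm M (\<lambda>x. f i x - f j x) < 1"
    using C[of 1] by auto
  then have "sq_integrable M (\<lambda>x. f N1 x - g x)" using diff[of 1 N1 N1] by simp
  from sq_integrable_diff[OF f[of N1] this] have g: "sq_integrable M g" by simp
  have "(\<lambda>n. sq_norm M (\<lambda>x. f n x - g x)) \<longlonglongrightarrow> 0"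
  proof (rule LIMSEQ_I)
    fix e :: real assume "e > 0"
    then obtain N where N: "\<And>i j. i \<ge> N \<Longrightarrow> j \<ge> N \<Longrightarrow> sq_norm M (\<lambda>x. f i x - f j x) < e / 2"
      using C[of "e / 2"] by auto
    have "sq_norm M (\<lambda>x. f i x - g x) \<le> e / 2" if "i \<ge> N" for i
      using diff[of "e / 2" N i] N that \<open>e > 0\<close> by simp
    then show "\<exists>no. \<forall>n\<ge>no. norm (sq_norm M (\<lambda>x. f n x - g x) - 0) < e"
      using \<open>e > 0\<close> by (intro exI[of _ N]) force
  qed
  with g that show thesis by blast
qed

section \<open>Test functions on an interval\<close>

text \<open>For \<open>c > 0\<close> these functions are closed under differentiation, hence smooth.\<close>

definition bump :: "real \<Rightarrow> real \<Rightarrow> real \<Rightarrow> real poly \<Rightarrow> nat \<Rightarrow> real \<Rightarrow> real" where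
  "bump a b c R k t = (if a < t \<and> t < b
     then poly R t * (1 / ((t - a) * (b - t))) ^ k * exp (- c / ((t - a) * (b - t))) else 0)"

text \<open>The exponential series dominates each of its terms. With \<open>x = 1 / h\<close> this
  shows that the exponential factor of \<open>bump\<close> beats every pole of the other
  factor.\<close>

lemma power_mult_exp_minus_le:
  fixes c x :: real
  assumes "0 < c" "0 \<le> x"
  shows "x ^ m * exp (- (c * x)) \<le> fact m / c ^ m"
proof -
  have "(c * x) ^ m / fact m \<le> (\<Sum>n. (c * x) ^ n / fact n)"
  proof -
    have "(\<Sum>n\<in>{m}. (c * x) ^ n / fact n) \<le> (\<Sum>n. (c * x) ^ n / fact n)"
      using assms summable_exp_generic[of "c * x"]
      by (intro sum_le_suminf) (auto simp: divide_inverse mult.commute)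
    then show ?thesis by simp
  qed
  also have "\<dots> = exp (c * x)"
    by (simp add: exp_def divide_inverse mult.commute)
  finally have "c ^ m * (x ^ m * exp (- (c * x))) \<le> fact m"
    by (simp add: power_mult_distrib exp_minus field_simps)
  then show ?thesis
    using assms by (simp add: field_simps)
qed

text \<open>A bound of second order at every point off the open interval, the endpoints included: it
  makes the derivative there exist and vanish.\<close>

lemma bump_quadratic_bound:
  assumes "0 < c"
  obtains D where "0 \<le> D" "\<And>t y. t \<notin> {a<..<b} \<Longrightarrow> \<bar>bump a b c R k y\<bar> \<le> D * (y - t)\<^sup>2"
proof -
  have "compact (poly R ` {a..b})"
    by (intro compact_continuous_image continuous_intros) auto
  then obtain B where B: "\<And>y. y \<in> {a..b} \<Longrightarrow> \<bar>poly R y\<bar> \<le> B" and "B > 0"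
    using compact_imp_bounded bounded_pos by (metis imageI real_norm_def)
  \<comment> \<open>The exponent \<open>k + 2\<close> spends \<open>k\<close> powers on the pole and
    leaves \<open>h ^ 2\<close>.\<close>
  define C where "C = fact (k + 2) / c ^ (k + 2)"
  have "C \<ge> 0" using assms by (simp add: C_def)
  define D where "D = B * C * (b - a)\<^sup>2"
  have "D \<ge> 0" using \<open>B > 0\<close> \<open>C \<ge> 0\<close> by (simp add: D_def)
  have "\<bar>bump a b c R k y\<bar> \<le> D * (y - t)\<^sup>2" if t: "t \<notin> {a<..<b}" for t y
  proof (cases "a < y \<and> y < b")
    case True
    define h where "h = (y - a) * (b - y)"
    have h: "h > 0" using True by (simp add: h_def)
    have e: "(1 / h) ^ (k + 2) * exp (- (c * (1 / h))) \<le> C"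
      unfolding C_def using assms h by (intro power_mult_exp_minus_le) auto
    have "h ^ 2 * ((1 / h) ^ (k + 2) * exp (- (c * (1 / h)))) \<le> h ^ 2 * C"
      using e by (intro mult_left_mono) auto
    moreover have "h ^ 2 * (1 / h) ^ (k + 2) = (1 / h) ^ k"
      using h by (simp add: power_add power_divide power2_eq_square)
    ultimately have 1: "(1 / h) ^ k * exp (- c / h) \<le> h ^ 2 * C"
      by (metis mult.assoc mult_minus_left times_divide_eq_right mult.right_neutral)
    \<comment> \<open>If \<open>t\<close> lies left of the interval then \<open>y - a\<close> is at
      most the distance from \<open>y\<close> to \<open>t\<close>, otherwise \<open>b - y\<close>
      is; the other factor of \<open>h\<close> is at most \<open>b - a\<close>.\<close>
    have "h \<le> (b - a) * \<bar>y - t\<bar>"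
    proof (cases "t \<le> a")
      case True
      then have "h \<le> \<bar>y - t\<bar> * (b - a)"
        using \<open>a < y \<and> y < b\<close> unfolding h_def by (intro mult_mono) auto
      then show ?thesis by (simp add: mult.commute)
    next
      case False
      with t have "b \<le> t" by auto
      then show ?thesis
        using \<open>a < y \<and> y < b\<close> unfolding h_def by (intro mult_mono) auto
    qed
    then have "h ^ 2 \<le> ((b - a) * \<bar>y - t\<bar>) ^ 2"
      using h by (intro power_mono) auto
    then have h2: "h ^ 2 \<le> (b - a)\<^sup>2 * (y - t)\<^sup>2"
      by (simp add: power_mult_distrib)
    have "\<bar>bump a b c R k y\<bar> = \<bar>poly R y\<bar> * ((1 / h) ^ k * exp (- c / h))"
      using True h by (simp add: bump_def h_def abs_mult power_abs)
    also have "\<dots> \<le> B * (h ^ 2 * C)"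
      using B[of y] True \<open>B > 0\<close> h by (intro mult_mono[OF _ 1]) auto
    also have "\<dots> \<le> B * ((b - a)\<^sup>2 * (y - t)\<^sup>2 * C)"
      using h2 \<open>B > 0\<close> \<open>C \<ge> 0\<close> by (intro mult_left_mono mult_right_mono) auto
    finally show ?thesis by (simp add: D_def mult_ac)
  next
    case False
    then have "bump a b c R k y = 0"
      unfolding bump_def by (rule if_not_P)
    then show ?thesis using \<open>D \<ge> 0\<close> by simp
  qed
  with \<open>D \<ge> 0\<close> that show thesis by blast
qed

text \<open>Inside the interval, \<open>w = 1 / h\<close> satisfies
  \<open>w' = - h' * w\<^sup>2\<close>, so each differentiation raises the order of the pole by at
  most 2 and changes the numerator to another polynomial. Outside, both sides vanish by the
  quadratic bound.\<close>

lemma bump_has_derivative: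
  fixes a b c :: real and R :: "real poly" and k :: nat
  assumes c: "0 < c"
  defines "h \<equiv> [:-a, 1:] * [:b, -1:]"
  shows "(bump a b c R k has_real_derivative
      bump a b c (pderiv R * h\<^sup>2 - smult (of_nat k) (R * pderiv h * h) + smult c (R * pderiv h))
        (k + 2) t) (at t)"
proof (cases "t \<in> {a<..<b}")
  case True
  define R' where "R' = pderiv R * h\<^sup>2 - smult (of_nat k) (R * pderiv h * h) + smult c (R * pderiv h)"
  have h: "poly h y = (y - a) * (b - y)" for y
    by (simp add: h_def algebra_simps)
  have h0: "poly h t > 0" using True by (simp add: h)
  define w where "w y = 1 / poly h y" for y
  let ?h = "poly h t" and ?h' = "poly (pderiv h) t"
  have dw: "(w has_real_derivative - ?h' * (w t)\<^sup>2) (at t)"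
    unfolding w_def using h0
    by (auto intro!: derivative_eq_intros poly_DERIV simp: power2_eq_square field_simps)
  have "((\<lambda>y. poly R y * w y ^ k * exp (- c * w y)) has_real_derivative
      poly (pderiv R) t * w t ^ k * exp (- c * w t)
      - poly R t * ?h' * (of_nat k * w t ^ (k - 1) * (w t)\<^sup>2) * exp (- c * w t)
      + poly R t * w t ^ k * (exp (- c * w t) * (c * ?h' * (w t)\<^sup>2))) (at t)"
    by (auto intro!: derivative_eq_intros poly_DERIV dw simp: algebra_simps)
  also have "poly (pderiv R) t * w t ^ k * exp (- c * w t)
      - poly R t * ?h' * (of_nat k * w t ^ (k - 1) * (w t)\<^sup>2) * exp (- c * w t)
      + poly R t * w t ^ k * (exp (- c * w t) * (c * ?h' * (w t)\<^sup>2))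
      = poly R' t * w t ^ (k + 2) * exp (- c * w t)"
  proof -
    have wh: "w t * ?h = 1" using h0 by (simp add: w_def)
    have 1: "w t ^ (k + 2) * ?h\<^sup>2 = w t ^ k"
      using wh by (metis mult.assoc mult.right_neutral power_add power_mult_distrib power_one)
    have 2: "w t ^ (k + 2) * ?h = w t ^ (k + 1)"
      using wh by (simp add: mult_ac)
    \<comment> \<open>At \<open>k = 0\<close> the truncated exponent \<open>k - 1\<close> does no
      harm, as the factor \<open>of_nat k\<close> is 0.\<close>
    have 3: "of_nat k * w t ^ (k - 1) * (w t)\<^sup>2 = of_nat k * w t ^ (k + 1)"
      by (cases k) (auto simp: power2_eq_square mult_ac)
    have "poly R' t * w t ^ (k + 2) = poly (pderiv R) t * (w t ^ (k + 2) * ?h\<^sup>2)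
        - of_nat k * poly R t * ?h' * (w t ^ (k + 2) * ?h) + c * poly R t * ?h' * w t ^ (k + 2)"
      by (simp add: R'_def algebra_simps del: power_add power_Suc)
    then have "poly R' t * w t ^ (k + 2) = poly (pderiv R) t * w t ^ k
        - poly R t * ?h' * (of_nat k * w t ^ (k - 1) * (w t)\<^sup>2) + poly R t * w t ^ k * (c * ?h' * (w t)\<^sup>2)"
      unfolding 1 2 3 by (simp add: power_add power2_eq_square mult_ac)
    from arg_cong[OF this, of "\<lambda>z. z * exp (- c * w t)"] show ?thesis
      by (simp add: algebra_simps)
  qed
  also have "\<dots> = bump a b c R' (k + 2) t"
    using True by (simp add: bump_def h w_def)
  finally have *: "((\<lambda>y. poly R y * w y ^ k * exp (- c * w y)) has_real_derivative
      bump a b c R' (k + 2) t) (at t)" .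
  have "(bump a b c R k has_real_derivative bump a b c R' (k + 2) t) (at t)"
    by (rule has_field_derivative_transform_within_open[OF *, of "{a<..<b}"])
      (use True in \<open>auto simp: bump_def h w_def\<close>)
  then show ?thesis by (simp add: R'_def)
next
  case False
  then have z: "bump a b c Q j t = 0" for Q j
    by (auto simp: bump_def)
  obtain D where D: "0 \<le> D" "\<And>y. \<bar>bump a b c R k y\<bar> \<le> D * (y - t)\<^sup>2"
    using bump_quadratic_bound[OF c] False by metis
  have "(bump a b c R k has_real_derivative 0) (at t)"
    unfolding DERIV_def
  proof (rule Lim_null_comparison)
    show "\<forall>\<^sub>F x in at 0. norm ((bump a b c R k (t + x) - bump a b c R k t) / x) \<le> D * \<bar>x\<bar>"
    proof (rule always_eventually, rule allI)
      fix x :: real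
      show "norm ((bump a b c R k (t + x) - bump a b c R k t) / x) \<le> D * \<bar>x\<bar>"
      proof (cases "x = 0")
        case False
        then show ?thesis
          using D(2)[of "t + x"] z by (simp add: field_simps power2_eq_square abs_mult_self_eq)
      qed simp
    qed
    show "((\<lambda>x. D * \<bar>x\<bar>) \<longlongrightarrow> 0) (at 0)"
      by (auto intro!: tendsto_eq_intros)
  qed
  then show ?thesis by (simp add: z)
qed

lemma bump_smooth:
  assumes "0 < c"
  shows "((deriv ^^ n) (bump a b c R k)) differentiable (at t)"
proof (induction n arbitrary: R k)
  case 0
  show ?case
    using bump_has_derivative[OF assms] unfolding funpow_0 real_differentiable_def by blast
next
  case (Suc n)
  have "deriv (bump a b c R k) = bump a b c (pderiv R * ([:-a, 1:] * [:b, -1:])\<^sup>2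
      - smult (of_nat k) (R * pderiv ([:-a, 1:] * [:b, -1:]) * ([:-a, 1:] * [:b, -1:]))
      + smult c (R * pderiv ([:-a, 1:] * [:b, -1:]))) (k + 2)"
    using bump_has_derivative[OF assms] by (intro ext DERIV_imp_deriv)
  then show ?case
    using Suc by (simp only: funpow_Suc_right o_apply)
qed

lemma bump_in_smooth_compact_support:
  assumes "0 < c" "0 < a" "a < b" "b < T"
  shows "bump a b c R k \<in> smooth_compact_support T"
  unfolding smooth_compact_support_def using bump_smooth[OF assms(1)] assms
  by (auto simp: bump_def intro!: exI[of _ "{a..b}"])

section \<open>The fundamental lemma of the calculus of variations\<close>

abbreviation lebesgue_on_Ioo :: "real \<Rightarrow> real measure" where
  "lebesgue_on_Ioo T \<equiv> restrict_space lborel {0<..<T}"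

text \<open>Bumps with flattening exponent and widening support tend boundedly to the indicator of
  \<open>{max x 0<..<T}\<close>. Hence \<open>e\<close> integrates to 0 over every half-line
  intersected with the interval, and half-lines determine a finite measure.\<close>

lemma fundamental_lemma_Ioo:
  assumes T: "0 < T" and int: "integrable (lebesgue_on_Ioo T) e"
    and test: "\<And>\<phi>. \<phi> \<in> smooth_compact_support T \<Longrightarrow> (LINT t|lebesgue_on_Ioo T. e t * \<phi> t) = 0"
  shows "AE t in lebesgue_on_Ioo T. e t = 0"
proof -
  define E where "E t = indicat_real {0<..<T} t * e t" for t
  have iE: "integrable lborel E"
    using int by (simp add: integrable_restrict_space E_def[abs_def])
  then have [measurable]: "E \<in> borel_measurable borel" by simp
  have zero: "(LINT t|lborel. indicator {x<..} t * E t) = 0" for x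
  proof (cases "max x 0 < T")
    case False
    then have "(\<lambda>t. indicat_real {x<..} t * E t) = (\<lambda>t. 0)"
      using T by (auto simp: E_def indicator_def)
    then show ?thesis by simp
  next
    case True
    define m where "m = max x 0"
    define L where "L = T - m"
    have L: "L > 0" "m \<ge> 0" using True by (auto simp: L_def m_def)
    \<comment> \<open>The offset 3 keeps the shift at no more than a third of \<open>L\<close>, so
      \<open>a n < b n\<close> from the start.\<close>
    define a where "a n = m + L / (real n + 3)" for n
    define b where "b n = T - L / (real n + 3)" for n
    have lim_L: "(\<lambda>n. L / (real n + 3)) \<longlonglongrightarrow> 0" by real_asymp
    have lim_a: "a \<longlonglongrightarrow> m" and lim_b: "b \<longlonglongrightarrow> T"
      using tendsto_add[OF tendsto_const lim_L, of m] tendsto_diff[OF tendsto_const lim_L, of T]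
      by (simp_all add: a_def[abs_def] b_def[abs_def])
    have L3: "0 < L / (real n + 3)" "L / (real n + 3) \<le> L / 3" for n
      using L by (auto simp: divide_simps)
    have ab: "m < a n" "a n < b n" "b n < T" for n
      unfolding a_def b_def using L3[of n] L L_def by linarith+
    \<comment> \<open>With numerator 1 and no pole only the exponential remains; its constant
      \<open>1 / (real n + 1)\<close> tends to 0, so the values tend to 1 inside the
      interval.\<close>
    define \<phi> where "\<phi> n = bump (a n) (b n) (1 / (real n + 1)) 1 0" for n
    have \<phi>: "\<phi> n \<in> smooth_compact_support T" for n
      unfolding \<phi>_def using ab[of n] L by (intro bump_in_smooth_compact_support) auto
    have mphi [measurable]: "\<phi> n \<in> borel_measurable borel" for n
      unfolding \<phi>_def bump_def[abs_def] poly_1 power_0 mult_1 by measurable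
    have "(\<lambda>n. LINT t|lborel. E t * \<phi> n t) \<longlonglongrightarrow> (LINT t|lborel. indicator {x<..} t * E t)"
    proof (rule integral_dominated_convergence[where w = "\<lambda>t. \<bar>E t\<bar>"])
      show "AE t in lborel. (\<lambda>n. E t * \<phi> n t) \<longlonglongrightarrow> indicator {x<..} t * E t"
      proof (rule AE_I2)
        fix t
        show "(\<lambda>n. E t * \<phi> n t) \<longlonglongrightarrow> indicator {x<..} t * E t"
        proof (cases "m < t \<and> t < T")
          case True
          have "(\<lambda>n. exp (- (1 / (real n + 1)) / ((t - a n) * (b n - t)))) \<longlonglongrightarrow> exp (- 0 / ((t - m) * (T - t)))"
            using True by (intro tendsto_intros lim_a lim_b) (auto, real_asymp)
          moreover have "\<forall>\<^sub>F n in sequentially. exp (- (1 / (real n + 1)) / ((t - a n) * (b n - t))) = \<phi> n t"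
          proof -
            have "\<forall>\<^sub>F n in sequentially. a n < t" "\<forall>\<^sub>F n in sequentially. t < b n"
              using order_tendstoD(2)[OF lim_a] order_tendstoD(1)[OF lim_b] True by auto
            then show ?thesis
              by eventually_elim (simp add: \<phi>_def bump_def)
          qed
          ultimately have "(\<lambda>n. \<phi> n t) \<longlonglongrightarrow> 1"
            by (auto intro: Lim_transform_eventually)
          from tendsto_mult_left[OF this, of "E t"] True show ?thesis
            by (simp add: m_def)
        next
          case False
          then have "\<phi> n t = 0" for n
            using ab[of n] by (auto simp: \<phi>_def bump_def)
          moreover have "indicator {x<..} t * E t = 0"
            using False by (auto simp: E_def indicator_def m_def)
          ultimately show ?thesis by (simp only: mult_zero_right tendsto_const)
        qed
      qed
      show "AE t in lborel. norm (E t * \<phi> n t) \<le> \<bar>E t\<bar>" for n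
      proof (rule AE_I2)
        fix t
        have "\<bar>\<phi> n t\<bar> \<le> 1"
          by (auto simp: \<phi>_def bump_def)
        then show "norm (E t * \<phi> n t) \<le> \<bar>E t\<bar>"
          by (simp add: abs_mult mult_left_le)
      qed
    qed (use iE in auto)
    moreover have "(LINT t|lborel. E t * \<phi> n t) = 0" for n
      using test[OF \<phi>[of n]] by (simp add: integral_restrict_space E_def mult.assoc)
    ultimately show ?thesis by (simp add: LIMSEQ_const_iff)
  qed
  have dens: "emeasure (density lborel (\<lambda>t. ennreal (s * E t))) {x<..} = ennreal (LINT t|lborel. indicator {x<..} t * max 0 (s * E t))"
    if "s \<in> {-1, 1}" for s x
  proof -
    have "integrable lborel (\<lambda>t. indicator {x<..} t *\<^sub>R max 0 (s * E t))"
      using iE by (intro integrable_mult_indicator) auto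
    then have i: "integrable lborel (\<lambda>t. indicator {x<..} t * max 0 (s * E t))" by simp
    have "emeasure (density lborel (\<lambda>t. ennreal (s * E t))) {x<..} =
        (\<integral>\<^sup>+t. ennreal (s * E t) * indicator {x<..} t \<partial>lborel)"
      by (subst emeasure_density) auto
    also have "\<dots> = (\<integral>\<^sup>+t. ennreal (indicator {x<..} t * max 0 (s * E t)) \<partial>lborel)"
      by (intro nn_integral_cong) (auto simp: indicator_def max_def ennreal_neg)
    also have "\<dots> = ennreal (LINT t|lborel. indicator {x<..} t * max 0 (s * E t))"
      by (rule nn_integral_eq_integral[OF i]) auto
    finally show ?thesis .
  qed
  \<comment> \<open>Since \<open>ennreal\<close> truncates at 0, these are the measures whose
    densities are the positive and the negative part of \<open>E\<close>. Equal parts at a point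
    mean that both are 0.\<close>
  have "density lborel (\<lambda>t. ennreal (1 * E t)) = density lborel (\<lambda>t. ennreal (-1 * E t))"
  proof (rule measure_eqI_lessThan)
    fix x
    have i: "integrable lborel (\<lambda>t. indicator {x<..} t *\<^sub>R max 0 (s * E t))" for s
      using iE by (intro integrable_mult_indicator) auto
    have "(LINT t|lborel. indicator {x<..} t * max 0 (1 * E t)) -
        (LINT t|lborel. indicator {x<..} t * max 0 (-1 * E t)) =
        (LINT t|lborel. indicator {x<..} t * max 0 (1 * E t) - indicator {x<..} t * max 0 (-1 * E t))"
      using i[of 1] i[of "-1"] by simp
    also have "\<dots> = (LINT t|lborel. indicator {x<..} t * E t)"
      by (intro Bochner_Integration.integral_cong) (auto simp: max_def algebra_simps)
    finally show "emeasure (density lborel (\<lambda>t. ennreal (1 * E t))) {x<..} =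
        emeasure (density lborel (\<lambda>t. ennreal (-1 * E t))) {x<..}"
      using zero[of x] dens[of 1 x] dens[of "-1" x] by simp
    show "emeasure (density lborel (\<lambda>t. ennreal (1 * E t))) {x<..} < \<infinity>"
      by (subst dens) auto
  qed auto
  then have "AE t in lborel. ennreal (1 * E t) = ennreal (-1 * E t)"
    by (subst (asm) sigma_finite_measure.density_unique_iff[OF sigma_finite_lborel]) auto
  then have "AE t in lborel. E t = 0"
  proof eventually_elim
    case (elim t)
    then show ?case
      by (cases "E t \<ge> 0") (auto simp: ennreal_neg ennreal_eq_0_iff)
  qed
  then have "AE t in lborel. t \<in> {0<..<T} \<longrightarrow> e t = 0"
    by eventually_elim (auto simp: E_def)
  then show ?thesis
    by (simp add: AE_restrict_space_iff)
qed

section \<open>Weak derivatives\<close>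

lemma finite_measure_Ioo: "finite_measure (lebesgue_on_Ioo T)"
  by (rule finite_measureI, cases "0 \<le> T")
    (simp_all add: emeasure_restrict_space space_restrict_space)

lemma set_integral_Ioo:
  "(LINT t:{0<..<T}|lborel. f t) = (LINT t|lebesgue_on_Ioo T. f t :: real)"
  by (simp add: set_lebesgue_integral_def integral_restrict_space)

lemma AE_Ioo_iff: "(AE t in lebesgue_on_Ioo T. P t) \<longleftrightarrow> (AE t in lborel. t \<in> {0<..<T} \<longrightarrow> P t)"
  by (simp add: AE_restrict_space_iff)

lemma L2_iff: "c \<in> L2 T \<longleftrightarrow> sq_integrable (lebesgue_on_Ioo T) c"
  by (simp add: L2_def sq_integrable_def set_borel_measurable_def set_integrable_def
      integrable_restrict_space borel_measurable_restrict_space_iff)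

lemma L2_norm_eq: "L2_norm T c = sq_norm (lebesgue_on_Ioo T) c"
  by (simp add: L2_norm_def sq_norm_def set_integral_Ioo)

lemma is_weak_deriv_iff:
  "is_weak_deriv T c d \<longleftrightarrow> (\<forall>\<phi>\<in>smooth_compact_support T.
     (LINT t|lebesgue_on_Ioo T. c t * deriv \<phi> t) = - (LINT t|lebesgue_on_Ioo T. d t * \<phi> t))"
  by (simp add: is_weak_deriv_def set_integral_Ioo)

section \<open>Calculus of test functions\<close>

lemma smooth_compact_support_differentiable:
  assumes "\<phi> \<in> smooth_compact_support T"
  shows "(\<phi> has_real_derivative deriv \<phi> t) (at t)"
proof -
  have "((deriv ^^ 0) \<phi>) differentiable (at t)"
    using assms unfolding smooth_compact_support_def by blast
  then show ?thesis
    by (simp add: DERIV_deriv_iff_real_differentiable)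
qed

lemma smooth_compact_support_deriv_continuous:
  assumes "\<phi> \<in> smooth_compact_support T"
  shows "continuous_on S (deriv \<phi>)"
proof -
  have "((deriv ^^ 1) \<phi>) differentiable (at t)" for t
    using assms unfolding smooth_compact_support_def by blast
  then show ?thesis
    by (intro differentiable_imp_continuous_on) (simp add: differentiable_at_imp_differentiable_on)
qed

lemma smooth_compact_support_continuous:
  assumes "\<phi> \<in> smooth_compact_support T"
  shows "continuous_on S \<phi>"
  using smooth_compact_support_differentiable[OF assms] DERIV_isCont continuous_at_imp_continuous_on
  by blast

lemma smooth_compact_support_eq_0:
  assumes "\<phi> \<in> smooth_compact_support T" "t \<notin> {0<..<T}"
  shows "\<phi> t = 0" "deriv \<phi> t = 0"
proof -
  obtain C where C: "compact C" "C \<subseteq> {0<..<T}" "\<And>t. t \<notin> C \<Longrightarrow> \<phi> t = 0"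
    using assms unfolding smooth_compact_support_def by blast
  then have t: "t \<in> - C" using assms by blast
  then show "\<phi> t = 0" using C by blast
  have "open (- C)" using C compact_imp_closed by blast
  then have "(\<phi> has_real_derivative 0) (at t)"
    by (intro has_field_derivative_transform_within_open[OF DERIV_const[of 0] _ t]) (use C in auto)
  then show "deriv \<phi> t = 0" by (rule DERIV_imp_deriv)
qed

lemma sq_integrable_continuous_Ioo:
  assumes "continuous_on UNIV (f :: real \<Rightarrow> real)"
  shows "sq_integrable (lebesgue_on_Ioo T) f"
proof -
  have "compact (f ` {0..T})"
    by (intro compact_continuous_image continuous_on_subset[OF assms]) auto
  then obtain B where B: "\<And>t. t \<in> {0..T} \<Longrightarrow> \<bar>f t\<bar> \<le> B"
    using compact_imp_bounded bounded_pos by (metis imageI real_norm_def)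
  have [measurable]: "f \<in> borel_measurable borel"
    using assms by (rule borel_measurable_continuous_onI)
  interpret finite_measure "lebesgue_on_Ioo T" by (rule finite_measure_Ioo)
  have "integrable (lebesgue_on_Ioo T) (\<lambda>t. (f t)\<^sup>2)"
  proof (rule integrable_const_bound)
    show "AE t in lebesgue_on_Ioo T. norm ((f t)\<^sup>2) \<le> B\<^sup>2"
      unfolding AE_Ioo_iff
    proof (rule AE_I2, rule impI)
      fix t assume "t \<in> {0<..<T}"
      then have "\<bar>f t\<bar>\<^sup>2 \<le> B\<^sup>2" using B[of t] by (intro power_mono) auto
      then show "norm ((f t)\<^sup>2) \<le> B\<^sup>2" by simp
    qed
  qed (auto intro!: measurable_restrict_space1)
  then show ?thesis
    by (auto simp: sq_integrable_def intro!: measurable_restrict_space1)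
qed

lemma smooth_compact_support_sq_integrable:
  assumes "\<phi> \<in> smooth_compact_support T"
  shows "sq_integrable (lebesgue_on_Ioo T) \<phi>" "sq_integrable (lebesgue_on_Ioo T) (deriv \<phi>)"
  using assms smooth_compact_support_continuous smooth_compact_support_deriv_continuous
  by (auto intro!: sq_integrable_continuous_Ioo)

lemma smooth_compact_support_linear:
  assumes f: "f \<in> smooth_compact_support T" and g: "g \<in> smooth_compact_support T"
  shows "(\<lambda>t. a * f t + b * g t) \<in> smooth_compact_support T"
proof -
  have d: "(deriv ^^ n) f differentiable (at t)" "(deriv ^^ n) g differentiable (at t)" for n t
    using f g unfolding smooth_compact_support_def by blast+
  have eq: "(deriv ^^ n) (\<lambda>t. a * f t + b * g t) = (\<lambda>t. a * (deriv ^^ n) f t + b * (deriv ^^ n) g t)" for n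
  proof (induction n)
    case (Suc n)
    have "deriv (\<lambda>t. a * (deriv ^^ n) f t + b * (deriv ^^ n) g t) t
        = a * deriv ((deriv ^^ n) f) t + b * deriv ((deriv ^^ n) g) t" for t
      using d[of n t] unfolding DERIV_deriv_iff_real_differentiable[symmetric]
      by (intro DERIV_imp_deriv DERIV_add DERIV_cmult)
    then show ?case by (simp add: Suc)
  qed simp
  obtain C D where "compact C" "C \<subseteq> {0<..<T}" "\<forall>t. t \<notin> C \<longrightarrow> f t = 0"
    "compact D" "D \<subseteq> {0<..<T}" "\<forall>t. t \<notin> D \<longrightarrow> g t = 0"
    using f g unfolding smooth_compact_support_def by blast
  then have "\<exists>C. compact C \<and> C \<subseteq> {0<..<T} \<and> (\<forall>t. t \<notin> C \<longrightarrow> a * f t + b * g t = 0)"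
    by (intro exI[of _ "C \<union> D"]) auto
  then show ?thesis
    using d by (auto simp: smooth_compact_support_def eq intro!: derivative_intros)
qed

lemma deriv_linear_smooth:
  assumes f: "f \<in> smooth_compact_support T" and g: "g \<in> smooth_compact_support T"
  shows "deriv (\<lambda>t. a * f t + b * g t) = (\<lambda>t. a * deriv f t + b * deriv g t)"
  by (intro ext DERIV_imp_deriv DERIV_add DERIV_cmult smooth_compact_support_differentiable[OF f]
      smooth_compact_support_differentiable[OF g])

lemma smooth_compact_support_FTC:
  assumes \<phi>: "\<phi> \<in> smooth_compact_support T" and "s \<le> t"
  shows "(LINT x|lebesgue_on_Ioo T. indicator {s..t} x * deriv \<phi> x) = \<phi> t - \<phi> s"
proof -
  have "(LINT x|lebesgue_on_Ioo T. indicator {s..t} x * deriv \<phi> x) =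
      (LINT x|lborel. indicator {s..t} x *\<^sub>R deriv \<phi> x)"
    unfolding integral_restrict_space[of "{0<..<T}" lborel, simplified]
    using smooth_compact_support_eq_0(2)[OF \<phi>]
    by (intro Bochner_Integration.integral_cong) (auto simp: indicator_def)
  also have "\<dots> = \<phi> t - \<phi> s"
    using smooth_compact_support_differentiable[OF \<phi>] \<open>s \<le> t\<close>
      smooth_compact_support_deriv_continuous[OF \<phi>]
    by (intro integral_FTC_atLeastAtMost)
      (auto simp flip: has_real_derivative_iff_has_vector_derivative intro: has_field_derivative_at_within)
  finally show ?thesis .
qed

text \<open>Cauchy-Schwarz for the derivative against the indicator of \<open>{s..t}\<close>. The
  modulus of continuity depends on the derivative norm only, so it is common to all functions of a
  bounded family.\<close>

lemma smooth_compact_support_Hoelder: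
  assumes \<phi>: "\<phi> \<in> smooth_compact_support T" and "s \<le> t"
  shows "\<bar>\<phi> t - \<phi> s\<bar> \<le> sqrt (t - s) * sq_norm (lebesgue_on_Ioo T) (deriv \<phi>)"
proof -
  let ?M = "lebesgue_on_Ioo T"
  interpret finite_measure ?M by (rule finite_measure_Ioo)
  have i: "sq_integrable ?M (indicator {s..t})"
    unfolding sq_integrable_def
  proof
    show "indicat_real {s..t} \<in> borel_measurable ?M"
      by (rule measurable_restrict_space1) measurable
    then have "integrable ?M (indicat_real {s..t})"
      by (intro integrable_const_bound[of _ 1]) (auto simp: indicator_def)
    moreover have "(\<lambda>x. (indicat_real {s..t} x)\<^sup>2) = indicat_real {s..t}"
      by (auto simp: indicator_def)
    ultimately show "integrable ?M (\<lambda>x. (indicat_real {s..t} x)\<^sup>2)" by simp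
  qed
  have "(LINT x|?M. (indicator {s..t} x)\<^sup>2) = (LINT x|lborel. indicator ({0<..<T} \<inter> {s..t}) x :: real)"
    unfolding integral_restrict_space[of "{0<..<T}" lborel, simplified]
    by (intro Bochner_Integration.integral_cong) (auto simp: indicator_def)
  also have "\<dots> = measure lborel ({0<..<T} \<inter> {s..t})" by simp
  also have "\<dots> \<le> measure lborel {s..t}"
    using \<open>s \<le> t\<close> by (intro measure_mono_fmeasurable) (auto simp: fmeasurable_def)
  finally have "sq_norm ?M (indicator {s..t}) \<le> sqrt (t - s)"
    using \<open>s \<le> t\<close> by (simp add: sq_norm_def)
  moreover have "\<bar>\<phi> t - \<phi> s\<bar> \<le> sq_norm ?M (indicator {s..t}) * sq_norm ?M (deriv \<phi>)"
    using abs_integral_mult_le[OF i smooth_compact_support_sq_integrable(2)[OF \<phi>]]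
      smooth_compact_support_FTC[OF assms] by simp
  ultimately show ?thesis
    by (meson mult_right_mono order_trans sq_norm_nonneg)
qed

text \<open>A Poincare inequality: the Hoelder estimate starting from \<open>s = 0\<close>, where a
  test function vanishes.\<close>

lemma smooth_compact_support_sup_bound:
  assumes \<phi>: "\<phi> \<in> smooth_compact_support T" and t: "t \<in> {0..T}"
  shows "\<bar>\<phi> t\<bar> \<le> sqrt T * sq_norm (lebesgue_on_Ioo T) (deriv \<phi>)"
proof -
  have "\<bar>\<phi> t\<bar> \<le> sqrt (t - 0) * sq_norm (lebesgue_on_Ioo T) (deriv \<phi>)"
    using smooth_compact_support_Hoelder[OF \<phi>, of 0 t] t smooth_compact_support_eq_0(1)[OF \<phi>, of 0]
    by simp
  also have "\<dots> \<le> sqrt T * sq_norm (lebesgue_on_Ioo T) (deriv \<phi>)"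
    using t by (intro mult_right_mono) auto
  finally show ?thesis .
qed

lemma smooth_compact_support_integral_by_parts:
  assumes f: "f \<in> smooth_compact_support T" and g: "g \<in> smooth_compact_support T"
  shows "(LINT x|lebesgue_on_Ioo T. f x * deriv g x) = - (LINT x|lebesgue_on_Ioo T. deriv f x * g x)"
proof (cases "0 \<le> T")
  case True
  note cont = smooth_compact_support_continuous[OF f] smooth_compact_support_continuous[OF g]
    smooth_compact_support_deriv_continuous[OF f] smooth_compact_support_deriv_continuous[OF g]
  have "((\<lambda>x. f x * g x) has_real_derivative deriv f x * g x + f x * deriv g x) (at x)" for x
    using DERIV_mult[OF smooth_compact_support_differentiable[OF f] smooth_compact_support_differentiable[OF g]]
    by (simp add: algebra_simps)
  then have "(LINT x|lborel. indicator {0..T} x *\<^sub>R (deriv f x * g x + f x * deriv g x)) = f T * g T - f 0 * g 0"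
    using True by (intro integral_FTC_atLeastAtMost)
      (auto intro!: continuous_intros cont simp flip: has_real_derivative_iff_has_vector_derivative
        intro: has_field_derivative_at_within)
  also have "\<dots> = 0"
    using smooth_compact_support_eq_0(1)[OF f, of 0] smooth_compact_support_eq_0(1)[OF f, of T] by simp
  also have "(LINT x|lborel. indicator {0..T} x *\<^sub>R (deriv f x * g x + f x * deriv g x)) =
      (LINT x|lebesgue_on_Ioo T. deriv f x * g x + f x * deriv g x)"
    unfolding integral_restrict_space[of "{0<..<T}" lborel, simplified]
    using smooth_compact_support_eq_0[OF f]
    by (intro Bochner_Integration.integral_cong) (auto simp: indicator_def)
  also have "\<dots> = (LINT x|lebesgue_on_Ioo T. deriv f x * g x) + (LINT x|lebesgue_on_Ioo T. f x * deriv g x)"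
    by (intro Bochner_Integration.integral_add integrable_mult_sq smooth_compact_support_sq_integrable f g)
  finally show ?thesis by simp
next
  case False
  then have "\<And>x. f x = 0" "\<And>x. g x = 0"
    using smooth_compact_support_eq_0(1)[OF f] smooth_compact_support_eq_0(1)[OF g] by auto
  then show ?thesis by simp
qed

lemma is_weak_deriv_smooth:
  "\<phi> \<in> smooth_compact_support T \<Longrightarrow> is_weak_deriv T \<phi> (deriv \<phi>)"
  using smooth_compact_support_integral_by_parts by (auto simp: is_weak_deriv_iff)

lemma is_weak_deriv_diff:
  assumes "c \<in> L2 T" "d \<in> L2 T" "is_weak_deriv T c d" "c' \<in> L2 T" "d' \<in> L2 T" "is_weak_deriv T c' d'"
  shows "is_weak_deriv T (\<lambda>t. c t - c' t) (\<lambda>t. d t - d' t)"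
  unfolding is_weak_deriv_iff
proof
  fix \<phi> assume \<phi>: "\<phi> \<in> smooth_compact_support T"
  note i = integrable_mult_sq[OF _ smooth_compact_support_sq_integrable(1)[OF \<phi>]]
    integrable_mult_sq[OF _ smooth_compact_support_sq_integrable(2)[OF \<phi>]]
  show "(LINT t|lebesgue_on_Ioo T. (c t - c' t) * deriv \<phi> t) = - (LINT t|lebesgue_on_Ioo T. (d t - d' t) * \<phi> t)"
    using assms \<phi> by (simp add: left_diff_distrib i L2_iff is_weak_deriv_iff)
qed

text \<open>The difference of two weak derivatives is orthogonal to all test functions, and it is
  integrable because the interval has finite length.\<close>

lemma weak_deriv_unique:
  assumes T: "0 < T" and d: "d \<in> L2 T" "is_weak_deriv T c d" and d': "d' \<in> L2 T" "is_weak_deriv T c d'"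
  shows "AE t in lebesgue_on_Ioo T. d t = d' t"
proof -
  let ?M = "lebesgue_on_Ioo T"
  interpret finite_measure ?M by (rule finite_measure_Ioo)
  have "AE t in ?M. d t - d' t = 0"
  proof (rule fundamental_lemma_Ioo[OF T])
    show "integrable ?M (\<lambda>t. d t - d' t)"
      using d(1) d'(1) by (intro sq_integrable_imp_integrable sq_integrable_diff) (auto simp: L2_iff)
  next
    fix \<phi> assume \<phi>: "\<phi> \<in> smooth_compact_support T"
    note i = integrable_mult_sq[OF _ smooth_compact_support_sq_integrable(1)[OF \<phi>]]
    show "(LINT t|?M. (d t - d' t) * \<phi> t) = 0"
      using d d' \<phi> by (simp add: left_diff_distrib i L2_iff is_weak_deriv_iff)
  qed
  then show ?thesis by simp
qed

text \<open>Frees norms from the \<open>SOME\<close> in \<open>weak_deriv\<close>: any weak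
  derivative that happens to be known may be used instead.\<close>

lemma L2_norm_weak_deriv:
  assumes T: "0 < T" and d: "d \<in> L2 T" "is_weak_deriv T c d"
  shows "L2_norm T (weak_deriv T c) = L2_norm T d"
proof -
  have "\<exists>d. d \<in> L2 T \<and> is_weak_deriv T c d" using d by blast
  from someI_ex[OF this] have w: "weak_deriv T c \<in> L2 T" "is_weak_deriv T c (weak_deriv T c)"
    unfolding weak_deriv_def by auto
  show ?thesis
    unfolding L2_norm_eq
    by (rule sq_norm_cong_AE[OF _ _ weak_deriv_unique[OF T w d]])
      (use w d in \<open>auto simp: L2_iff intro: sq_integrable_measurable\<close>)
qed

lemma W12_weak_deriv:
  assumes "c \<in> W12 T"
  shows "weak_deriv T c \<in> L2 T" "is_weak_deriv T c (weak_deriv T c)"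
proof -
  have "\<exists>d. d \<in> L2 T \<and> is_weak_deriv T c d" using assms by (auto simp: W12_def)
  from someI_ex[OF this] show "weak_deriv T c \<in> L2 T" "is_weak_deriv T c (weak_deriv T c)"
    unfolding weak_deriv_def by auto
qed

text \<open>The derivative chosen for a difference is not literally the difference of the chosen
  derivatives; the two agree almost everywhere, hence in norm.\<close>

lemma W12_norm_smooth_diff:
  assumes T: "0 < T" and \<phi>: "\<phi> \<in> smooth_compact_support T"
    and c: "c \<in> L2 T" and d: "d \<in> L2 T" "is_weak_deriv T c d"
  shows "W12_norm T (\<lambda>t. \<phi> t - c t) = sqrt ((sq_norm (lebesgue_on_Ioo T) (\<lambda>t. \<phi> t - c t))\<^sup>2
    + (sq_norm (lebesgue_on_Ioo T) (\<lambda>t. deriv \<phi> t - d t))\<^sup>2)"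
proof -
  have "is_weak_deriv T (\<lambda>t. \<phi> t - c t) (\<lambda>t. deriv \<phi> t - d t)"
    using smooth_compact_support_sq_integrable[OF \<phi>] c d is_weak_deriv_smooth[OF \<phi>]
    by (intro is_weak_deriv_diff) (auto simp: L2_iff)
  moreover have "(\<lambda>t. deriv \<phi> t - d t) \<in> L2 T"
    using smooth_compact_support_sq_integrable[OF \<phi>] d by (auto simp: L2_iff intro: sq_integrable_diff)
  ultimately show ?thesis
    using L2_norm_weak_deriv[OF T] by (simp add: W12_norm_def L2_norm_eq)
qed

lemma zero_in_W12_0: "(\<lambda>t. 0) \<in> W12_0 T" if "0 < T"
proof -
  have z: "(\<lambda>t. 0) \<in> smooth_compact_support T"
  proof -
    have "(deriv ^^ n) (\<lambda>t::real. 0::real) = (\<lambda>t. 0)" for n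
      by (induction n) auto
    then show ?thesis by (auto simp: smooth_compact_support_def intro!: exI[of _ "{}"])
  qed
  have L: "(\<lambda>t. 0) \<in> L2 T" "is_weak_deriv T (\<lambda>t. 0) (\<lambda>t. 0)"
    by (auto simp: L2_iff sq_integrable_def is_weak_deriv_iff)
  have "W12_norm T (\<lambda>t. (\<lambda>t. 0) t - 0) = 0"
    by (subst W12_norm_smooth_diff[OF that z L(1) L]) (simp add: sq_norm_def)
  then show ?thesis
    using z L by (auto simp: W12_0_def W12_def intro!: exI[of _ "\<lambda>n t. 0"])
qed

section \<open>Sequential compactness of bounded sets in the Sobolev space\<close>

text \<open>Only dyadic convex combinations of the tail from \<open>N\<close> on. The parallelogram
  law uses nothing but midpoints, and with two rules every closure property is a short induction
  without weights.\<close>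

inductive_set midpoint_hull :: "(nat \<Rightarrow> real \<Rightarrow> real) \<Rightarrow> nat \<Rightarrow> (real \<Rightarrow> real) set"
  for x :: "nat \<Rightarrow> real \<Rightarrow> real" and N :: nat where
  base: "N \<le> n \<Longrightarrow> x n \<in> midpoint_hull x N"
| mid: "f \<in> midpoint_hull x N \<Longrightarrow> g \<in> midpoint_hull x N \<Longrightarrow> (\<lambda>t. (f t + g t) / 2) \<in> midpoint_hull x N"

lemma midpoint_hull_mono:
  assumes "f \<in> midpoint_hull x N" "M \<le> N"
  shows "f \<in> midpoint_hull x M"
  using assms by induction (auto intro: midpoint_hull.intros)

lemma midpoint_hull_smooth:
  assumes "f \<in> midpoint_hull x N" "\<And>n. x n \<in> smooth_compact_support T"
  shows "f \<in> smooth_compact_support T"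
  using assms(1)
proof induction
  case (mid f g)
  from smooth_compact_support_linear[OF mid.IH, of "1/2" "1/2"] show ?case
    by (simp add: add_divide_distrib)
qed (use assms in auto)

text \<open>Intervals are convex, so at each point the combinations inherit bounds
  (\<open>a = 0\<close>) and limits (\<open>a\<close> the limit, \<open>B\<close> small) from the
  tail.\<close>

lemma midpoint_hull_dist:
  assumes "f \<in> midpoint_hull x N" "\<And>n. n \<ge> N \<Longrightarrow> \<bar>x n t - a\<bar> \<le> B"
  shows "\<bar>f t - a\<bar> \<le> B"
  using assms by induction (auto simp: abs_le_iff field_simps)

lemma deriv_midpoint:
  assumes "f \<in> smooth_compact_support T" "g \<in> smooth_compact_support T"
  shows "deriv (\<lambda>t. (f t + g t) / 2) = (\<lambda>t. (deriv f t + deriv g t) / 2)"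
  using deriv_linear_smooth[OF assms, of "1/2" "1/2"] by (simp add: add_divide_distrib)

text \<open>
  Mazur's lemma for the derivatives: a tail of the midpoint hulls contains elements of almost
  minimal norm, and the parallelogram law makes those a Cauchy sequence.
\<close>

lemma midpoint_hull_Cauchy:
  assumes x: "\<And>n. x n \<in> smooth_compact_support T"
    and lim: "(\<lambda>n. sq_norm (lebesgue_on_Ioo T) (deriv (x n))) \<longlonglongrightarrow> l"
  obtains z where "\<And>n. z n \<in> midpoint_hull x n"
    "\<And>n. sq_norm (lebesgue_on_Ioo T) (deriv (z n)) \<le> sq_norm (lebesgue_on_Ioo T) (deriv (x n)) + 1 / real (Suc n)"
    "\<And>e. e > 0 \<Longrightarrow> \<exists>N. \<forall>i\<ge>N. \<forall>j\<ge>N. sq_norm (lebesgue_on_Ioo T) (\<lambda>t. deriv (z i) t - deriv (z j) t) < e"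
proof -
  define q where "q f = sq_norm (lebesgue_on_Ioo T) (deriv f)" for f :: "real \<Rightarrow> real"
  have q0: "0 \<le> q f" for f by (simp add: q_def)
  \<comment> \<open>The hulls shrink as \<open>N\<close> grows, so these infima increase;
    \<open>A n \<le> q (x n)\<close> bounds them, and so they converge to some
    \<open>a\<close>.\<close>
  define A where "A N = Inf (q ` midpoint_hull x N)" for N
  have ne: "midpoint_hull x N \<noteq> {}" for N
    using midpoint_hull.base[of N N x] by blast
  have bdd: "bdd_below (q ` midpoint_hull x N)" for N
    using q0 by (intro bdd_belowI[of _ 0]) auto
  have A_le: "A N \<le> q f" if "f \<in> midpoint_hull x N" for f N
    unfolding A_def using bdd that by (intro cInf_lower) auto
  have A0: "0 \<le> A N" for N
    unfolding A_def using ne q0 by (intro cInf_greatest) auto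
  have "incseq A"
  proof (rule incseq_SucI)
    fix n
    have "q ` midpoint_hull x (Suc n) \<subseteq> q ` midpoint_hull x n"
      using midpoint_hull_mono[of _ x "Suc n" n] by auto
    then show "A n \<le> A (Suc n)"
      unfolding A_def using ne bdd by (intro cInf_superset_mono) auto
  qed
  obtain B where B: "\<And>n. q (x n) \<le> B"
    using convergent_imp_Bseq[OF convergentI[OF lim]] unfolding Bseq_def q_def by force
  have "A n \<le> B" for n
    using A_le[OF midpoint_hull.base[of n n x]] B[of n] by linarith
  then obtain a where a: "A \<longlonglongrightarrow> a" "\<And>n. A n \<le> a"
    using incseq_convergent[OF \<open>incseq A\<close>] by blast
  have "\<exists>f\<in>midpoint_hull x n. q f < A n + 1 / real (Suc n)" for n
  proof -
    have "A n < A n + 1 / real (Suc n)" by simp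
    then show ?thesis
      unfolding A_def[of n] using cInf_lessD[of "q ` midpoint_hull x n"] ne by blast
  qed
  then obtain z where z: "\<And>n. z n \<in> midpoint_hull x n" "\<And>n. q (z n) < A n + 1 / real (Suc n)"
    by metis
  have zS: "z n \<in> smooth_compact_support T" for n
    using midpoint_hull_smooth[OF z(1) x] .
  \<comment> \<open>The right side of the parallelogram law: both norms are at most
    \<open>a + 1 / real (Suc N)\<close>, while the midpoint belongs to the hull and has norm at
    least \<open>A N\<close>.\<close>
  define eps where "eps N = 4 * (a + 1 / real (Suc N))\<^sup>2 - 4 * (A N)\<^sup>2" for N
  have diff: "(sq_norm (lebesgue_on_Ioo T) (\<lambda>t. deriv (z i) t - deriv (z j) t))\<^sup>2 \<le> eps N"
    if ij: "N \<le> i" "N \<le> j" for i j N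
  proof -
    have zi: "q (z i) \<le> a + 1 / real (Suc N)" if "N \<le> i" for i
    proof -
      have "1 / real (Suc i) \<le> 1 / real (Suc N)" using that by (simp add: frac_le)
      then show ?thesis using z(2)[of i] a(2)[of i] by linarith
    qed
    have "(\<lambda>t. (z i t + z j t) / 2) \<in> midpoint_hull x N"
      using z(1) ij midpoint_hull_mono by (blast intro: midpoint_hull.mid)
    from A_le[OF this] have m: "A N \<le> sq_norm (lebesgue_on_Ioo T) (\<lambda>t. (deriv (z i) t + deriv (z j) t) / 2)"
      by (simp add: q_def deriv_midpoint[OF zS zS])
    have "(sq_norm (lebesgue_on_Ioo T) (\<lambda>t. deriv (z i) t - deriv (z j) t))\<^sup>2 =
        2 * (q (z i))\<^sup>2 + 2 * (q (z j))\<^sup>2 - 4 * (sq_norm (lebesgue_on_Ioo T) (\<lambda>t. (deriv (z i) t + deriv (z j) t) / 2))\<^sup>2"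
      unfolding q_def using zS smooth_compact_support_sq_integrable(2) by (intro sq_norm_parallelogram) auto
    also have "\<dots> \<le> 2 * (a + 1 / real (Suc N))\<^sup>2 + 2 * (a + 1 / real (Suc N))\<^sup>2 - 4 * (A N)\<^sup>2"
      using zi ij q0 m A0 by (intro diff_mono add_mono mult_left_mono power_mono) auto
    finally show ?thesis by (simp add: eps_def)
  qed
  have "eps \<longlonglongrightarrow> 4 * (a + 0)\<^sup>2 - 4 * a\<^sup>2"
    unfolding eps_def[abs_def] by (intro tendsto_intros a(1) LIMSEQ_Suc[OF lim_1_over_n])
  then have eps: "eps \<longlonglongrightarrow> 0" by simp
  show thesis
  proof (rule that[OF z(1)])
    show "sq_norm (lebesgue_on_Ioo T) (deriv (z n)) \<le> sq_norm (lebesgue_on_Ioo T) (deriv (x n)) + 1 / real (Suc n)" for n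
      using z(2)[of n] A_le[OF midpoint_hull.base[of n n x]] by (simp add: q_def)
    show "\<exists>N. \<forall>i\<ge>N. \<forall>j\<ge>N. sq_norm (lebesgue_on_Ioo T) (\<lambda>t. deriv (z i) t - deriv (z j) t) < e" if "e > 0" for e
    proof -
      have "0 < e\<^sup>2" using that by simp
      from order_tendstoD(2)[OF eps this] obtain N where N: "eps N < e\<^sup>2"
        by (auto simp: eventually_sequentially)
      have "sq_norm (lebesgue_on_Ioo T) (\<lambda>t. deriv (z i) t - deriv (z j) t) < e" if "N \<le> i" "N \<le> j" for i j
        using diff[OF that] N \<open>e > 0\<close> by (intro power2_less_imp_less[of _ e]) auto
      then show ?thesis by blast
    qed
  qed
qed

text \<open>The Arzela-Ascoli argument: a subsequence converges at all rational times, and the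
  common Hoelder estimate carries the Cauchy property over to every other time.\<close>

lemma smooth_pointwise_convergent_subseq:
  assumes x: "\<And>n. x n \<in> smooth_compact_support T"
    and B: "\<And>n. sq_norm (lebesgue_on_Ioo T) (deriv (x n)) \<le> B"
  obtains r w where "strict_mono (r :: nat \<Rightarrow> nat)" "\<And>t. t \<in> {0..T} \<Longrightarrow> (\<lambda>n. x (r n) t) \<longlonglongrightarrow> w t"
proof -
  have "0 \<le> B" using B[of 0] sq_norm_nonneg order_trans by blast
  have Hoelder: "\<bar>x n t - x n s\<bar> \<le> sqrt \<bar>t - s\<bar> * B" for n s t
  proof -
    have "\<bar>x n t - x n s\<bar> \<le> sqrt \<bar>t - s\<bar> * sq_norm (lebesgue_on_Ioo T) (deriv (x n))"
      using smooth_compact_support_Hoelder[OF x[of n], of s t] smooth_compact_support_Hoelder[OF x[of n], of t s]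
      by (cases "s \<le> t") (auto simp: abs_minus_commute)
    also have "\<dots> \<le> sqrt \<bar>t - s\<bar> * B" using B by (intro mult_left_mono) auto
    finally show ?thesis .
  qed
  have "countable (\<rat> \<inter> {0..T})" by (simp add: countable_rat)
  moreover have "norm (x n t) \<le> sqrt T * B" if "t \<in> \<rat> \<inter> {0..T}" for n t
  proof -
    have "norm (x n t) \<le> sqrt T * sq_norm (lebesgue_on_Ioo T) (deriv (x n))"
      using smooth_compact_support_sup_bound[OF x[of n], of t] that by simp
    also have "\<dots> \<le> sqrt T * B" using B[of n] that by (intro mult_left_mono) auto
    finally show ?thesis .
  qed
  ultimately obtain r where r: "strict_mono (r :: nat \<Rightarrow> nat)"
    and conv: "\<And>t. t \<in> \<rat> \<inter> {0..T} \<Longrightarrow> \<exists>l. (\<lambda>n. x (r n) t) \<longlonglongrightarrow> l"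
    using function_convergent_subsequence[of "\<rat> \<inter> {0..T}" x "sqrt T * B"] by metis
  have "convergent (\<lambda>n. x (r n) t)" if t: "t \<in> {0..T}" for t
  \<comment> \<open>The rational neighbour \<open>s\<close> is taken strictly left of
    \<open>t\<close>, which leaves no room at 0; there all values are 0.\<close>
  proof (cases "t = 0")
    case True
    then show ?thesis
      using smooth_compact_support_eq_0(1)[OF x] by (auto intro: convergent_const)
  next
    case False
    with t have "0 < t" by simp
    have "Cauchy (\<lambda>n. x (r n) t)"
    proof (rule CauchyI)
      fix e :: real assume "0 < e"
      \<comment> \<open>Within distance \<open>\<eta>\<close> values change by less than
        \<open>e / 3\<close>, one of the three terms of the estimate; \<open>B + 1\<close> is
        positive even if \<open>B = 0\<close>.\<close>
      define \<eta> where "\<eta> = (e / (3 * (B + 1)))\<^sup>2"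
      have "\<eta> > 0" using \<open>0 < e\<close> \<open>0 \<le> B\<close> by (simp add: \<eta>_def)
      obtain s where s: "s \<in> \<rat>" "max 0 (t - \<eta>) < s" "s < t"
        using Rats_dense_in_real[of "max 0 (t - \<eta>)" t] \<open>0 < t\<close> \<open>\<eta> > 0\<close> by auto
      then have "\<bar>t - s\<bar> \<le> \<eta>" by auto
      then have "sqrt \<bar>t - s\<bar> \<le> e / (3 * (B + 1))"
        using \<open>0 < e\<close> \<open>0 \<le> B\<close> by (intro real_le_lsqrt) (auto simp: \<eta>_def)
      then have "sqrt \<bar>t - s\<bar> * B \<le> e / (3 * (B + 1)) * B"
        using \<open>0 \<le> B\<close> by (rule mult_right_mono)
      also have "\<dots> < e / 3"
        using \<open>0 < e\<close> \<open>0 \<le> B\<close> by (simp add: field_simps)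
      finally have close: "\<bar>x n t - x n s\<bar> < e / 3" for n
        using Hoelder[of n t s] by linarith
      have "s \<in> \<rat> \<inter> {0..T}" using s t by auto
      from conv[OF this] have "Cauchy (\<lambda>n. x (r n) s)"
        by (auto intro: LIMSEQ_imp_Cauchy)
      then obtain M where M: "\<And>m n. M \<le> m \<Longrightarrow> M \<le> n \<Longrightarrow> norm (x (r m) s - x (r n) s) < e / 3"
        using CauchyD[of _ "e / 3"] \<open>0 < e\<close> by (metis divide_pos_pos zero_less_numeral)
      have "norm (x (r m) t - x (r n) t) < e" if "M \<le> m" "M \<le> n" for m n
        using M[OF that] close[of "r m"] close[of "r n"] unfolding real_norm_def by linarith
      then show "\<exists>M. \<forall>m\<ge>M. \<forall>n\<ge>M. norm (x (r m) t - x (r n) t) < e" by blast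
    qed
    then show ?thesis by (simp add: Cauchy_convergent_iff)
  qed
  then have "\<And>t. t \<in> {0..T} \<Longrightarrow> (\<lambda>n. x (r n) t) \<longlonglongrightarrow> lim (\<lambda>n. x (r n) t)"
    by (simp add: convergent_LIMSEQ_iff)
  from that[OF r this] show thesis .
qed

text \<open>The derivatives of \<open>x n\<close> need not converge strongly. The hull elements
  \<open>z n\<close> have the same pointwise limit and derivatives that do converge in L2, so they
  witness that \<open>w\<close> lies in the closure of the test functions.\<close>

lemma W12_0_limit:
  assumes T: "0 < T"
    and x: "\<And>n. x n \<in> smooth_compact_support T"
    and lim: "(\<lambda>n. sq_norm (lebesgue_on_Ioo T) (deriv (x n))) \<longlonglongrightarrow> l"
    and w: "\<And>t. t \<in> {0..T} \<Longrightarrow> (\<lambda>n. x n t) \<longlonglongrightarrow> w t"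
  shows "w \<in> W12_0 T" "L2_norm T (weak_deriv T w) \<le> l"
proof -
  let ?M = "lebesgue_on_Ioo T"
  interpret finite_measure ?M by (rule finite_measure_Ioo)
  obtain B where B: "\<And>n. sq_norm ?M (deriv (x n)) \<le> B"
    using convergent_imp_Bseq[OF convergentI[OF lim]] unfolding Bseq_def by force
  have "0 \<le> B" using B[of 0] sq_norm_nonneg order_trans by blast
  obtain z where zh: "\<And>n. z n \<in> midpoint_hull x n"
    and zn: "\<And>n. sq_norm ?M (deriv (z n)) \<le> sq_norm ?M (deriv (x n)) + 1 / real (Suc n)"
    and zC: "\<And>e. e > 0 \<Longrightarrow> \<exists>N. \<forall>i\<ge>N. \<forall>j\<ge>N. sq_norm ?M (\<lambda>t. deriv (z i) t - deriv (z j) t) < e"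
    using midpoint_hull_Cauchy[OF x lim] by blast
  have zS: "z n \<in> smooth_compact_support T" for n
    using midpoint_hull_smooth[OF zh x] .
  note zsq = smooth_compact_support_sq_integrable[OF zS]
  have z_lim: "(\<lambda>n. z n t) \<longlonglongrightarrow> w t" if t: "t \<in> {0..T}" for t
  proof (rule LIMSEQ_I)
    fix e :: real assume "0 < e"
    then obtain N where N: "\<And>n. n \<ge> N \<Longrightarrow> \<bar>x n t - w t\<bar> < e / 2"
      using LIMSEQ_D[OF w[OF t], of "e / 2"] by auto
    have "\<bar>z n t - w t\<bar> \<le> e / 2" if "n \<ge> N" for n
      using zh[of n] by (rule midpoint_hull_dist) (use N that in \<open>auto intro: less_imp_le\<close>)
    then show "\<exists>no. \<forall>n\<ge>no. norm (z n t - w t) < e"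
      using \<open>0 < e\<close> by (intro exI[of _ N]) force
  qed
  obtain d where d: "sq_integrable ?M d" "(\<lambda>n. sq_norm ?M (\<lambda>t. deriv (z n) t - d t)) \<longlonglongrightarrow> 0"
    using sq_norm_complete[OF zsq(2) zC] by blast
  have "(\<lambda>n. sq_norm ?M (deriv (z n)) - sq_norm ?M d) \<longlonglongrightarrow> 0"
    by (rule Lim_null_comparison[OF _ d(2)]) (simp add: abs_sq_norm_diff_le zsq d)
  then have zd: "(\<lambda>n. sq_norm ?M (deriv (z n))) \<longlonglongrightarrow> sq_norm ?M d"
    by (simp add: LIM_zero_iff)
  \<comment> \<open>Each \<open>z n\<close> has a derivative norm at most slightly above that of
    \<open>x n\<close>, so the bound by \<open>l\<close> survives the passage to
    combinations.\<close>
  have "(\<lambda>n. sq_norm ?M (deriv (x n)) + 1 / real (Suc n)) \<longlonglongrightarrow> l + 0"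
    by (intro tendsto_intros lim LIMSEQ_Suc[OF lim_1_over_n])
  then have dl: "sq_norm ?M d \<le> l"
    using LIMSEQ_le[OF zd] zn by simp
  have [measurable]: "z n \<in> borel_measurable ?M" for n
    using zsq(1) by (simp add: sq_integrable_def)
  have z_bound: "\<bar>z n t\<bar> \<le> sqrt T * B" if "t \<in> {0..T}" for n t
  proof -
    have "\<bar>x n t - 0\<bar> \<le> sqrt T * B" for n
    proof -
      have "\<bar>x n t\<bar> \<le> sqrt T * sq_norm ?M (deriv (x n))"
        by (rule smooth_compact_support_sup_bound[OF x that])
      also have "\<dots> \<le> sqrt T * B" using B[of n] T by (intro mult_left_mono) auto
      finally show ?thesis by simp
    qed
    then have "\<bar>z n t - 0\<bar> \<le> sqrt T * B"
      using midpoint_hull_dist[OF zh[of n], of t 0] by blast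
    then show ?thesis by simp
  qed
  have w_bound: "\<bar>w t\<bar> \<le> sqrt T * B" if "t \<in> {0..T}" for t
    using LIMSEQ_le_const2[OF tendsto_rabs[OF z_lim[OF that]]] z_bound[OF that] by blast
  have space: "t \<in> {0..T}" if "t \<in> space ?M" for t
    using that by (auto simp: space_restrict_space)
  have [measurable]: "w \<in> borel_measurable ?M"
    by (rule borel_measurable_LIMSEQ_real[where u = z]) (use z_lim space in auto)
  have w_sq: "sq_integrable ?M w"
    unfolding sq_integrable_def
  proof
    show "integrable ?M (\<lambda>x. (w x)\<^sup>2)"
    proof (rule integrable_const_bound)
      show "AE t in ?M. norm ((w t)\<^sup>2) \<le> (sqrt T * B)\<^sup>2"
        using power_mono[OF w_bound[OF space] abs_ge_zero, of _ 2] by (intro AE_I2) simp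
    qed simp
  qed simp
  have "(\<lambda>n. LINT t|?M. (z n t - w t)\<^sup>2) \<longlonglongrightarrow> (LINT t|?M. 0)"
  proof (rule integral_dominated_convergence[where w = "\<lambda>t. (2 * (sqrt T * B))\<^sup>2"])
    show "AE t in ?M. (\<lambda>n. (z n t - w t)\<^sup>2) \<longlonglongrightarrow> 0"
    proof (rule AE_I2)
      fix t assume "t \<in> space ?M"
      from tendsto_power[OF LIM_zero[OF z_lim[OF space[OF this]]], of 2]
      show "(\<lambda>n. (z n t - w t)\<^sup>2) \<longlonglongrightarrow> 0" by simp
    qed
    show "AE t in ?M. norm ((z n t - w t)\<^sup>2) \<le> (2 * (sqrt T * B))\<^sup>2" for n
    proof (rule AE_I2)
      fix t assume "t \<in> space ?M"
      then have "\<bar>z n t - w t\<bar> \<le> 2 * (sqrt T * B)"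
        using z_bound[OF space, of t n] w_bound[OF space, of t] by linarith
      from power_mono[OF this abs_ge_zero, of 2] show "norm ((z n t - w t)\<^sup>2) \<le> (2 * (sqrt T * B))\<^sup>2"
        by simp
    qed
  qed simp_all
  then have zw: "(\<lambda>n. sq_norm ?M (\<lambda>t. z n t - w t)) \<longlonglongrightarrow> 0"
    unfolding sq_norm_def using tendsto_real_sqrt by fastforce
  \<comment> \<open>By Cauchy-Schwarz, pairing with a fixed square integrable function is
    continuous; this takes integration by parts for \<open>z n\<close> to the limit on both
    sides.\<close>
  have pair_lim: "(\<lambda>n. LINT t|?M. f n t * \<phi> t) \<longlonglongrightarrow> (LINT t|?M. g t * \<phi> t)"
    if f: "\<And>n. sq_integrable ?M (f n)" and g: "sq_integrable ?M g" and \<phi>: "sq_integrable ?M \<phi>"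
      and fg: "(\<lambda>n. sq_norm ?M (\<lambda>t. f n t - g t)) \<longlonglongrightarrow> 0" for f g \<phi>
  proof -
    have "(\<lambda>n. (LINT t|?M. f n t * \<phi> t) - (LINT t|?M. g t * \<phi> t)) \<longlonglongrightarrow> 0"
    proof (rule Lim_null_comparison)
      show "(\<lambda>n. sq_norm ?M (\<lambda>t. f n t - g t) * sq_norm ?M \<phi>) \<longlonglongrightarrow> 0"
        using tendsto_mult_right[OF fg, of "sq_norm ?M \<phi>"] by simp
      have "(LINT t|?M. f n t * \<phi> t) - (LINT t|?M. g t * \<phi> t) = (LINT t|?M. (f n t - g t) * \<phi> t)" for n
        using integrable_mult_sq[OF f[of n] \<phi>] integrable_mult_sq[OF g \<phi>] by (simp add: left_diff_distrib)
      then show "\<forall>\<^sub>F n in sequentially. norm ((LINT t|?M. f n t * \<phi> t) - (LINT t|?M. g t * \<phi> t)) \<le>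
          sq_norm ?M (\<lambda>t. f n t - g t) * sq_norm ?M \<phi>"
        using abs_integral_mult_le[OF sq_integrable_diff[OF f g] \<phi>] by simp
    qed
    then show ?thesis by (simp add: LIM_zero_iff)
  qed
  have wd: "is_weak_deriv T w d"
    unfolding is_weak_deriv_iff
  proof
    fix \<phi> assume \<phi>: "\<phi> \<in> smooth_compact_support T"
    note sq = smooth_compact_support_sq_integrable[OF \<phi>]
    have "(\<lambda>n. LINT t|?M. z n t * deriv \<phi> t) \<longlonglongrightarrow> (LINT t|?M. w t * deriv \<phi> t)"
      by (rule pair_lim[OF zsq(1) w_sq sq(2) zw])
    moreover have "(\<lambda>n. - (LINT t|?M. deriv (z n) t * \<phi> t)) \<longlonglongrightarrow> - (LINT t|?M. d t * \<phi> t)"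
      by (intro tendsto_minus pair_lim zsq d sq)
    then have "(\<lambda>n. LINT t|?M. z n t * deriv \<phi> t) \<longlonglongrightarrow> - (LINT t|?M. d t * \<phi> t)"
      by (simp add: smooth_compact_support_integral_by_parts[OF zS \<phi>])
    ultimately show "(LINT t|?M. w t * deriv \<phi> t) = - (LINT t|?M. d t * \<phi> t)"
      by (rule LIMSEQ_unique)
  qed
  have L2: "w \<in> L2 T" "d \<in> L2 T" using w_sq d by (auto simp: L2_iff)
  have "(\<lambda>n. W12_norm T (\<lambda>t. z n t - w t)) \<longlonglongrightarrow> sqrt (0\<^sup>2 + 0\<^sup>2)"
    unfolding W12_norm_smooth_diff[OF T zS L2 wd] by (intro tendsto_intros zw d)
  then show "w \<in> W12_0 T"
    using L2 wd zS by (auto simp: W12_0_def W12_def)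
  show "L2_norm T (weak_deriv T w) \<le> l"
    using L2_norm_weak_deriv[OF T L2(2) wd] dl by (simp add: L2_norm_eq)
qed

lemma W12_0_compact:
  assumes T: "0 < T" and c: "\<And>n. c n \<in> W12_0 T"
    and lim: "(\<lambda>n. L2_norm T (weak_deriv T (c n))) \<longlonglongrightarrow> l"
  obtains r w where "strict_mono (r :: nat \<Rightarrow> nat)" "w \<in> W12_0 T"
    "AE t in lborel. t \<in> {0<..<T} \<longrightarrow> (\<lambda>n. c (r n) t) \<longlonglongrightarrow> w t" "L2_norm T (weak_deriv T w) \<le> l"
proof -
  let ?M = "lebesgue_on_Ioo T"
  interpret finite_measure ?M by (rule finite_measure_Ioo)
  have cW: "c n \<in> W12 T" and cL: "c n \<in> L2 T" for n
    using c[of n] by (auto simp: W12_0_def W12_def)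
  note wd = W12_weak_deriv[OF cW]
  have "\<exists>\<phi>\<in>smooth_compact_support T. W12_norm T (\<lambda>t. \<phi> t - c n t) < 1 / real (Suc n)" for n
  proof -
    obtain \<phi> where "\<And>m::nat. \<phi> m \<in> smooth_compact_support T" "(\<lambda>m. W12_norm T (\<lambda>t. \<phi> m t - c n t)) \<longlonglongrightarrow> 0"
      using c[of n] unfolding W12_0_def by blast
    moreover have "0 < 1 / real (Suc n)" by simp
    ultimately show ?thesis
      using order_tendstoD(2) eventually_happens sequentially_bot by blast
  qed
  then obtain \<psi> where \<psi>: "\<And>n. \<psi> n \<in> smooth_compact_support T"
    and \<psi>c: "\<And>n. W12_norm T (\<lambda>t. \<psi> n t - c n t) < 1 / real (Suc n)"
    by metis
  note \<psi>sq = smooth_compact_support_sq_integrable[OF \<psi>]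
  have le: "sq_norm ?M (\<lambda>t. \<psi> n t - c n t) \<le> 1 / real (Suc n)"
    "sq_norm ?M (\<lambda>t. deriv (\<psi> n) t - weak_deriv T (c n) t) \<le> 1 / real (Suc n)" for n
  proof -
    let ?a = "sq_norm ?M (\<lambda>t. \<psi> n t - c n t)"
      and ?b = "sq_norm ?M (\<lambda>t. deriv (\<psi> n) t - weak_deriv T (c n) t)"
    have s: "sqrt (?a\<^sup>2 + ?b\<^sup>2) < 1 / real (Suc n)"
      using \<psi>c[of n] by (simp add: W12_norm_smooth_diff[OF T \<psi> cL wd])
    have "?a \<le> sqrt (?a\<^sup>2 + ?b\<^sup>2)" "?b \<le> sqrt (?a\<^sup>2 + ?b\<^sup>2)"
      by (simp_all add: real_le_rsqrt)
    with s show "?a \<le> 1 / real (Suc n)" "?b \<le> 1 / real (Suc n)" by linarith+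
  qed
  have inv0: "(\<lambda>n. 1 / real (Suc n)) \<longlonglongrightarrow> 0" by (rule LIMSEQ_Suc[OF lim_1_over_n])
  have "(\<lambda>n. sq_norm ?M (\<lambda>t. \<psi> n t - c n t)) \<longlonglongrightarrow> 0"
    by (rule Lim_null_comparison[OF _ inv0]) (simp add: le(1) del: of_nat_Suc)
  then obtain r1 where r1: "strict_mono (r1 :: nat \<Rightarrow> nat)"
    and ae1: "AE t in ?M. (\<lambda>n. \<psi> (r1 n) t - c (r1 n) t) \<longlonglongrightarrow> 0"
    using AE_subseq_of_sq_norm_tendsto_0[of "\<lambda>n t. \<psi> n t - c n t"] sq_integrable_diff[OF \<psi>sq(1)] cL
    by (auto simp: L2_iff)
  have "(\<lambda>n. sq_norm ?M (deriv (\<psi> n)) - sq_norm ?M (weak_deriv T (c n))) \<longlonglongrightarrow> 0"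
  proof (rule Lim_null_comparison[OF _ inv0], rule always_eventually, rule allI)
    fix n
    have "norm (sq_norm ?M (deriv (\<psi> n)) - sq_norm ?M (weak_deriv T (c n))) \<le>
        sq_norm ?M (\<lambda>t. deriv (\<psi> n) t - weak_deriv T (c n) t)"
      using abs_sq_norm_diff_le[OF \<psi>sq(2)] wd(1) by (simp add: L2_iff)
    also note le(2)[of n]
    finally show "norm (sq_norm ?M (deriv (\<psi> n)) - sq_norm ?M (weak_deriv T (c n))) \<le> 1 / real (Suc n)" .
  qed
  from tendsto_add[OF this lim] have \<psi>l: "(\<lambda>n. sq_norm ?M (deriv (\<psi> n))) \<longlonglongrightarrow> l"
    by (simp add: L2_norm_eq)
  then obtain B where B: "\<And>n. sq_norm ?M (deriv (\<psi> n)) \<le> B"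
    using convergent_imp_Bseq[OF convergentI[OF \<psi>l]] unfolding Bseq_def by force
  obtain r2 w where r2: "strict_mono (r2 :: nat \<Rightarrow> nat)"
    and w: "\<And>t. t \<in> {0..T} \<Longrightarrow> (\<lambda>n. \<psi> (r1 (r2 n)) t) \<longlonglongrightarrow> w t"
    using smooth_pointwise_convergent_subseq[of "\<lambda>n. \<psi> (r1 n)"] \<psi> B by metis
  have r: "strict_mono (r1 \<circ> r2)" using r1 r2 by (rule strict_mono_o)
  have "(\<lambda>n. sq_norm ?M (deriv (\<psi> (r1 (r2 n))))) \<longlonglongrightarrow> l"
    using LIMSEQ_subseq_LIMSEQ[OF \<psi>l r] by (simp add: o_def)
  note W = W12_0_limit[OF T \<psi> this w]
  have "AE t in ?M. (\<lambda>n. c ((r1 \<circ> r2) n) t) \<longlonglongrightarrow> w t"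
    using ae1 AE_space
  proof eventually_elim
    case (elim t)
    then have "t \<in> {0..T}" by (auto simp: space_restrict_space)
    \<comment> \<open>Here \<open>c\<close> is written as \<open>\<psi> - (\<psi> - c)\<close>: the
      first part converges at every time, the second tends to 0 at almost every time along
      \<open>r1\<close>.\<close>
    from tendsto_diff[OF w[OF this] LIMSEQ_subseq_LIMSEQ[OF elim(1) r2]]
    show ?case by (simp add: o_def)
  qed
  then show thesis
    using that[OF r W(1) _ W(2)] by (simp add: AE_Ioo_iff)
qed

section \<open>The Radon transform of convergent image sequences\<close>

lemma closed_segment_real_iff: "q \<in> closed_segment a b \<longleftrightarrow> min a b \<le> q \<and> q \<le> max a (b :: real)"
  by (auto simp: closed_segment_eq_real_ivl)

lemma negligible_borel_imp_null_sets_lborel: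
  assumes "negligible S" "S \<in> sets borel"
  shows "S \<in> null_sets lborel"
  using assms null_sets_completion_iff[of S lborel] by (simp add: negligible_iff_null_sets)

text \<open>
  The third assumption makes \<open>(q, r) \<mapsto> line (\<theta>, q) r\<close> the inverse of a linear map, so that null sets
  meet almost every line in a null set.
\<close>

locale line_family =
  fixes line :: "real \<times> 'q::euclidean_space \<Rightarrow> real \<Rightarrow> 'a::euclidean_space"
  assumes line_continuous: "continuous_on UNIV (\<lambda>z. line (fst z) (snd z))"
    and line_dim: "DIM('a) \<le> DIM('q) + 1"
    and line_inverse: "\<And>\<theta>. \<exists>M. linear M \<and> (\<forall>q r. M (line (\<theta>, q) r) = (q, r))"
    and line_norm: "\<And>p r. \<bar>r\<bar> \<le> norm (line p r)"
begin

lemma line_borel: "(\<lambda>z. line (fst z) (snd z)) \<in> borel_measurable (borel \<Otimes>\<^sub>M borel)"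
  using borel_measurable_continuous_onI[OF line_continuous] by (simp add: borel_prod)

lemma line_measurable [measurable (raw)]:
  assumes [measurable]: "f \<in> borel_measurable M" "g \<in> borel_measurable M"
  shows "(\<lambda>x. line (f x) (g x)) \<in> borel_measurable M"
proof -
  have "(\<lambda>x. (f x, g x)) \<in> M \<rightarrow>\<^sub>M borel \<Otimes>\<^sub>M borel" by measurable
  from measurable_compose[OF this line_borel] show ?thesis by simp
qed

lemma AE_line_notin_null_set:
  assumes N: "N \<in> null_sets lborel"
  shows "AE p in lborel. AE r in lborel. line p r \<notin> N"
proof -
  have [measurable]: "N \<in> sets borel" using N by auto
  \<comment> \<open>The measure of the parameters at which the line lies in \<open>N\<close>. Being
    Borel in \<open>p\<close>, it allows the statements for single angles to be assembled into one
    about almost all lines.\<close>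
  define h where "h p = (\<integral>\<^sup>+ r. indicator N (line p r) \<partial>lborel)" for p
  have hp: "h p = 0 \<longleftrightarrow> (AE r in lborel. line p r \<notin> N)" for p
    unfolding h_def by (subst nn_integral_0_iff_AE) (auto simp: indicator_def)
  have hm: "h \<in> borel_measurable borel"
    unfolding h_def[abs_def] by measurable
  have fib: "AE q in lborel. h (\<theta>, q) = 0" for \<theta>
  proof -
    obtain M where M: "linear M" "\<And>q r. M (line (\<theta>, q) r) = (q, r)"
      using line_inverse by blast
    have "negligible N"
      using N by (auto simp: negligible_iff_null_sets intro: null_sets_completionI)
    moreover have "M differentiable_on N"
      using M(1) by (simp add: linear_imp_differentiable_on)
    ultimately have "negligible (M ` N)"
      using line_dim by (intro negligible_differentiable_image_negligible) auto
    moreover have "{z. line (\<theta>, fst z) (snd z) \<in> N} \<subseteq> M ` N"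
    proof
      fix z assume "z \<in> {z. line (\<theta>, fst z) (snd z) \<in> N}"
      then have "M (line (\<theta>, fst z) (snd z)) \<in> M ` N" by simp
      then show "z \<in> M ` N" by (simp add: M(2))
    qed
    ultimately have "negligible {z. line (\<theta>, fst z) (snd z) \<in> N}"
      by (rule negligible_subset)
    moreover have "{z. line (\<theta>, fst z) (snd z) \<in> N} \<in> sets borel"
    proof -
      have "(\<lambda>z. line (\<theta>, fst z) (snd z)) \<in> borel_measurable (borel :: ('q \<times> real) measure)"
        unfolding borel_prod[symmetric] by measurable
      from measurable_sets[OF this \<open>N \<in> sets borel\<close>] show ?thesis
        by (simp add: vimage_def)
    qed
    ultimately have "{z. line (\<theta>, fst z) (snd z) \<in> N} \<in> null_sets lborel"
      by (rule negligible_borel_imp_null_sets_lborel)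
    then have "AE z in lborel \<Otimes>\<^sub>M lborel. line (\<theta>, fst z) (snd z) \<notin> N"
      unfolding lborel_prod by (rule AE_I') auto
    from lborel_pair.AE_pair[OF this] show ?thesis
      by (simp add: hp)
  qed
  have "AE z in lborel \<Otimes>\<^sub>M lborel. h z = 0"
  proof (rule lborel_pair.AE_pair_measure)
    show "{x \<in> space (lborel \<Otimes>\<^sub>M lborel). h x = 0} \<in> sets (lborel \<Otimes>\<^sub>M lborel)"
      using hm unfolding lborel_prod by measurable
    show "AE x in lborel. AE y in lborel. h (x, y) = 0"
      using fib by simp
  qed
  then show ?thesis unfolding lborel_prod hp .
qed

end

locale radon_setting = line_family line
  for line :: "real \<times> 'q::euclidean_space \<Rightarrow> real \<Rightarrow> 'a::euclidean_space" +
  fixes coll :: "real \<times> 'q \<Rightarrow> real" and \<Omega> :: "'a set" and \<mu> :: "'a \<Rightarrow> real"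
  assumes open_\<Omega>: "open \<Omega>" and bounded_\<Omega>: "bounded \<Omega>"
    and coll_borel [measurable]: "coll \<in> borel_measurable borel"
    and \<mu>_borel: "set_borel_measurable lborel \<Omega> \<mu>"
begin

lemma \<Omega>_borel [measurable]: "\<Omega> \<in> sets borel"
  using open_\<Omega> by simp

lemma attenuation_bounds:
  "0 \<le> attenuation line coll \<Omega> \<mu> p r" "attenuation line coll \<Omega> \<mu> p r \<le> 1"
  by (auto simp: attenuation_def Let_def)

lemma attenuation_measurable [measurable (raw)]:
  assumes [measurable]: "f \<in> borel_measurable M" "g \<in> borel_measurable M"
  shows "(\<lambda>x. attenuation line coll \<Omega> \<mu> (f x) (g x)) \<in> borel_measurable M"
proof -
  have [measurable]: "(\<lambda>x. indicator \<Omega> x * \<mu> x) \<in> borel_measurable borel"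
    using \<mu>_borel by (simp add: set_borel_measurable_def)
  \<comment> \<open>The map \<open>\<mu>\<close> is measurable on \<open>\<Omega>\<close> only, so
    it is cut off there, and the segment is written by inequalities that are jointly measurable in
    \<open>p\<close>, \<open>r\<close> and \<open>q\<close>.\<close>
  define I where "I p r = (\<integral>\<^sup>+ q. ennreal (indicator \<Omega> (line p q) * \<mu> (line p q)) *
      (if min r (coll p) \<le> q \<and> q \<le> max r (coll p) then 1 else 0) \<partial>lborel)" for p r
  have eq: "attenuation line coll \<Omega> \<mu> p r = (if I p r = \<infinity> then 0 else exp (- enn2real (I p r)))" for p r
  proof -
    have "(\<integral>\<^sup>+ q. ennreal (\<mu> (line p q)) *
        indicator {q \<in> closed_segment r (coll p). line p q \<in> \<Omega>} q \<partial>lborel) = I p r"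
      unfolding I_def by (intro nn_integral_cong) (auto simp: indicator_def closed_segment_real_iff)
    then show ?thesis by (simp add: attenuation_def)
  qed
  have [measurable]: "(\<lambda>x. I (f x) (g x)) \<in> borel_measurable M"
    unfolding I_def by measurable
  show ?thesis unfolding eq by measurable
qed

text \<open>Measurability of \<open>u k\<close> and \<open>c k\<close> is known on
  \<open>\<Omega>\<close> and \<open>A\<close> only, so \<open>G\<close> is the transform of their
  extensions by 0; at times in \<open>A\<close> nothing changes.\<close>

lemma radon_image_seq_measurable:
  assumes u: "\<And>k. k \<in> {1..K} \<Longrightarrow> set_borel_measurable lborel \<Omega> (u k)"
    and c: "\<And>k. k \<in> {1..K} \<Longrightarrow> set_borel_measurable lborel A (c k)"
  obtains G where "G \<in> borel_measurable borel"
    "\<And>p t. t \<in> A \<Longrightarrow> radon line coll \<Omega> \<mu> (image_seq K u c) (p, t) = G (p, t)"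
proof -
  define U where "U k x = indicator \<Omega> x * u k x" for k x
  define C where "C k t = indicator A t * c k t" for k t
  have [measurable]: "\<And>k. k \<in> {1..K} \<Longrightarrow> U k \<in> borel_measurable borel"
    "\<And>k. k \<in> {1..K} \<Longrightarrow> C k \<in> borel_measurable borel"
    using u c by (auto simp: set_borel_measurable_def U_def[abs_def] C_def[abs_def])
  define G where "G z = (LINT r|lborel. (\<Sum>k=1..K. U k (line (fst z) r) * C k (snd z)) *
      attenuation line coll \<Omega> \<mu> (fst z) r)" for z
  have "G \<in> borel_measurable (borel \<Otimes>\<^sub>M borel)"
    unfolding G_def[abs_def] by measurable
  moreover have "radon line coll \<Omega> \<mu> (image_seq K u c) (p, t) = G (p, t)" if "t \<in> A" for p t
    using that unfolding radon_def G_def image_seq_def set_lebesgue_integral_def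
    by (auto intro!: Bochner_Integration.integral_cong simp: U_def C_def indicator_def)
  ultimately show thesis using that by (simp add: borel_prod)
qed

text \<open>By \<open>line_norm\<close> the parameters of points of a bounded set are bounded. Thus
  constants on a section can serve as dominating functions.\<close>

lemma line_section_finite: "emeasure lborel {r. line p r \<in> \<Omega>} < \<infinity>"
proof -
  obtain B where "\<And>x. x \<in> \<Omega> \<Longrightarrow> norm x \<le> B"
    using bounded_\<Omega> by (auto simp: bounded_iff)
  then have "{r. line p r \<in> \<Omega>} \<subseteq> {-B..B}"
  proof (intro subsetI)
    fix r assume "r \<in> {r. line p r \<in> \<Omega>}"
    then have "norm (line p r) \<le> B" using \<open>\<And>x. x \<in> \<Omega> \<Longrightarrow> norm x \<le> B\<close> by simp
    then show "r \<in> {-B..B}" using line_norm[of r p] by auto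
  qed
  then have "emeasure lborel {r. line p r \<in> \<Omega>} \<le> emeasure lborel {-B..B}"
    by (intro emeasure_mono) auto
  also have "\<dots> < \<infinity>" by (cases "-B \<le> B") auto
  finally show ?thesis .
qed

text \<open>The exceptional lines come from the null set of \<open>u\<close> alone and are discarded
  before a time is chosen, so \<open>t\<close> stands inside the quantifier over lines. For fixed
  \<open>t\<close> the integrand is dominated: \<open>u\<close> and the attenuation are at most 1 in
  absolute value, and the convergent sequences \<open>c n k t\<close> are bounded.\<close>

lemma radon_image_seq_tendsto:
  fixes u :: "nat \<Rightarrow> nat \<Rightarrow> 'a \<Rightarrow> real" and c :: "nat \<Rightarrow> nat \<Rightarrow> real \<Rightarrow> real"
  assumes u: "\<And>n k. k \<in> {1..K} \<Longrightarrow> set_borel_measurable lborel \<Omega> (u n k)"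
    and w: "\<And>k. k \<in> {1..K} \<Longrightarrow> set_borel_measurable lborel \<Omega> (w k)"
    and bound: "\<And>n k. k \<in> {1..K} \<Longrightarrow> AE x in lborel. x \<in> \<Omega> \<longrightarrow> \<bar>u n k x\<bar> \<le> 1"
    and lim: "\<And>k. k \<in> {1..K} \<Longrightarrow> AE x in lborel. x \<in> \<Omega> \<longrightarrow> (\<lambda>n. u n k x) \<longlonglongrightarrow> w k x"
  shows "AE p in lborel. \<forall>t. (\<forall>k\<in>{1..K}. (\<lambda>n. c n k t) \<longlonglongrightarrow> d k t) \<longrightarrow>
    (\<lambda>n. radon line coll \<Omega> \<mu> (image_seq K (u n) (c n)) (p, t)) \<longlonglongrightarrow>
      radon line coll \<Omega> \<mu> (image_seq K w d) (p, t)"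
proof -
  have "AE x in lborel. \<forall>k\<in>{1..K}. x \<in> \<Omega> \<longrightarrow> (\<forall>n. \<bar>u n k x\<bar> \<le> 1) \<and> (\<lambda>n. u n k x) \<longlonglongrightarrow> w k x"
  proof (rule AE_finite_allI)
    fix k assume k: "k \<in> {1..K}"
    have "AE x in lborel. \<forall>n. x \<in> \<Omega> \<longrightarrow> \<bar>u n k x\<bar> \<le> 1"
      unfolding AE_all_countable using bound[OF k] by blast
    with lim[OF k] show "AE x in lborel. x \<in> \<Omega> \<longrightarrow> (\<forall>n. \<bar>u n k x\<bar> \<le> 1) \<and> (\<lambda>n. u n k x) \<longlonglongrightarrow> w k x"
      by eventually_elim auto
  qed simp
  then obtain N where good0: "\<And>x. x \<in> space lborel - N \<Longrightarrow>
      \<forall>k\<in>{1..K}. x \<in> \<Omega> \<longrightarrow> (\<forall>n. \<bar>u n k x\<bar> \<le> 1) \<and> (\<lambda>n. u n k x) \<longlonglongrightarrow> w k x"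
    and N: "N \<in> null_sets lborel"
    by (rule AE_E3) (rule that)
  have good: "(\<forall>n. \<bar>u n k x\<bar> \<le> 1) \<and> (\<lambda>n. u n k x) \<longlonglongrightarrow> w k x" if "x \<notin> N" "k \<in> {1..K}" "x \<in> \<Omega>" for x k
    using good0[of x] that by simp
  show ?thesis
    using AE_line_notin_null_set[OF N]
  proof eventually_elim
    case (elim p)
    show ?case
    proof (intro allI impI)
      fix t assume c: "\<forall>k\<in>{1..K}. (\<lambda>n. c n k t) \<longlonglongrightarrow> d k t"
      have "\<exists>B. \<forall>n. \<bar>c n k t\<bar> \<le> B" if "k \<in> {1..K}" for k
      proof -
        have "Bseq (\<lambda>n. c n k t)"
          using c that by (blast intro: convergent_imp_Bseq convergentI)
        then show ?thesis unfolding Bseq_def real_norm_def by blast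
      qed
      then obtain B where B: "\<And>n k. k \<in> {1..K} \<Longrightarrow> \<bar>c n k t\<bar> \<le> B k" by metis
      define U where "U n k x = indicator \<Omega> x * u n k x" for n k x
      define W where "W k x = indicator \<Omega> x * w k x" for k x
      have [measurable]: "\<And>n k. k \<in> {1..K} \<Longrightarrow> U n k \<in> borel_measurable borel"
        "\<And>k. k \<in> {1..K} \<Longrightarrow> W k \<in> borel_measurable borel"
        using u w by (auto simp: set_borel_measurable_def U_def[abs_def] W_def[abs_def])
      let ?att = "\<lambda>r. attenuation line coll \<Omega> \<mu> p r"
      have "(\<lambda>n. LINT r|lborel. (\<Sum>k=1..K. U n k (line p r) * c n k t) * ?att r) \<longlonglongrightarrow>
          (LINT r|lborel. (\<Sum>k=1..K. W k (line p r) * d k t) * ?att r)"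
      proof (rule integral_dominated_convergence[where w = "\<lambda>r. indicator {r. line p r \<in> \<Omega>} r * (\<Sum>k=1..K. B k)"])
        show "integrable lborel (\<lambda>r. indicator {r. line p r \<in> \<Omega>} r * (\<Sum>k=1..K. B k))"
          using line_section_finite[of p] by (intro integrable_mult_left integrable_real_indicator) auto
        show "AE r in lborel. (\<lambda>n. (\<Sum>k=1..K. U n k (line p r) * c n k t) * ?att r) \<longlonglongrightarrow>
            (\<Sum>k=1..K. W k (line p r) * d k t) * ?att r"
          using elim
        proof eventually_elim
          case (elim r)
          have "(\<lambda>n. U n k (line p r)) \<longlonglongrightarrow> W k (line p r)" if "k \<in> {1..K}" for k
            using good[OF elim that] by (cases "line p r \<in> \<Omega>") (auto simp: U_def W_def)
          then show ?case
            using c by (intro tendsto_intros) auto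
        qed
        show "AE r in lborel. norm ((\<Sum>k=1..K. U n k (line p r) * c n k t) * ?att r) \<le>
            indicator {r. line p r \<in> \<Omega>} r * (\<Sum>k=1..K. B k)" for n
          using elim
        proof eventually_elim
          case (elim r)
          show ?case
          proof (cases "line p r \<in> \<Omega>")
            case True
            have "\<bar>\<Sum>k=1..K. U n k (line p r) * c n k t\<bar> \<le> (\<Sum>k=1..K. \<bar>U n k (line p r) * c n k t\<bar>)"
              by (rule sum_abs)
            also have "\<dots> \<le> (\<Sum>k=1..K. B k)"
            proof (rule sum_mono)
              fix k assume k: "k \<in> {1..K}"
              have "\<bar>U n k (line p r)\<bar> * \<bar>c n k t\<bar> \<le> 1 * B k"
                using good[OF elim k True] B[OF k] True by (intro mult_mono) (auto simp: U_def)
              then show "\<bar>U n k (line p r) * c n k t\<bar> \<le> B k" by (simp add: abs_mult)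
            qed
            finally have 1: "\<bar>\<Sum>k=1..K. U n k (line p r) * c n k t\<bar> \<le> (\<Sum>k=1..K. B k)" .
            have "\<bar>\<Sum>k=1..K. U n k (line p r) * c n k t\<bar> * ?att r \<le> (\<Sum>k=1..K. B k) * 1"
              using 1 attenuation_bounds[of p r] by (intro mult_mono) auto
            then show ?thesis
              using True attenuation_bounds(1)[of p r] by (simp add: abs_mult)
          qed (simp add: U_def)
        qed
      qed measurable
      also have "(\<lambda>n. LINT r|lborel. (\<Sum>k=1..K. U n k (line p r) * c n k t) * ?att r) =
          (\<lambda>n. radon line coll \<Omega> \<mu> (image_seq K (u n) (c n)) (p, t))"
        unfolding radon_def image_seq_def set_lebesgue_integral_def
        by (auto intro!: Bochner_Integration.integral_cong simp: U_def indicator_def)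
      also have "(LINT r|lborel. (\<Sum>k=1..K. W k (line p r) * d k t) * ?att r) =
          radon line coll \<Omega> \<mu> (image_seq K w d) (p, t)"
        unfolding radon_def image_seq_def set_lebesgue_integral_def
        by (auto intro!: Bochner_Integration.integral_cong simp: W_def indicator_def)
      finally show "(\<lambda>n. radon line coll \<Omega> \<mu> (image_seq K (u n) (c n)) (p, t)) \<longlonglongrightarrow>
          radon line coll \<Omega> \<mu> (image_seq K w d) (p, t)" .
    qed
  qed
qed

end

section \<open>Lower semicontinuity of the Kullback-Leibler divergence\<close>

lemma KL_integrand_measurable [measurable (raw)]:
  assumes [measurable]: "f \<in> borel_measurable M" "g \<in> borel_measurable M"
  shows "(\<lambda>x. KL_integrand (f x) (g x)) \<in> borel_measurable M"
  unfolding KL_integrand_def by measurable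

text \<open>The value \<infinity> for nonpositive arguments is the continuous extension: since
  \<open>b > 0\<close>, the logarithmic term blows up as the argument decreases to 0, so the
  sequence may reach a nonpositive limit from either side.\<close>

lemma KL_integrand_tendsto:
  assumes b: "0 < b" and a: "a \<longlonglongrightarrow> l"
  shows "(\<lambda>n. KL_integrand (a n) b) \<longlonglongrightarrow> KL_integrand l b"
proof (cases "0 < l")
  case True
  have "(\<lambda>n. ennreal (a n - b + b * ln (b / a n))) \<longlonglongrightarrow> ennreal (l - b + b * ln (b / l))"
    using True b by (intro tendsto_intros a) auto
  moreover have "\<forall>\<^sub>F n in sequentially. ennreal (a n - b + b * ln (b / a n)) = KL_integrand (a n) b"
    using order_tendstoD(1)[OF a True] by eventually_elim (simp add: KL_integrand_def)
  ultimately have "(\<lambda>n. KL_integrand (a n) b) \<longlonglongrightarrow> ennreal (l - b + b * ln (b / l))"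
    by (rule Lim_transform_eventually)
  then show ?thesis using True by (simp add: KL_integrand_def)
next
  case False
  have "(\<lambda>n. KL_integrand (a n) b) \<longlonglongrightarrow> \<infinity>"
    unfolding infinity_ennreal_def
  proof (rule order_tendstoI)
    fix m :: ennreal assume "m < top"
    then obtain x where x: "0 \<le> x" "m = ennreal x" by (cases m) auto
    \<comment> \<open>Solves \<open>b * ln (b / \<delta>) = x + 1 + b\<close>, so that any positive
      argument below \<open>\<delta>\<close> gives a value above \<open>x + 1\<close>.\<close>
    define \<delta> where "\<delta> = b * exp (- (x + 1 + b) / b)"
    have "\<delta> > 0" using b by (simp add: \<delta>_def)
    have "\<forall>\<^sub>F n in sequentially. a n < \<delta>"
      using order_tendstoD(2)[OF a, of \<delta>] False \<open>\<delta> > 0\<close> by simp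
    then show "\<forall>\<^sub>F n in sequentially. m < KL_integrand (a n) b"
    proof eventually_elim
      case (elim n)
      show ?case
      proof (cases "a n \<le> 0")
        case True
        then show ?thesis using x by (simp add: KL_integrand_def)
      next
        case False
        then have "ln (a n) \<le> ln \<delta>" using elim by simp
        also have "ln \<delta> = ln b - (x + 1 + b) / b"
          using b by (simp add: \<delta>_def ln_mult field_simps)
        finally have "(x + 1 + b) / b \<le> ln (b / a n)"
          using False b by (simp add: ln_div)
        then have "x + 1 + b \<le> b * ln (b / a n)"
          using b by (simp add: field_simps)
        then have "x < a n - b + b * ln (b / a n)" using False by linarith
        then show ?thesis using x False by (simp add: KL_integrand_def ennreal_less_iff)
      qed
    qed
  qed simp
  then show ?thesis using False by (simp add: KL_integrand_def)
qed

text \<open>\<open>KL\<close> is an iterated integral, so Fatou's lemma is applied in time on almost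
  every line and then over the lines. Measurability and convergence are available on the open
  interval only; \<open>H\<close> is cut off there, at the cost of two endpoints of measure 0. The
  limit \<open>F'\<close> enters through monotonicity of the integral.\<close>

lemma KL_lower_semicontinuous:
  fixes \<Sigma> :: "'p::euclidean_space set"
  assumes \<Sigma>: "\<Sigma> \<in> sets borel"
    and g: "set_borel_measurable lborel (\<Sigma> \<times> {0..T}) g"
    and g_pos: "AE y in lborel. y \<in> \<Sigma> \<times> {0..T} \<longrightarrow> 0 < g y"
    and F: "\<And>n. \<exists>G \<in> borel_measurable borel. \<forall>p t. t \<in> {0<..<T} \<longrightarrow> F n (p, t) = G (p, t)"
    and lim: "AE p in lborel. AE t in lborel. t \<in> {0<..<T} \<longrightarrow> (\<lambda>n. F n (p, t)) \<longlonglongrightarrow> F' (p, t)"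
    and KL: "(\<lambda>n. KL \<Sigma> T (F n) g) \<longlonglongrightarrow> \<kappa>"
  shows "KL \<Sigma> T F' g \<le> \<kappa>"
proof -
  obtain G where Gm: "\<And>n. G n \<in> borel_measurable borel"
    and G: "\<And>n p t. t \<in> {0<..<T} \<Longrightarrow> F n (p, t) = G n (p, t)"
    using F by metis
  have Gm' [measurable]: "G n \<in> borel_measurable (borel \<Otimes>\<^sub>M borel)" for n
    using Gm by (simp add: borel_prod)
  define g' where "g' y = indicator (\<Sigma> \<times> {0..T}) y * g y" for y
  have [measurable]: "g' \<in> borel_measurable (borel \<Otimes>\<^sub>M borel)"
    using g by (simp add: set_borel_measurable_def g'_def[abs_def] borel_prod)
  note \<Sigma> [measurable]
  define H where "H n p t = indicator \<Sigma> p * (indicator {0<..<T} t * KL_integrand (G n (p, t)) (g' (p, t)))"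
    for n p t
  have Hm [measurable]: "(\<lambda>z. H n (fst z) (snd z)) \<in> borel_measurable (borel \<Otimes>\<^sub>M borel)" for n
    unfolding H_def by measurable
  have "(\<lambda>z. H n (fst z) (snd z)) \<circ> Pair p \<in> borel_measurable borel" for n p
    by (rule measurable_comp[OF _ Hm]) measurable
  then have Hpm [measurable]: "H n p \<in> borel_measurable borel" for n p
    by (simp add: o_def)
  have ends: "AE t in lborel. t \<noteq> 0 \<and> t \<noteq> T"
    using AE_lborel_singleton[of 0] AE_lborel_singleton[of T] by (auto elim: AE_mp)
  have KL_H: "KL \<Sigma> T (F n) g = (\<integral>\<^sup>+p. (\<integral>\<^sup>+t. H n p t \<partial>lborel) \<partial>lborel)" for n
    unfolding KL_def
  proof (rule nn_integral_cong)
    fix p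
    show "(\<integral>\<^sup>+t\<in>{0..T}. KL_integrand (F n (p, t)) (g (p, t)) \<partial>lborel) * indicator \<Sigma> p =
        (\<integral>\<^sup>+t. H n p t \<partial>lborel)"
    proof (cases "p \<in> \<Sigma>")
      case True
      have "(\<integral>\<^sup>+t\<in>{0..T}. KL_integrand (F n (p, t)) (g (p, t)) \<partial>lborel) = (\<integral>\<^sup>+t. H n p t \<partial>lborel)"
      proof (rule nn_integral_cong_AE)
        show "AE t in lborel. KL_integrand (F n (p, t)) (g (p, t)) * indicator {0..T} t = H n p t"
          using ends by eventually_elim (use True in \<open>auto simp: H_def G g'_def indicator_def\<close>)
      qed
      then show ?thesis using True by simp
    qed (simp add: H_def)
  qed
  have gp: "AE p in lborel. AE t in lborel. (p, t) \<in> \<Sigma> \<times> {0..T} \<longrightarrow> 0 < g (p, t)"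
    using g_pos unfolding lborel_prod[symmetric] by (rule lborel_pair.AE_pair)
  have "KL \<Sigma> T F' g \<le> (\<integral>\<^sup>+p. liminf (\<lambda>n. \<integral>\<^sup>+t. H n p t \<partial>lborel) \<partial>lborel)"
    unfolding KL_def
  proof (rule nn_integral_mono_AE)
    show "AE p in lborel. (\<integral>\<^sup>+t\<in>{0..T}. KL_integrand (F' (p, t)) (g (p, t)) \<partial>lborel) * indicator \<Sigma> p
        \<le> liminf (\<lambda>n. \<integral>\<^sup>+t. H n p t \<partial>lborel)"
      using lim gp
    proof eventually_elim
      case (elim p)
      show ?case
      proof (cases "p \<in> \<Sigma>")
        case True
        have "(\<integral>\<^sup>+t\<in>{0..T}. KL_integrand (F' (p, t)) (g (p, t)) \<partial>lborel) \<le>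
            (\<integral>\<^sup>+t. liminf (\<lambda>n. H n p t) \<partial>lborel)"
        proof (rule nn_integral_mono_AE)
          show "AE t in lborel. KL_integrand (F' (p, t)) (g (p, t)) * indicator {0..T} t \<le> liminf (\<lambda>n. H n p t)"
            using elim(1) elim(2) ends
          proof eventually_elim
            case (elim t)
            show ?case
            proof (cases "t \<in> {0<..<T}")
              case t: True
              have "(\<lambda>n. KL_integrand (F n (p, t)) (g (p, t))) \<longlonglongrightarrow> KL_integrand (F' (p, t)) (g (p, t))"
                using elim t True by (intro KL_integrand_tendsto) auto
              moreover have "H n p t = KL_integrand (F n (p, t)) (g (p, t))" for n
                using True t by (auto simp: H_def G g'_def indicator_def)
              ultimately have "liminf (\<lambda>n. H n p t) = KL_integrand (F' (p, t)) (g (p, t))"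
                by (simp add: lim_imp_Liminf)
              then show ?thesis using t by simp
            qed (use elim in auto)
          qed
        qed
        also have "\<dots> \<le> liminf (\<lambda>n. \<integral>\<^sup>+t. H n p t \<partial>lborel)"
          by (rule nn_integral_liminf) simp
        finally show ?thesis using True by simp
      qed simp
    qed
  qed
  also have "\<dots> \<le> liminf (\<lambda>n. \<integral>\<^sup>+p. (\<integral>\<^sup>+t. H n p t \<partial>lborel) \<partial>lborel)"
    by (rule nn_integral_liminf) (use Hm in measurable)
  also have "\<dots> = \<kappa>"
    using lim_imp_Liminf[OF _ KL] by (simp add: KL_H)
  finally show ?thesis .
qed

section \<open>Total variation\<close>

lemma C1_compact_support_partial_continuous:
  assumes "\<phi> \<in> C1_compact_support \<Omega>" "b \<in> Basis"
  shows "continuous_on S (\<lambda>x. frechet_derivative \<phi> (at x) b \<bullet> b)"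
proof -
  have "continuous_on UNIV (\<lambda>x. frechet_derivative \<phi> (at x) b)"
    using assms by (simp add: C1_compact_support_def)
  then have "continuous_on S (\<lambda>x. frechet_derivative \<phi> (at x) b)"
    by (rule continuous_on_subset) simp
  then show ?thesis by (intro continuous_on_inner continuous_on_const)
qed

lemma C1_compact_support_partial_eq_0:
  assumes C: "compact C" "\<And>x. x \<notin> C \<Longrightarrow> \<phi> x = 0" and x: "x \<notin> C"
  shows "frechet_derivative \<phi> (at x) b = 0"
proof -
  have "open (- C)" using C compact_imp_closed by blast
  then have "(\<phi> has_derivative (\<lambda>h. 0)) (at x)"
    by (rule has_derivative_transform_within_open[OF has_derivative_const[of 0]]) (use C x in auto)
  from frechet_derivative_at[OF this] show ?thesis by metis
qed

lemma C1_compact_support_partial_bounded: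
  assumes \<phi>: "\<phi> \<in> C1_compact_support \<Omega>" and b: "b \<in> Basis"
  obtains B where "0 \<le> B" "\<And>x. \<bar>frechet_derivative \<phi> (at x) b \<bullet> b\<bar> \<le> B"
proof -
  let ?f = "\<lambda>x. frechet_derivative \<phi> (at x) b \<bullet> b"
  obtain C where C: "compact C" "\<And>x. x \<notin> C \<Longrightarrow> \<phi> x = 0"
    using \<phi> by (auto simp: C1_compact_support_def)
  have "compact (?f ` C)"
    using C1_compact_support_partial_continuous[OF \<phi> b] C(1) by (rule compact_continuous_image)
  then have "bounded (?f ` C)" by (rule compact_imp_bounded)
  then obtain B where "B > 0" and B: "\<And>x. x \<in> C \<Longrightarrow> \<bar>?f x\<bar> \<le> B"
    unfolding bounded_pos by auto
  have "\<bar>?f x\<bar> \<le> B" for x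
  proof (cases "x \<in> C")
    case False
    then show ?thesis using C1_compact_support_partial_eq_0[OF C] \<open>B > 0\<close> by simp
  qed (rule B)
  from that[OF less_imp_le[OF \<open>B > 0\<close>] this] show thesis .
qed

lemma divergence_measurable:
  assumes "\<phi> \<in> C1_compact_support \<Omega>"
  shows "divergence \<phi> \<in> borel_measurable borel"
proof -
  have "continuous_on UNIV (divergence \<phi>)"
    unfolding divergence_def[abs_def]
    by (intro continuous_on_sum C1_compact_support_partial_continuous[OF assms])
  then show ?thesis by (rule borel_measurable_continuous_onI)
qed

lemma divergence_bounded:
  assumes "\<phi> \<in> C1_compact_support \<Omega>"
  obtains B where "0 \<le> B" "\<And>x. \<bar>divergence \<phi> x\<bar> \<le> B"
proof -
  have "\<forall>b\<in>Basis. \<exists>B. 0 \<le> B \<and> (\<forall>x. \<bar>frechet_derivative \<phi> (at x) b \<bullet> b\<bar> \<le> B)"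
    using C1_compact_support_partial_bounded[OF assms] by metis
  then obtain B where B: "\<And>b. b \<in> Basis \<Longrightarrow> 0 \<le> B b"
    "\<And>b x. b \<in> Basis \<Longrightarrow> \<bar>frechet_derivative \<phi> (at x) b \<bullet> b\<bar> \<le> B b"
    by metis
  show thesis
  proof (rule that[of "\<Sum>b\<in>Basis. B b"])
    show "\<bar>divergence \<phi> x\<bar> \<le> (\<Sum>b\<in>Basis. B b)" for x
      unfolding divergence_def using B(2) by (intro order_trans[OF sum_abs] sum_mono)
  qed (intro sum_nonneg B)
qed

text \<open>The divergence theorem without boundary, one coordinate at a time: by translation
  invariance the difference quotients of \<open>f\<close> have integral 0, and they converge
  dominatedly to the partial derivative.\<close>

lemma integral_partial_eq_0:
  fixes \<phi> :: "'a::euclidean_space \<Rightarrow> 'a"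
  assumes \<phi>: "\<phi> \<in> C1_compact_support \<Omega>" and b: "b \<in> Basis"
  shows "(LINT x|lborel. frechet_derivative \<phi> (at x) b \<bullet> b) = 0"
    "integrable lborel (\<lambda>x. frechet_derivative \<phi> (at x) b \<bullet> b)"
proof -
  let ?g = "\<lambda>x. frechet_derivative \<phi> (at x) b \<bullet> b"
  define f where "f x = \<phi> x \<bullet> b" for x
  obtain C where C: "compact C" "\<And>x. x \<notin> C \<Longrightarrow> \<phi> x = 0"
    using \<phi> by (auto simp: C1_compact_support_def)
  obtain R where R: "\<And>x. x \<in> C \<Longrightarrow> norm x \<le> R"
    using compact_imp_bounded[OF C(1)] by (auto simp: bounded_iff)
  obtain B where B: "0 \<le> B" "\<And>x. \<bar>?g x\<bar> \<le> B"
    using C1_compact_support_partial_bounded[OF \<phi> b] by metis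
  have d\<phi>: "(\<phi> has_derivative frechet_derivative \<phi> (at x)) (at x)" for x
    using \<phi> by (auto simp: C1_compact_support_def frechet_derivative_works)
  have line_deriv: "((\<lambda>s. f (x + s *\<^sub>R b)) has_real_derivative ?g (x + s *\<^sub>R b)) (at s)" for x s
  proof -
    have lin: "linear (frechet_derivative \<phi> (at (x + s *\<^sub>R b)))"
      using d\<phi> has_derivative_linear by blast
    have "((\<lambda>s. \<phi> (x + s *\<^sub>R b)) has_derivative (\<lambda>h. frechet_derivative \<phi> (at (x + s *\<^sub>R b)) (h *\<^sub>R b))) (at s)"
      by (rule has_derivative_compose[OF _ d\<phi>]) (auto intro!: derivative_eq_intros)
    then have "((\<lambda>s. f (x + s *\<^sub>R b)) has_derivative (\<lambda>h. frechet_derivative \<phi> (at (x + s *\<^sub>R b)) (h *\<^sub>R b) \<bullet> b)) (at s)"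
      unfolding f_def by (rule has_derivative_inner_left)
    then show ?thesis
      unfolding has_field_derivative_def by (simp add: linear_cmul[OF lin] mult.commute[of "?g _"] mult_commute_abs)
  qed
  have f_cont: "continuous_on UNIV f"
    unfolding f_def using d\<phi> by (intro continuous_intros has_derivative_continuous_on) (auto intro: has_derivative_at_withinI)
  then have [measurable]: "f \<in> borel_measurable borel"
    by (rule borel_measurable_continuous_onI)
  have [measurable]: "?g \<in> borel_measurable borel"
    using C1_compact_support_partial_continuous[OF \<phi> b] by (rule borel_measurable_continuous_onI)
  have f0: "f x = 0" if "R < norm x" for x
    using that R[of x] C(2)[of x] by (force simp: f_def)
  have g0: "?g x = 0" if "R < norm x" for x
    using that R[of x] C1_compact_support_partial_eq_0[OF C] by force
  \<comment> \<open>The radius exceeds \<open>R\<close> by 1 because the shifts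
    \<open>h n *\<^sub>R b\<close> have length at most 1; outside this ball both terms of the
    difference quotient vanish.\<close>
  have ball_int: "integrable lborel (\<lambda>x. indicator (cball (0::'a) (R + 1)) x * D)" for D :: real
    using emeasure_compact_finite[of "cball 0 (R + 1)"]
    by (intro integrable_mult_left integrable_real_indicator) auto
  have f_int: "integrable lborel f"
  proof -
    have "compact (f ` cball 0 R)"
      by (intro compact_continuous_image continuous_on_subset[OF f_cont]) auto
    then have "bounded (f ` cball 0 R)" by (rule compact_imp_bounded)
    then obtain D where D: "D > 0" "\<And>x. x \<in> cball 0 R \<Longrightarrow> \<bar>f x\<bar> \<le> D"
      unfolding bounded_pos by auto
    show ?thesis
    proof (rule Bochner_Integration.integrable_bound[OF ball_int[of D]])
      show "AE x in lborel. norm (f x) \<le> norm (indicator (cball 0 (R + 1)) x * D)"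
        using D f0 by (intro AE_I2) (force simp: indicator_def not_le)
    qed simp
  qed
  show g_int: "integrable lborel ?g"
  proof (rule Bochner_Integration.integrable_bound[OF ball_int[of B]])
    show "AE x in lborel. norm (?g x) \<le> norm (indicator (cball 0 (R + 1)) x * B)"
      using B g0 by (intro AE_I2) (force simp: indicator_def not_le)
  qed simp
  have trans: "(LINT x|lborel. f (x + c)) = (LINT x|lborel. f x)" "integrable lborel (\<lambda>x. f (x + c))" for c
  proof -
    have "(LINT x|lborel. f x) = (LINT x|distr lborel borel ((+) c). f x)"
      by (simp add: lborel_distr_plus)
    also have "\<dots> = (LINT x|lborel. f (c + x))" by (rule integral_distr) auto
    finally show "(LINT x|lborel. f (x + c)) = (LINT x|lborel. f x)" by (simp add: add.commute)
    have "integrable (distr lborel borel ((+) c)) f" using f_int by (simp add: lborel_distr_plus)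
    then have "integrable lborel (\<lambda>x. f (c + x))" by (subst (asm) integrable_distr_eq) auto
    then show "integrable lborel (\<lambda>x. f (x + c))" by (simp add: add.commute)
  qed
  define h where "h n = 1 / real (Suc n)" for n
  have h: "0 < h n" "h n \<le> 1" for n by (simp_all add: h_def)
  have "h \<longlonglongrightarrow> 0" unfolding h_def[abs_def] by (rule LIMSEQ_Suc[OF lim_1_over_n])
  then have h_lim: "filterlim h (at 0) sequentially"
    using h by (auto simp: filterlim_at eventually_sequentially intro!: exI[of _ 0]) (metis less_irrefl)
  have "(\<lambda>n. LINT x|lborel. (f (x + h n *\<^sub>R b) - f x) / h n) \<longlonglongrightarrow> (LINT x|lborel. ?g x)"
  proof (rule integral_dominated_convergence[where w = "\<lambda>x. indicator (cball (0::'a) (R + 1)) x * B"])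
    show "AE x in lborel. (\<lambda>n. (f (x + h n *\<^sub>R b) - f x) / h n) \<longlonglongrightarrow> ?g x"
    proof (rule AE_I2)
      fix x
      have "((\<lambda>y. (f (x + (0 + y) *\<^sub>R b) - f (x + 0 *\<^sub>R b)) / y) \<longlongrightarrow> ?g (x + 0 *\<^sub>R b)) (at 0)"
        using line_deriv[of x 0] unfolding DERIV_def .
      then have "((\<lambda>y. (f (x + y *\<^sub>R b) - f x) / y) \<longlongrightarrow> ?g x) (at 0)" by simp
      from filterlim_compose[OF this h_lim] show "(\<lambda>n. (f (x + h n *\<^sub>R b) - f x) / h n) \<longlonglongrightarrow> ?g x" .
    qed
    show "AE x in lborel. norm ((f (x + h n *\<^sub>R b) - f x) / h n) \<le> indicator (cball 0 (R + 1)) x * B" for n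
    proof (rule AE_I2)
      fix x :: 'a
      show "norm ((f (x + h n *\<^sub>R b) - f x) / h n) \<le> indicator (cball 0 (R + 1)) x * B"
      proof (cases "norm x \<le> R + 1")
        case True
        \<comment> \<open>The mean value theorem turns the quotient into a value of the partial
          derivative, which gives the bound \<open>B\<close> independent of
          \<open>n\<close>.\<close>
        obtain z where "f (x + h n *\<^sub>R b) - f (x + 0 *\<^sub>R b) = (h n - 0) * ?g (x + z *\<^sub>R b)"
          using MVT2[OF h(1)[of n], of "\<lambda>s. f (x + s *\<^sub>R b)" "\<lambda>s. ?g (x + s *\<^sub>R b)"] line_deriv[of x] by blast
        then have "(f (x + h n *\<^sub>R b) - f x) / h n = ?g (x + z *\<^sub>R b)"
          using h(1)[of n] by (simp add: field_simps)
        then show ?thesis using True B(2) by simp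
      next
        case False
        have "norm x \<le> norm (x + h n *\<^sub>R b) + norm (h n *\<^sub>R b)"
          by (metis add_diff_cancel_right' norm_triangle_ineq4)
        also have "norm (h n *\<^sub>R b) \<le> 1" using h[of n] b by simp
        finally have "R < norm (x + h n *\<^sub>R b)" using False by linarith
        moreover have "R < norm x" using False by simp
        ultimately show ?thesis using False by (simp add: f0)
      qed
    qed
    show "integrable lborel (\<lambda>x. indicator (cball (0::'a) (R + 1)) x * B)" by (rule ball_int)
  qed measurable
  moreover have "(LINT x|lborel. (f (x + h n *\<^sub>R b) - f x) / h n) = 0" for n
    using trans[of "h n *\<^sub>R b"] f_int by simp
  ultimately have "(\<lambda>n. 0) \<longlonglongrightarrow> (LINT x|lborel. ?g x)" by (simp only:)
  from LIMSEQ_unique[OF this tendsto_const] show "(LINT x|lborel. ?g x) = 0" .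
qed

text \<open>Puts constants into \<open>BV \<Omega>\<close>. A test field is supported inside
  \<Omega>, so the integral of its divergence over \<Omega> is the integral over the whole
  space.\<close>

lemma total_variation_const: "total_variation \<Omega> (\<lambda>x. a) \<le> 0"
  unfolding total_variation_def
proof (rule SUP_least)
  fix \<phi> assume "\<phi> \<in> {\<phi> \<in> C1_compact_support \<Omega>. \<forall>x. norm (\<phi> x) \<le> 1}"
  then have \<phi>: "\<phi> \<in> C1_compact_support \<Omega>" by simp
  then obtain C where C: "compact C" "C \<subseteq> \<Omega>" "\<And>x. x \<notin> C \<Longrightarrow> \<phi> x = 0"
    by (auto simp: C1_compact_support_def)
  have ind: "indicator \<Omega> x *\<^sub>R (a * divergence \<phi> x) = a * divergence \<phi> x" for x
  proof (cases "x \<in> \<Omega>")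
    case False
    then have "x \<notin> C" using C by blast
    then show ?thesis
      using C1_compact_support_partial_eq_0[OF C(1,3)] by (simp add: divergence_def)
  qed simp
  have "(LINT x:\<Omega>|lborel. a * divergence \<phi> x) = (LINT x|lborel. a * divergence \<phi> x)"
    unfolding set_lebesgue_integral_def ind ..
  also have "\<dots> = 0"
    unfolding divergence_def using integral_partial_eq_0[OF \<phi>] by simp
  finally have eq: "(LINT x:\<Omega>|lborel. a * divergence \<phi> x) = 0" .
  show "ereal (LINT x:\<Omega>|lborel. a * divergence \<phi> x) \<le> 0"
    unfolding eq by simp
qed

section \<open>Semicontinuity and compactness in BV\<close>

lemma total_variation_nonneg: "0 \<le> total_variation \<Omega> v"
proof -
  have d0: "frechet_derivative (\<lambda>x::'a. 0::'a) (at x) = (\<lambda>h. 0)" for x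
    using frechet_derivative_at[OF has_derivative_const[of "0::'a" "at x"]] by simp
  then have "(\<lambda>x::'a. 0) \<in> {\<phi> \<in> C1_compact_support \<Omega>. \<forall>x. norm (\<phi> x) \<le> 1}"
    by (auto simp: C1_compact_support_def intro!: exI[of _ "{}"])
  moreover have "(LINT x:\<Omega>|lborel. v x * divergence (\<lambda>x. 0) x) = 0"
    by (simp add: divergence_def d0 set_lebesgue_integral_def)
  ultimately show ?thesis
    unfolding total_variation_def by (intro SUP_upper2[of "\<lambda>x. 0"]) auto
qed

text \<open>A supremum of functionals, each continuous under bounded almost everywhere convergence:
  the divergence of a fixed test field is bounded and \<Omega> has finite measure.\<close>

lemma total_variation_lower_semicontinuous:
  fixes \<Omega> :: "'a::euclidean_space set"
  assumes \<Omega>: "open \<Omega>" "bounded \<Omega>"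
    and v: "\<And>n. set_borel_measurable lborel \<Omega> (v n)" and w: "set_borel_measurable lborel \<Omega> w"
    and bound: "\<And>n. AE x in lborel. x \<in> \<Omega> \<longrightarrow> \<bar>v n x\<bar> \<le> 1"
    and lim: "AE x in lborel. x \<in> \<Omega> \<longrightarrow> (\<lambda>n. v n x) \<longlonglongrightarrow> w x"
    and TV: "(\<lambda>n. total_variation \<Omega> (v n)) \<longlonglongrightarrow> \<tau>"
  shows "total_variation \<Omega> w \<le> \<tau>"
  unfolding total_variation_def[of _ w]
proof (rule SUP_least)
  fix \<phi> assume \<phi>: "\<phi> \<in> {\<phi> \<in> C1_compact_support \<Omega>. \<forall>x. norm (\<phi> x) \<le> 1}"
  then have \<phi>C: "\<phi> \<in> C1_compact_support \<Omega>" by simp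
  obtain B where B: "0 \<le> B" "\<And>x. \<bar>divergence \<phi> x\<bar> \<le> B"
    using divergence_bounded[OF \<phi>C] by metis
  have [measurable]: "divergence \<phi> \<in> borel_measurable borel"
    using \<phi>C by (rule divergence_measurable)
  have [measurable]: "(\<lambda>x. indicator \<Omega> x * v n x) \<in> borel_measurable borel"
    "(\<lambda>x. indicator \<Omega> x * w x) \<in> borel_measurable borel" for n
    using v[of n] w by (auto simp: set_borel_measurable_def)
  have fin: "emeasure lborel \<Omega> < \<infinity>" using \<Omega>(2) by (rule emeasure_bounded_finite)
  have "(\<lambda>n. LINT x|lborel. (indicator \<Omega> x * v n x) * divergence \<phi> x) \<longlonglongrightarrow>
      (LINT x|lborel. (indicator \<Omega> x * w x) * divergence \<phi> x)"
  proof (rule integral_dominated_convergence[where w = "\<lambda>x. indicator \<Omega> x * B"])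
    show "integrable lborel (\<lambda>x. indicator \<Omega> x * B)"
      using \<Omega>(1) fin by (intro integrable_mult_left integrable_real_indicator) auto
    show "AE x in lborel. (\<lambda>n. (indicator \<Omega> x * v n x) * divergence \<phi> x) \<longlonglongrightarrow> (indicator \<Omega> x * w x) * divergence \<phi> x"
      using lim by eventually_elim (auto intro!: tendsto_intros simp: indicator_def)
    show "AE x in lborel. norm ((indicator \<Omega> x * v n x) * divergence \<phi> x) \<le> indicator \<Omega> x * B" for n
      using bound[of n]
    proof eventually_elim
      case (elim x)
      then show ?case
        using mult_mono[of "\<bar>v n x\<bar>" 1 "\<bar>divergence \<phi> x\<bar>" B] B by (auto simp: abs_mult indicator_def)
    qed
  qed measurable
  then have "(\<lambda>n. ereal (LINT x:\<Omega>|lborel. v n x * divergence \<phi> x)) \<longlonglongrightarrow> ereal (LINT x:\<Omega>|lborel. w x * divergence \<phi> x)"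
    by (simp add: set_lebesgue_integral_def mult.assoc)
  moreover have "ereal (LINT x:\<Omega>|lborel. v n x * divergence \<phi> x) \<le> total_variation \<Omega> (v n)" for n
    unfolding total_variation_def using \<phi> by (rule SUP_upper)
  ultimately show "ereal (LINT x:\<Omega>|lborel. w x * divergence \<phi> x) \<le> \<tau>"
    using LIMSEQ_le[OF _ TV] by blast
qed

lemma L1_norm_tendsto:
  fixes \<Omega> :: "'a::euclidean_space set"
  assumes \<Omega>: "open \<Omega>" "bounded \<Omega>"
    and v: "\<And>n. set_borel_measurable lborel \<Omega> (v n)" and w: "set_borel_measurable lborel \<Omega> w"
    and bound: "\<And>n. AE x in lborel. x \<in> \<Omega> \<longrightarrow> \<bar>v n x\<bar> \<le> 1"
    and lim: "AE x in lborel. x \<in> \<Omega> \<longrightarrow> (\<lambda>n. v n x) \<longlonglongrightarrow> w x"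
  shows "(\<lambda>n. L1_norm \<Omega> (v n)) \<longlonglongrightarrow> L1_norm \<Omega> w"
proof -
  have [measurable]: "(\<lambda>x. indicator \<Omega> x * v n x) \<in> borel_measurable borel"
    "(\<lambda>x. indicator \<Omega> x * w x) \<in> borel_measurable borel" for n
    using v[of n] w by (auto simp: set_borel_measurable_def)
  have fin: "emeasure lborel \<Omega> < \<infinity>" using \<Omega>(2) by (rule emeasure_bounded_finite)
  have "(\<lambda>n. LINT x|lborel. \<bar>indicator \<Omega> x * v n x\<bar>) \<longlonglongrightarrow> (LINT x|lborel. \<bar>indicator \<Omega> x * w x\<bar>)"
  proof (rule integral_dominated_convergence[where w = "indicator \<Omega>"])
    show "integrable lborel (indicat_real \<Omega>)"
      using \<Omega>(1) fin by (intro integrable_real_indicator) auto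
    show "AE x in lborel. (\<lambda>n. \<bar>indicator \<Omega> x * v n x\<bar>) \<longlonglongrightarrow> \<bar>indicator \<Omega> x * w x\<bar>"
      using lim by eventually_elim (auto intro!: tendsto_intros simp: indicator_def)
    show "AE x in lborel. norm (\<bar>indicator \<Omega> x * v n x\<bar>) \<le> indicator \<Omega> x" for n
      using bound[of n] by eventually_elim (auto simp: indicator_def)
  qed measurable
  then show ?thesis
    by (simp add: L1_norm_def set_lebesgue_integral_def abs_mult)
qed

lemma L1_norm_le_measure:
  fixes \<Omega> :: "'a::euclidean_space set"
  assumes \<Omega>: "open \<Omega>" "bounded \<Omega>" and v: "set_integrable lborel \<Omega> v"
    and bound: "AE x in lborel. x \<in> \<Omega> \<longrightarrow> \<bar>v x\<bar> \<le> 1"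
  shows "L1_norm \<Omega> v \<le> measure lborel \<Omega>"
proof -
  have fin: "emeasure lborel \<Omega> < \<infinity>" using \<Omega>(2) by (rule emeasure_bounded_finite)
  have "L1_norm \<Omega> v \<le> (LINT x|lborel. indicator \<Omega> x)"
    unfolding L1_norm_def set_lebesgue_integral_def
  proof (rule integral_mono_AE)
    show "integrable lborel (\<lambda>x. indicator \<Omega> x *\<^sub>R \<bar>v x\<bar>)"
      using integrable_abs[OF v[unfolded set_integrable_def]] by (simp add: abs_mult)
    show "integrable lborel (indicat_real \<Omega>)"
      using \<Omega>(1) fin by (intro integrable_real_indicator) auto
    show "AE x in lborel. indicator \<Omega> x *\<^sub>R \<bar>v x\<bar> \<le> indicator \<Omega> x"
      using bound by eventually_elim (auto simp: indicator_def)
  qed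
  then show ?thesis by simp
qed

lemma BV_measurable: "v \<in> BV \<Omega> \<Longrightarrow> set_borel_measurable lborel \<Omega> v"
  by (auto simp: BV_def set_integrable_def set_borel_measurable_def intro: borel_measurable_integrable)

text \<open>Values of modulus at most 1 on a bounded domain bound the L1 norm by the measure of
  \<Omega>, so a bound on the variation alone triggers the embedding. A further subsequence turns L1
  convergence into convergence almost everywhere.\<close>

lemma BV_unit_compact:
  fixes \<Omega> :: "'a::euclidean_space set"
  assumes \<Omega>: "open \<Omega>" "bounded \<Omega>" and emb: "BV_compact_in_L1 \<Omega>"
    and v: "\<And>n. v n \<in> BV \<Omega>"
    and bound: "\<And>n. AE x in lborel. x \<in> \<Omega> \<longrightarrow> \<bar>v n x\<bar> \<le> 1"
    and TV_bound: "\<And>n. total_variation \<Omega> (v n) \<le> ereal B"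
    and TV: "(\<lambda>n. total_variation \<Omega> (v n)) \<longlonglongrightarrow> ereal \<tau>"
  obtains r w where "strict_mono (r :: nat \<Rightarrow> nat)" "w \<in> BV \<Omega>"
    "AE x in lborel. x \<in> \<Omega> \<longrightarrow> (\<lambda>n. v (r n) x) \<longlonglongrightarrow> w x" "total_variation \<Omega> w \<le> ereal \<tau>"
proof -
  have "ereal (L1_norm \<Omega> (v n)) + total_variation \<Omega> (v n) \<le> ereal (measure lborel \<Omega> + B)" for n
  proof -
    have "ereal (L1_norm \<Omega> (v n)) \<le> ereal (measure lborel \<Omega>)"
      using L1_norm_le_measure[OF \<Omega> _ bound] v by (simp add: BV_def)
    from add_mono[OF this TV_bound[of n]] show ?thesis by simp
  qed
  then have "\<exists>B. \<forall>n. ereal (L1_norm \<Omega> (v n)) + total_variation \<Omega> (v n) \<le> ereal B" by blast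
  with v have "\<exists>w r1. strict_mono (r1 :: nat \<Rightarrow> nat) \<and> set_integrable lborel \<Omega> w \<and>
      (\<lambda>n. L1_norm \<Omega> (\<lambda>x. v (r1 n) x - w x)) \<longlonglongrightarrow> 0"
    using emb[unfolded BV_compact_in_L1_def, rule_format, of v] by simp
  then obtain w r1 where r1: "strict_mono (r1 :: nat \<Rightarrow> nat)" and w: "set_integrable lborel \<Omega> w"
    and L1: "(\<lambda>n. L1_norm \<Omega> (\<lambda>x. v (r1 n) x - w x)) \<longlonglongrightarrow> 0"
    by blast
  have int: "integrable lborel (\<lambda>x. indicator \<Omega> x * (v (r1 n) x - w x))" for n
    using v[of "r1 n"] w by (auto simp: BV_def set_integrable_def right_diff_distrib)
  have "(\<lambda>n. LINT x|lborel. norm (indicator \<Omega> x * (v (r1 n) x - w x))) \<longlonglongrightarrow> 0"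
    using L1 by (simp add: L1_norm_def set_lebesgue_integral_def abs_mult)
  from tendsto_L1_AE_subseq[OF int this] obtain r2 where r2: "strict_mono (r2 :: nat \<Rightarrow> nat)"
    and ae: "AE x in lborel. (\<lambda>n. indicator \<Omega> x * (v (r1 (r2 n)) x - w x)) \<longlonglongrightarrow> 0"
    by blast
  have r: "strict_mono (r1 \<circ> r2)" using r1 r2 by (rule strict_mono_o)
  have lim: "AE x in lborel. x \<in> \<Omega> \<longrightarrow> (\<lambda>n. v ((r1 \<circ> r2) n) x) \<longlonglongrightarrow> w x"
    using ae by eventually_elim (auto simp: LIM_zero_iff)
  have "(\<lambda>n. total_variation \<Omega> (v ((r1 \<circ> r2) n))) \<longlonglongrightarrow> ereal \<tau>"
    using LIMSEQ_subseq_LIMSEQ[OF TV r] by (simp add: o_def)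
  then have TVw: "total_variation \<Omega> w \<le> ereal \<tau>"
    using total_variation_lower_semicontinuous[OF \<Omega> BV_measurable[OF v] _ bound lim] w
    by (auto simp: set_integrable_def set_borel_measurable_def)
  then have "total_variation \<Omega> w < \<infinity>" using le_less_trans by fastforce
  then have "w \<in> BV \<Omega>"
    using w by (simp add: BV_def)
  from that[OF r this lim TVw] show thesis .
qed

section \<open>Existence of minimizers\<close>

text \<open>With finitely many indices one refines once per index: \<open>ex\<close> works along any
  sequence already chosen, and \<open>sub\<close> preserves what was achieved for earlier
  indices.\<close>

lemma finite_diagonal_subseq:
  assumes "finite A"
    and ex: "\<And>k s. k \<in> A \<Longrightarrow> strict_mono (s :: nat \<Rightarrow> nat) \<Longrightarrow> \<exists>r. strict_mono r \<and> P k (s \<circ> r)"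
    and sub: "\<And>k s r. P k s \<Longrightarrow> strict_mono (r :: nat \<Rightarrow> nat) \<Longrightarrow> P k (s \<circ> r)"
  shows "\<exists>s. strict_mono (s :: nat \<Rightarrow> nat) \<and> (\<forall>k\<in>A. P k s)"
  using assms(1) ex
proof (induction A)
  case empty
  show ?case using strict_mono_id by blast
next
  case (insert a A)
  then obtain s where s: "strict_mono (s :: nat \<Rightarrow> nat)" "\<forall>k\<in>A. P k s" by blast
  then obtain r where r: "strict_mono r" "P a (s \<circ> r)" using insert.prems[of a s] by blast
  have "strict_mono (s \<circ> r)" using s r by (simp add: strict_mono_o)
  moreover have "\<forall>k\<in>insert a A. P k (s \<circ> r)" using s r sub by blast
  ultimately show ?case by blast
qed

text \<open>\<open>\<tau>\<close> and \<open>l\<close> are limits along the sequence and are kept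
  apart from the values at \<open>w\<close> and \<open>d\<close>, which may be strictly
  smaller.\<close>

definition BV_W12_converges ::
  "'a::euclidean_space set \<Rightarrow> real \<Rightarrow> (nat \<Rightarrow> 'a \<Rightarrow> real) \<Rightarrow> (nat \<Rightarrow> real \<Rightarrow> real) \<Rightarrow>
     ('a \<Rightarrow> real) \<Rightarrow> (real \<Rightarrow> real) \<Rightarrow> real \<Rightarrow> real \<Rightarrow> bool" where
  "BV_W12_converges \<Omega> T v c w d \<tau> l \<longleftrightarrow>
     w \<in> BV \<Omega> \<and> (AE x in lborel. x \<in> \<Omega> \<longrightarrow> (\<lambda>n. v n x) \<longlonglongrightarrow> w x) \<and>
     (\<lambda>n. total_variation \<Omega> (v n)) \<longlonglongrightarrow> ereal \<tau> \<and> total_variation \<Omega> w \<le> ereal \<tau> \<and>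
     d \<in> W12_0 T \<and> (AE t in lborel. t \<in> {0<..<T} \<longrightarrow> (\<lambda>n. c n t) \<longlonglongrightarrow> d t) \<and>
     (\<lambda>n. L2_norm T (weak_deriv T (c n))) \<longlonglongrightarrow> l \<and> L2_norm T (weak_deriv T d) \<le> l"

lemma BV_W12_converges_subseq:
  assumes "BV_W12_converges \<Omega> T v c w d \<tau> l" "strict_mono r"
  shows "BV_W12_converges \<Omega> T (\<lambda>n. v (r n)) (\<lambda>n. c (r n)) w d \<tau> l"
proof -
  note b = assms(1)[unfolded BV_W12_converges_def]
  have "AE x in lborel. x \<in> \<Omega> \<longrightarrow> (\<lambda>n. v (r n) x) \<longlonglongrightarrow> w x"
    using b[THEN conjunct2, THEN conjunct1]
    by eventually_elim (auto dest: LIMSEQ_subseq_LIMSEQ[OF _ assms(2)] simp: o_def)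
  moreover have "AE t in lborel. t \<in> {0<..<T} \<longrightarrow> (\<lambda>n. c (r n) t) \<longlonglongrightarrow> d t"
    using b[THEN conjunct2, THEN conjunct2, THEN conjunct2, THEN conjunct2, THEN conjunct2, THEN conjunct1]
    by eventually_elim (auto dest: LIMSEQ_subseq_LIMSEQ[OF _ assms(2)] simp: o_def)
  moreover have "(\<lambda>n. total_variation \<Omega> (v (r n))) \<longlonglongrightarrow> ereal \<tau>"
    using b LIMSEQ_subseq_LIMSEQ[of "\<lambda>n. total_variation \<Omega> (v n)", OF _ assms(2)] by (simp add: o_def)
  moreover have "(\<lambda>n. L2_norm T (weak_deriv T (c (r n)))) \<longlonglongrightarrow> l"
    using b LIMSEQ_subseq_LIMSEQ[of "\<lambda>n. L2_norm T (weak_deriv T (c n))", OF _ assms(2)] by (simp add: o_def)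
  ultimately show ?thesis
    using b by (simp add: BV_W12_converges_def)
qed

text \<open>Four nested extractions. In space and in time the seminorm is made convergent before the
  functions, because the compactness lemmas take a limit of seminorms as input and bound the
  seminorm of the limit by it.\<close>

lemma BV_W12_compact:
  fixes \<Omega> :: "'a::euclidean_space set"
  assumes \<Omega>: "open \<Omega>" "bounded \<Omega>" and emb: "BV_compact_in_L1 \<Omega>" and T: "0 < T"
    and v: "\<And>n. v n \<in> BV \<Omega>" and bound: "\<And>n. AE x in lborel. x \<in> \<Omega> \<longrightarrow> \<bar>v n x\<bar> \<le> 1"
    and TV_bound: "\<And>n. total_variation \<Omega> (v n) \<le> ereal B"
    and c: "\<And>n. c n \<in> W12_0 T" and c_bound: "\<And>n. L2_norm T (weak_deriv T (c n)) \<le> B'"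
  shows "\<exists>r. strict_mono (r :: nat \<Rightarrow> nat) \<and> (\<exists>w d \<tau> l. BV_W12_converges \<Omega> T (\<lambda>n. v (r n)) (\<lambda>n. c (r n)) w d \<tau> l)"
proof -
  define tv where "tv n = real_of_ereal (total_variation \<Omega> (v n))" for n
  have tv: "total_variation \<Omega> (v n) = ereal (tv n)" for n
    using TV_bound[of n] total_variation_nonneg[of \<Omega> "v n"]
    by (cases "total_variation \<Omega> (v n)") (auto simp: tv_def)
  have "bounded (range tv)"
    using TV_bound total_variation_nonneg[of \<Omega>] by (auto simp: bounded_iff tv intro!: exI[of _ B]) (metis abs_of_nonneg ereal_less_eq(3) ereal_less_eq(5) tv)
  from bounded_imp_convergent_subsequence[OF this] obtain \<tau> r1
    where r1: "strict_mono (r1 :: nat \<Rightarrow> nat)" and \<tau>: "(tv \<circ> r1) \<longlonglongrightarrow> \<tau>" by metis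
  have "(\<lambda>n. total_variation \<Omega> (v (r1 n))) \<longlonglongrightarrow> ereal \<tau>"
    using \<tau> by (simp add: tv o_def)
  then obtain r2 w where r2: "strict_mono (r2 :: nat \<Rightarrow> nat)" and w: "w \<in> BV \<Omega>"
    "AE x in lborel. x \<in> \<Omega> \<longrightarrow> (\<lambda>n. v (r1 (r2 n)) x) \<longlonglongrightarrow> w x" "total_variation \<Omega> w \<le> ereal \<tau>"
    using BV_unit_compact[OF \<Omega> emb, where v = "\<lambda>n. v (r1 n)", OF v bound TV_bound] by blast
  define q where "q n = L2_norm T (weak_deriv T (c (r1 (r2 n))))" for n
  have "bounded (range q)"
    using c_bound by (auto simp: bounded_iff q_def L2_norm_eq intro!: exI[of _ B'])
  from bounded_imp_convergent_subsequence[OF this] obtain l r3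
    where r3: "strict_mono (r3 :: nat \<Rightarrow> nat)" and l: "(q \<circ> r3) \<longlonglongrightarrow> l" by metis
  then have "(\<lambda>n. L2_norm T (weak_deriv T (c (r1 (r2 (r3 n)))))) \<longlonglongrightarrow> l"
    by (simp add: q_def o_def)
  then obtain r4 d where r4: "strict_mono (r4 :: nat \<Rightarrow> nat)" and d: "d \<in> W12_0 T"
    "AE t in lborel. t \<in> {0<..<T} \<longrightarrow> (\<lambda>n. c (r1 (r2 (r3 (r4 n)))) t) \<longlonglongrightarrow> d t"
    "L2_norm T (weak_deriv T d) \<le> l"
    using W12_0_compact[OF T, where c = "\<lambda>n. c (r1 (r2 (r3 n)))", OF c] by blast
  have r34: "strict_mono (r3 \<circ> r4)" and r234: "strict_mono (r2 \<circ> (r3 \<circ> r4))"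
    using r2 r3 r4 by (simp_all add: strict_mono_o)
  have "AE x in lborel. x \<in> \<Omega> \<longrightarrow> (\<lambda>n. v (r1 (r2 (r3 (r4 n)))) x) \<longlonglongrightarrow> w x"
    using w(2) by eventually_elim (auto dest: LIMSEQ_subseq_LIMSEQ[OF _ r34, unfolded o_def])
  moreover have "(\<lambda>n. total_variation \<Omega> (v (r1 (r2 (r3 (r4 n)))))) \<longlonglongrightarrow> ereal \<tau>"
    using LIMSEQ_subseq_LIMSEQ[OF \<tau> r234] by (simp add: tv o_def)
  moreover have "(\<lambda>n. L2_norm T (weak_deriv T (c (r1 (r2 (r3 (r4 n))))))) \<longlonglongrightarrow> l"
    using LIMSEQ_subseq_LIMSEQ[OF l r4] by (simp add: q_def o_def)
  ultimately have "BV_W12_converges \<Omega> T (\<lambda>n. v (r1 (r2 (r3 (r4 n))))) (\<lambda>n. c (r1 (r2 (r3 (r4 n))))) w d \<tau> l"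
    using w d by (simp add: BV_W12_converges_def)
  moreover have "strict_mono (\<lambda>n. r1 (r2 (r3 (r4 n))))"
    using strict_mono_o[OF r1 r234] by (simp add: o_def)
  ultimately show ?thesis by blast
qed

text \<open>Covers the case of an infinite infimum. The energy of the witness is irrelevant; its
  sinogram is 0, so it is infinite as soon as the set of lines has positive measure.\<close>

lemma admissible_nonempty:
  fixes \<Omega> :: "'a::euclidean_space set"
  assumes "open \<Omega>" "bounded \<Omega>" "0 < T" "1 \<le> K"
  shows "admissible \<Omega> T K \<noteq> {}"
proof -
  have "set_integrable lborel \<Omega> (\<lambda>x. a :: real)" for a
    unfolding set_integrable_def using assms emeasure_bounded_finite[OF assms(2)]
    by (auto intro!: integrable_real_indicator)
  then have BV: "(\<lambda>x. a) \<in> BV \<Omega>" for a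
    using total_variation_const[of \<Omega> a] by (auto simp: BV_def)
  have "(\<lambda>k x. if k = 1 then 1 else 0, \<lambda>k t. 0) \<in> admissible \<Omega> T K"
    using BV zero_in_W12_0[OF assms(3)] assms(4)
    by (auto simp: admissible_def partition_constraint_def sum.delta)
  then show ?thesis by blast
qed

section \<open>The minimizing sequence and its limit\<close>

context radon_setting
begin

lemma minimizer_exists:
  assumes spect: "dynamic_spect coll \<Omega> \<Sigma> T K \<mu> g"
    and coeffs: "0 < \<alpha>" "0 \<le> \<beta>" "0 < \<delta>"
  shows "\<exists>(u, c) \<in> admissible \<Omega> T K. \<forall>(u', c') \<in> admissible \<Omega> T K.
    J line coll \<Omega> \<Sigma> T K \<mu> g \<alpha> \<beta> \<delta> u c \<le> J line coll \<Omega> \<Sigma> T K \<mu> g \<alpha> \<beta> \<delta> u' c'"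
proof -
  interpret dynamic_spect coll \<Omega> \<Sigma> T K \<mu> g by fact
  let ?J = "\<lambda>z. J line coll \<Omega> \<Sigma> T K \<mu> g \<alpha> \<beta> \<delta> (fst z) (snd z)"
  let ?KL = "\<lambda>z. KL \<Sigma> T (radon line coll \<Omega> \<mu> (image_seq K (fst z) (snd z))) g"
  let ?Adm = "admissible \<Omega> T K"
  \<comment> \<open>On admissible pairs the variations are finite, so this part of \<open>J\<close>
    is a real number and can be subtracted; only the Kullback-Leibler part may be infinite.\<close>
  define reg where "reg z = \<alpha> * (\<Sum>k=1..K. real_of_ereal (total_variation \<Omega> (fst z k)))
    + \<beta> * (\<Sum>k=1..K. L1_norm \<Omega> (fst z k))
    + \<delta> / 2 * (\<Sum>k=1..K. (L2_norm T (weak_deriv T (snd z k)))\<^sup>2)"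
    for z :: "(nat \<Rightarrow> 'a \<Rightarrow> real) \<times> (nat \<Rightarrow> real \<Rightarrow> real)"
  have adm: "fst z k \<in> BV \<Omega>" "AE x in lborel. x \<in> \<Omega> \<longrightarrow> \<bar>fst z k x\<bar> \<le> 1" "snd z k \<in> W12_0 T"
    "AE x in lborel. x \<in> \<Omega> \<longrightarrow> (\<Sum>k=1..K. fst z k x) = 1 \<and> (\<forall>k\<in>{1..K}. fst z k x \<in> {0..1})"
    "AE t in lborel. t \<in> {0<..<T} \<longrightarrow> 0 \<le> snd z k t"
    if "z \<in> ?Adm" "k \<in> {1..K}" for z k
  proof -
    have *: "fst z \<in> partition_constraint \<Omega> K" "snd z k \<in> W12_0 T"
      "AE t in lborel. t \<in> {0<..<T} \<longrightarrow> 0 \<le> snd z k t"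
      using that by (cases z; simp add: admissible_def)+
    then show "fst z k \<in> BV \<Omega>" "snd z k \<in> W12_0 T"
      "AE t in lborel. t \<in> {0<..<T} \<longrightarrow> 0 \<le> snd z k t"
      using that(2) by (auto simp: partition_constraint_def)
    show "AE x in lborel. x \<in> \<Omega> \<longrightarrow> (\<Sum>k=1..K. fst z k x) = 1 \<and> (\<forall>k\<in>{1..K}. fst z k x \<in> {0..1})"
      using *(1) by (simp add: partition_constraint_def)
    then show "AE x in lborel. x \<in> \<Omega> \<longrightarrow> \<bar>fst z k x\<bar> \<le> 1"
      by eventually_elim (use that(2) in auto)
  qed
  have tv: "total_variation \<Omega> (fst z k) = ereal (real_of_ereal (total_variation \<Omega> (fst z k)))"
    "0 \<le> real_of_ereal (total_variation \<Omega> (fst z k))"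
    if "z \<in> ?Adm" "k \<in> {1..K}" for z k
  proof -
    have "total_variation \<Omega> (fst z k) < \<infinity>" "0 \<le> total_variation \<Omega> (fst z k)"
      using adm(1)[OF that] total_variation_nonneg by (auto simp: BV_def)
    then show "total_variation \<Omega> (fst z k) = ereal (real_of_ereal (total_variation \<Omega> (fst z k)))"
      "0 \<le> real_of_ereal (total_variation \<Omega> (fst z k))"
      by (auto simp: ereal_real real_of_ereal_pos)
  qed
  have L1_nonneg: "0 \<le> L1_norm \<Omega> f" for f
    unfolding L1_norm_def set_lebesgue_integral_def by (intro integral_nonneg_AE AE_I2) simp
  have J_eq: "?J z = enn2ereal (?KL z) + ereal (reg z)" if "z \<in> ?Adm" for z
  proof -
    have "(\<Sum>k=1..K. total_variation \<Omega> (fst z k)) = (\<Sum>k=1..K. ereal (real_of_ereal (total_variation \<Omega> (fst z k))))"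
      by (intro sum.cong refl tv(1)[OF that])
    then have "(\<Sum>k=1..K. total_variation \<Omega> (fst z k)) = ereal (\<Sum>k=1..K. real_of_ereal (total_variation \<Omega> (fst z k)))"
      by (simp only: sum_ereal)
    then show ?thesis
      unfolding J_def reg_def by (simp only: times_ereal.simps plus_ereal.simps(1)[symmetric] add.assoc)
  qed
  have tv_le: "\<alpha> * real_of_ereal (total_variation \<Omega> (fst z k)) \<le> reg z"
    and wd_le: "\<delta> / 2 * (L2_norm T (weak_deriv T (snd z k)))\<^sup>2 \<le> reg z"
    and reg_nonneg: "0 \<le> reg z"
    if "z \<in> ?Adm" "k \<in> {1..K}" for z k
  proof -
    have a: "real_of_ereal (total_variation \<Omega> (fst z k)) \<le> (\<Sum>k=1..K. real_of_ereal (total_variation \<Omega> (fst z k)))"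
      using that tv(2) by (intro member_le_sum) auto
    have b: "0 \<le> (\<Sum>k=1..K. L1_norm \<Omega> (fst z k))" using L1_nonneg by (intro sum_nonneg) auto
    have c: "(L2_norm T (weak_deriv T (snd z k)))\<^sup>2 \<le> (\<Sum>k=1..K. (L2_norm T (weak_deriv T (snd z k)))\<^sup>2)"
      using that by (intro member_le_sum) auto
    have a': "\<alpha> * real_of_ereal (total_variation \<Omega> (fst z k)) \<le> \<alpha> * (\<Sum>k=1..K. real_of_ereal (total_variation \<Omega> (fst z k)))"
      using a coeffs by (intro mult_left_mono) auto
    have b': "0 \<le> \<beta> * (\<Sum>k=1..K. L1_norm \<Omega> (fst z k))" using b coeffs by simp
    have c': "\<delta> / 2 * (L2_norm T (weak_deriv T (snd z k)))\<^sup>2 \<le> \<delta> / 2 * (\<Sum>k=1..K. (L2_norm T (weak_deriv T (snd z k)))\<^sup>2)"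
      using c coeffs by (intro mult_left_mono) auto
    have a0: "0 \<le> \<alpha> * real_of_ereal (total_variation \<Omega> (fst z k))" using tv(2)[OF that] coeffs by simp
    have c0: "0 \<le> \<delta> / 2 * (L2_norm T (weak_deriv T (snd z k)))\<^sup>2" using coeffs by simp
    show "\<alpha> * real_of_ereal (total_variation \<Omega> (fst z k)) \<le> reg z"
      "\<delta> / 2 * (L2_norm T (weak_deriv T (snd z k)))\<^sup>2 \<le> reg z" "0 \<le> reg z"
      unfolding reg_def using a' b' c' a0 c0 by linarith+
  qed
  \<comment> \<open>Some facts in \<open>adm\<close> and \<open>reg_nonneg\<close> do not mention a
    component but are stated for one; \<open>K \<ge> 1\<close> provides it.\<close>
  have one: "1 \<in> {1..K}" using K_pos by simp
  have J_nonneg: "0 \<le> ?J z" if "z \<in> ?Adm" for z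
    unfolding J_eq[OF that] using reg_nonneg[OF that one] by (intro add_nonneg_nonneg) auto
  define m where "m = (INF z\<in>?Adm. ?J z)"
  have m_le: "m \<le> ?J z" if "z \<in> ?Adm" for z
    unfolding m_def using that by (rule INF_lower)
  have "\<exists>z\<in>?Adm. ?J z \<le> m"
  proof (cases "m = \<infinity>")
    case True
    then show ?thesis
      using admissible_nonempty[OF open_domain bounded_domain T_pos K_pos] by auto
  next
    case False
    have "0 \<le> m" unfolding m_def using J_nonneg by (intro INF_greatest) auto
    with False obtain m0 where m0: "m = ereal m0" by (cases m) auto
    have "\<exists>z\<in>?Adm. ?J z < ereal (m0 + 1 / real (Suc n))" for n
    proof -
      have "m < ereal (m0 + 1 / real (Suc n))" by (simp add: m0)
      then show ?thesis unfolding m_def by (simp only: INF_less_iff)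
    qed
    then obtain z where z: "\<And>n. z n \<in> ?Adm" and zJ: "\<And>n. ?J (z n) < ereal (m0 + 1 / real (Suc n))"
      by metis
    have J_lim: "(\<lambda>n. ?J (z n)) \<longlonglongrightarrow> ereal m0"
    proof (rule tendsto_sandwich[where f = "\<lambda>_. ereal m0" and h = "\<lambda>n. ereal (m0 + 1 / real (Suc n))"])
      have "(\<lambda>n. m0 + 1 / real (Suc n)) \<longlonglongrightarrow> m0 + 0"
        by (intro tendsto_intros LIMSEQ_Suc[OF lim_1_over_n])
      then show "(\<lambda>n. ereal (m0 + 1 / real (Suc n))) \<longlonglongrightarrow> ereal m0" by simp
      show "\<forall>\<^sub>F n in sequentially. ereal m0 \<le> ?J (z n)" using m_le[OF z] by (simp add: m0)
      show "\<forall>\<^sub>F n in sequentially. ?J (z n) \<le> ereal (m0 + 1 / real (Suc n))"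
        using zJ by (intro always_eventually allI less_imp_le)
    qed simp
    have reg_le: "reg (z n) \<le> m0 + 1" for n
    proof -
      have "ereal (reg (z n)) \<le> ?J (z n)"
        unfolding J_eq[OF z] by (simp add: ereal_le_add_self2)
      also have "\<dots> < ereal (m0 + 1 / real (Suc n))" by (rule zJ)
      also have "\<dots> \<le> ereal (m0 + 1)" by simp
      finally show ?thesis by simp
    qed
    have TV_bound: "total_variation \<Omega> (fst (z n) k) \<le> ereal ((m0 + 1) / \<alpha>)" if "k \<in> {1..K}" for n k
    proof -
      have "real_of_ereal (total_variation \<Omega> (fst (z n) k)) \<le> (m0 + 1) / \<alpha>"
        using tv_le[OF z that, of n] reg_le[of n] coeffs by (simp add: field_simps)
      then show ?thesis using tv(1)[OF z that, of n] by (metis ereal_less_eq(3))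
    qed
    have wd_bound: "L2_norm T (weak_deriv T (snd (z n) k)) \<le> sqrt (2 * (m0 + 1) / \<delta>)" if "k \<in> {1..K}" for n k
    proof (rule real_le_rsqrt)
      show "(L2_norm T (weak_deriv T (snd (z n) k)))\<^sup>2 \<le> 2 * (m0 + 1) / \<delta>"
        using wd_le[OF z that, of n] reg_le[of n] coeffs by (simp add: field_simps)
    qed
    \<comment> \<open>The limits are existentially bound, so \<open>P k\<close> is a property of the
      subsequence alone and survives further refinement.\<close>
    define P where "P k s = (\<exists>w d \<tau> l. BV_W12_converges \<Omega> T (\<lambda>n. fst (z (s n)) k) (\<lambda>n. snd (z (s n)) k) w d \<tau> l)"
      for k and s :: "nat \<Rightarrow> nat"
    have "\<exists>s. strict_mono (s :: nat \<Rightarrow> nat) \<and> (\<forall>k\<in>{1..K}. P k s)"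
    proof (rule finite_diagonal_subseq)
      fix k and s :: "nat \<Rightarrow> nat" assume k: "k \<in> {1..K}"
      show "\<exists>r. strict_mono r \<and> P k (s \<circ> r)"
        unfolding P_def o_def
        by (rule BV_W12_compact[OF open_domain bounded_domain compact_embedding T_pos])
          (use adm[OF z k] TV_bound[OF k] wd_bound[OF k] in auto)
    next
      fix k and s r :: "nat \<Rightarrow> nat" assume "P k s" "strict_mono r"
      then show "P k (s \<circ> r)" unfolding P_def o_def using BV_W12_converges_subseq by fast
    qed simp
    then obtain s where s: "strict_mono (s :: nat \<Rightarrow> nat)" and "\<forall>k\<in>{1..K}. P k s" by blast
    then obtain w d \<tau> l where conv: "\<And>k. k \<in> {1..K} \<Longrightarrow>
        BV_W12_converges \<Omega> T (\<lambda>n. fst (z (s n)) k) (\<lambda>n. snd (z (s n)) k) (w k) (d k) (\<tau> k) (l k)"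
      unfolding P_def by metis
    note C = conv[unfolded BV_W12_converges_def]
    have w_lim: "AE x in lborel. \<forall>k\<in>{1..K}. x \<in> \<Omega> \<longrightarrow> (\<lambda>n. fst (z (s n)) k x) \<longlonglongrightarrow> w k x"
      using C by (intro AE_finite_allI) auto
    have d_lim: "AE t in lborel. \<forall>k\<in>{1..K}. t \<in> {0<..<T} \<longrightarrow> (\<lambda>n. snd (z (s n)) k t) \<longlonglongrightarrow> d k t"
      using C by (intro AE_finite_allI) auto
    have wd_adm: "(w, d) \<in> ?Adm"
    proof -
      have "AE x in lborel. \<forall>n. x \<in> \<Omega> \<longrightarrow> (\<Sum>k=1..K. fst (z (s n)) k x) = 1 \<and> (\<forall>k\<in>{1..K}. fst (z (s n)) k x \<in> {0..1})"
        unfolding AE_all_countable using adm(4)[OF z one] by blast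
      with w_lim have "AE x in lborel. x \<in> \<Omega> \<longrightarrow> (\<Sum>k=1..K. w k x) = 1 \<and> (\<forall>k\<in>{1..K}. w k x \<in> {0..1})"
      proof eventually_elim
        case (elim x)
        show ?case
        proof (intro impI conjI ballI)
          assume x: "x \<in> \<Omega>"
          have "(\<lambda>n. \<Sum>k=1..K. fst (z (s n)) k x) \<longlonglongrightarrow> (\<Sum>k=1..K. w k x)"
            using elim(1) x by (intro tendsto_sum) auto
          moreover have "(\<lambda>n. \<Sum>k=1..K. fst (z (s n)) k x) = (\<lambda>n. 1)" using elim(2) x by auto
          ultimately show "(\<Sum>k=1..K. w k x) = 1" by (simp only: LIMSEQ_const_iff)
          fix k assume k: "k \<in> {1..K}"
          have "(\<lambda>n. fst (z (s n)) k x) \<longlonglongrightarrow> w k x" using elim(1) x k by blast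
          moreover have "fst (z (s n)) k x \<in> {0..1}" for n using elim(2) x k by blast
          ultimately show "w k x \<in> {0..1}"
            using closed_sequentially[of "{0..1}" "\<lambda>n. fst (z (s n)) k x"] closed_atLeastAtMost by blast
        qed
      qed
      moreover have "AE t in lborel. t \<in> {0<..<T} \<longrightarrow> 0 \<le> d k t" if k: "k \<in> {1..K}" for k
      proof -
        have "AE t in lborel. \<forall>n. t \<in> {0<..<T} \<longrightarrow> 0 \<le> snd (z (s n)) k t"
          unfolding AE_all_countable using adm(5)[OF z k] by blast
        with d_lim show ?thesis
          by eventually_elim (use k in \<open>blast intro: LIMSEQ_le_const\<close>)
      qed
      ultimately show ?thesis
        using C by (auto simp: admissible_def partition_constraint_def)
    qed
    \<comment> \<open>The limit of \<open>reg\<close> along the subsequence, built from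
      \<open>\<tau>\<close> and \<open>l\<close>. At the limit pair \<open>reg\<close> can drop
      below it, which only helps.\<close>
    define reg' where "reg' = \<alpha> * (\<Sum>k=1..K. \<tau> k) + \<beta> * (\<Sum>k=1..K. L1_norm \<Omega> (w k)) + \<delta> / 2 * (\<Sum>k=1..K. (l k)\<^sup>2)"
    have TV_lim: "(\<lambda>n. real_of_ereal (total_variation \<Omega> (fst (z (s n)) k))) \<longlonglongrightarrow> \<tau> k" if "k \<in> {1..K}" for k
      by (rule lim_real_of_ereal) (use C[OF that] in blast)
    have L1_lim: "(\<lambda>n. L1_norm \<Omega> (fst (z (s n)) k)) \<longlonglongrightarrow> L1_norm \<Omega> (w k)" if "k \<in> {1..K}" for k
      by (rule L1_norm_tendsto[OF open_domain bounded_domain BV_measurable[OF adm(1)[OF z that]]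
            BV_measurable adm(2)[OF z that]]) (use C[OF that] in blast)+
    have wd_lim: "(\<lambda>n. L2_norm T (weak_deriv T (snd (z (s n)) k))) \<longlonglongrightarrow> l k" if "k \<in> {1..K}" for k
      using C[OF that] by blast
    have reg_lim: "(\<lambda>n. reg (z (s n))) \<longlonglongrightarrow> reg'"
      unfolding reg_def reg'_def
      by (intro tendsto_add tendsto_mult_left tendsto_sum tendsto_power TV_lim L1_lim wd_lim)
    have reg_wd: "reg (w, d) \<le> reg'"
      unfolding reg_def reg'_def fst_conv snd_conv
    proof (intro add_mono mult_left_mono sum_mono order_refl)
      fix k assume k: "k \<in> {1..K}"
      have "ereal (real_of_ereal (total_variation \<Omega> (w k))) \<le> ereal (\<tau> k)"
        using tv(1)[OF wd_adm k] C[OF k] by simp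
      then show "real_of_ereal (total_variation \<Omega> (w k)) \<le> \<tau> k" by simp
      show "(L2_norm T (weak_deriv T (d k)))\<^sup>2 \<le> (l k)\<^sup>2"
        using C[OF k] by (intro power_mono) (auto simp: L2_norm_eq)
    qed (use coeffs in auto)
    \<comment> \<open>Both limits are finite, so the difference is well defined and forces
      convergence of the Kullback-Leibler terms.\<close>
    have "(\<lambda>n. ?J (z (s n)) - ereal (reg (z (s n)))) \<longlonglongrightarrow> ereal m0 - ereal reg'"
      using LIMSEQ_subseq_LIMSEQ[OF J_lim s] reg_lim
      by (intro tendsto_diff_ereal_general) (auto simp: o_def)
    moreover have "?J (z (s n)) - ereal (reg (z (s n))) = enn2ereal (?KL (z (s n)))" for n
      unfolding J_eq[OF z] by (cases "enn2ereal (?KL (z (s n)))") auto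
    ultimately have KL_lim: "(\<lambda>n. enn2ereal (?KL (z (s n)))) \<longlonglongrightarrow> ereal (m0 - reg')" by simp
    \<comment> \<open>A limit of nonnegative terms; hence \<open>ennreal (m0 - reg')\<close>
      truncates nothing.\<close>
    then have "0 \<le> ereal (m0 - reg')"
      by (rule LIMSEQ_le_const) simp
    then have KL_val: "ereal (m0 - reg') = enn2ereal (ennreal (m0 - reg'))" by simp
    have KL_lim': "(\<lambda>n. ?KL (z (s n))) \<longlonglongrightarrow> ennreal (m0 - reg')"
      using KL_lim unfolding KL_val tendsto_enn2ereal_iff .
    have "?KL (w, d) \<le> ennreal (m0 - reg')"
      unfolding fst_conv snd_conv
    proof (rule KL_lower_semicontinuous[OF lines_meas data_meas data_pos _ _ KL_lim'])
      fix n
      have c: "set_borel_measurable lborel {0<..<T} (snd (z (s n)) k)" if "k \<in> {1..K}" for k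
        using adm(3)[OF z that] by (auto simp: W12_0_def W12_def L2_def)
      show "\<exists>G\<in>borel_measurable borel. \<forall>p t. t \<in> {0<..<T} \<longrightarrow>
          radon line coll \<Omega> \<mu> (image_seq K (fst (z (s n))) (snd (z (s n)))) (p, t) = G (p, t)"
        by (rule radon_image_seq_measurable[OF BV_measurable[OF adm(1)[OF z[of "s n"]]] c]) blast+
    next
      have "AE p in lborel. \<forall>t. (\<forall>k\<in>{1..K}. (\<lambda>n. snd (z (s n)) k t) \<longlonglongrightarrow> d k t) \<longrightarrow>
          (\<lambda>n. radon line coll \<Omega> \<mu> (image_seq K (fst (z (s n))) (snd (z (s n)))) (p, t)) \<longlonglongrightarrow>
          radon line coll \<Omega> \<mu> (image_seq K w d) (p, t)"
        by (rule radon_image_seq_tendsto[OF BV_measurable[OF adm(1)[OF z]] BV_measurable adm(2)[OF z]])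
          (use C in blast)+
      then show "AE p in lborel. AE t in lborel. t \<in> {0<..<T} \<longrightarrow>
          (\<lambda>n. radon line coll \<Omega> \<mu> (image_seq K (fst (z (s n))) (snd (z (s n)))) (p, t)) \<longlonglongrightarrow>
          radon line coll \<Omega> \<mu> (image_seq K w d) (p, t)"
      proof eventually_elim
        case (elim p)
        show ?case using d_lim by eventually_elim (use elim in blast)
      qed
    qed
    then have "enn2ereal (?KL (w, d)) \<le> ereal (m0 - reg')"
      unfolding KL_val less_eq_ennreal.rep_eq .
    \<comment> \<open>The \<open>reg'\<close> subtracted from the infimum is added back, as a bound
      for \<open>reg (w, d)\<close>.\<close>
    from add_mono[OF this, of "ereal (reg (w, d))" "ereal reg'"] reg_wd
    have "?J (w, d) \<le> m"
      unfolding J_eq[OF wd_adm] m0 by simp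
    with wd_adm show ?thesis by blast
  qed
  then obtain u c where uc: "(u, c) \<in> ?Adm" "?J (u, c) \<le> m" by (metis surj_pair)
  show ?thesis
  proof (rule bexI[OF _ uc(1)], simp only: prod.case, rule ballI)
    fix z' assume "z' \<in> ?Adm"
    from order_trans[OF uc(2) m_le[OF this]]
    show "case z' of (u', c') \<Rightarrow> J line coll \<Omega> \<Sigma> T K \<mu> g \<alpha> \<beta> \<delta> u c \<le> J line coll \<Omega> \<Sigma> T K \<mu> g \<alpha> \<beta> \<delta> u' c'"
      by (simp add: split_beta)
  qed
qed

end

section \<open>The planar and spatial line families\<close>

lemma continuous_on_if_const:
  assumes "continuous_on S f" "continuous_on S g"
  shows "continuous_on S (\<lambda>x. if P then f x else g x)"
  using assms by (cases P) auto

lemma line_2d_family: "line_family line_2d"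
proof
  have eq: "line_2d p r = (\<chi> i. if i = 1 then r * cos (fst p) - snd p * sin (fst p)
      else r * sin (fst p) + snd p * cos (fst p))" for p r
    by (simp add: line_2d_def split_beta vec_eq_iff forall_2)
  show "continuous_on UNIV (\<lambda>z. line_2d (fst z) (snd z))"
    unfolding eq by (intro continuous_on_vec_lambda continuous_on_if_const continuous_intros)
  show "DIM(real ^ 2) \<le> DIM(real) + 1" by simp
  show "\<exists>M. linear M \<and> (\<forall>q r. M (line_2d (\<theta>, q) r) = (q, r))" for \<theta>
  proof (intro exI conjI allI)
    \<comment> \<open>The coordinates of \<open>x\<close> in the rotated orthonormal frame: first
      along the detector, then along the line.\<close>
    let ?M = "\<lambda>x::real^2. (cos \<theta> * x $ 2 - sin \<theta> * x $ 1, cos \<theta> * x $ 1 + sin \<theta> * x $ 2)"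
    show "linear ?M" by (rule linearI) (auto simp: algebra_simps)
    \<comment> \<open>Polynomial identities in sine and cosine; the Pythagorean factor is kept and
      becomes 1 afterwards.\<close>
    have "cos \<theta> * (r * sin \<theta> + q * cos \<theta>) - sin \<theta> * (r * cos \<theta> - q * sin \<theta>) = q * ((sin \<theta>)\<^sup>2 + (cos \<theta>)\<^sup>2)"
      "cos \<theta> * (r * cos \<theta> - q * sin \<theta>) + sin \<theta> * (r * sin \<theta> + q * cos \<theta>) = r * ((sin \<theta>)\<^sup>2 + (cos \<theta>)\<^sup>2)" for q r
      by algebra+
    then show "?M (line_2d (\<theta>, q) r) = (q, r)" for q r by (simp add: eq)
  qed
  show "\<bar>r\<bar> \<le> norm (line_2d p r)" for p r
  proof -
    have "line_2d p r \<bullet> line_2d p r = (r * cos (fst p) - snd p * sin (fst p))\<^sup>2 + (r * sin (fst p) + snd p * cos (fst p))\<^sup>2"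
      by (simp add: eq inner_vec_def sum_2 power2_eq_square)
    also have "\<dots> = r\<^sup>2 * ((sin (fst p))\<^sup>2 + (cos (fst p))\<^sup>2) + (snd p)\<^sup>2 * ((sin (fst p))\<^sup>2 + (cos (fst p))\<^sup>2)"
      by algebra
    finally have "r\<^sup>2 \<le> (norm (line_2d p r))\<^sup>2"
      by (simp add: power2_norm_eq_inner)
    from real_sqrt_le_mono[OF this] show ?thesis by simp
  qed
qed

lemma line_3d_family: "line_family line_3d"
proof
  have eq: "line_3d p r = (\<chi> i. if i = 1 then r * cos (fst p) - fst (snd p) * sin (fst p)
      else if i = 2 then r * sin (fst p) + fst (snd p) * cos (fst p) else snd (snd p))" for p r
    by (simp add: line_3d_def split_beta vec_eq_iff forall_3)
  show "continuous_on UNIV (\<lambda>z. line_3d (fst z) (snd z))"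
    unfolding eq by (intro continuous_on_vec_lambda continuous_on_if_const continuous_intros)
  show "DIM(real ^ 3) \<le> DIM(real \<times> real) + 1" by simp
  show "\<exists>M. linear M \<and> (\<forall>q r. M (line_3d (\<theta>, q) r) = (q, r))" for \<theta>
  proof (intro exI conjI allI)
    \<comment> \<open>The planar rotation within a slice; the height is copied into the second entry
      of the bin position.\<close>
    let ?M = "\<lambda>x::real^3. ((cos \<theta> * x $ 2 - sin \<theta> * x $ 1, x $ 3), cos \<theta> * x $ 1 + sin \<theta> * x $ 2)"
    show "linear ?M" by (rule linearI) (auto simp: algebra_simps)
    have "cos \<theta> * (r * sin \<theta> + q * cos \<theta>) - sin \<theta> * (r * cos \<theta> - q * sin \<theta>) = q * ((sin \<theta>)\<^sup>2 + (cos \<theta>)\<^sup>2)"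
      "cos \<theta> * (r * cos \<theta> - q * sin \<theta>) + sin \<theta> * (r * sin \<theta> + q * cos \<theta>) = r * ((sin \<theta>)\<^sup>2 + (cos \<theta>)\<^sup>2)" for q r
      by algebra+
    then show "?M (line_3d (\<theta>, q) r) = (q, r)" for q r by (simp add: eq)
  qed
  show "\<bar>r\<bar> \<le> norm (line_3d p r)" for p r
  proof -
    have "line_3d p r \<bullet> line_3d p r = (r * cos (fst p) - fst (snd p) * sin (fst p))\<^sup>2
        + (r * sin (fst p) + fst (snd p) * cos (fst p))\<^sup>2 + (snd (snd p))\<^sup>2"
      by (simp add: eq inner_vec_def sum_3 power2_eq_square)
    also have "\<dots> = r\<^sup>2 * ((sin (fst p))\<^sup>2 + (cos (fst p))\<^sup>2)
        + (fst (snd p))\<^sup>2 * ((sin (fst p))\<^sup>2 + (cos (fst p))\<^sup>2) + (snd (snd p))\<^sup>2"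
      by algebra
    finally have "r\<^sup>2 \<le> (norm (line_3d p r))\<^sup>2"
      by (simp add: power2_norm_eq_inner)
    from real_sqrt_le_mono[OF this] show ?thesis by simp
  qed
qed

lemma radon_settingI:
  assumes "line_family line" "dynamic_spect coll \<Omega> \<Sigma> T K \<mu> g"
  shows "radon_setting line coll \<Omega> \<mu>"
  using assms by (simp add: radon_setting_def radon_setting_axioms_def dynamic_spect_def)

theorem theorem3:
  fixes T \<alpha> \<beta> \<delta> :: real and K :: nat
  assumes "0 < \<alpha>" and "0 \<le> \<beta>" and "0 < \<delta>"
  shows "(\<forall>(\<Omega> :: (real^2) set) \<Sigma> coll \<mu> g.
            dynamic_spect coll \<Omega> \<Sigma> T K \<mu> g \<longrightarrow>
            (\<exists>(u, c) \<in> admissible \<Omega> T K. \<forall>(u', c') \<in> admissible \<Omega> T K.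
               J line_2d coll \<Omega> \<Sigma> T K \<mu> g \<alpha> \<beta> \<delta> u c
                 \<le> J line_2d coll \<Omega> \<Sigma> T K \<mu> g \<alpha> \<beta> \<delta> u' c')) \<and>
         (\<forall>(\<Omega> :: (real^3) set) \<Sigma> coll \<mu> g.
            dynamic_spect coll \<Omega> \<Sigma> T K \<mu> g \<longrightarrow>
            (\<exists>(u, c) \<in> admissible \<Omega> T K. \<forall>(u', c') \<in> admissible \<Omega> T K.
               J line_3d coll \<Omega> \<Sigma> T K \<mu> g \<alpha> \<beta> \<delta> u c
                 \<le> J line_3d coll \<Omega> \<Sigma> T K \<mu> g \<alpha> \<beta> \<delta> u' c'))"
  by (intro conjI allI impI radon_setting.minimizer_exists radon_settingI
      line_2d_family line_3d_family assms)

end
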